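(* Let $A$ be a finite-dimensional vector space, $\circ$ a binary operation on $A$, $\Delta:A\to A\otimes A$ a linear map and $\cdot$ the dual operation of $\Delta$ on $A^*$. Let $\circ_h$ be a $\mathbf{K}$-bilinear operation on $A_h$, $\Delta_h:A_h\to A_h\hat\otimes A_h$ a $\mathbf{K}$-linear map and $\cdot_h$ its topological dual operation on $A_h^\star$. (1) Assume that $(A,\circ,\Delta)$ is a commutative and cocommutative ASI bialgebra, that $(A_h,\circ_h,\Delta_h)$ is an ASI bialgebra deformation of it, and that $(A,\{,\},\circ,\delta,\Delta)$ is the QCL. Let $[,]$ denote the dual operation of $\delta$. Then $((A_h,\circ_h),(A_h^\star,\cdot_h),R^\star_{\circ_h},L^\star_{\circ_h},R^\star_{\cdot_h},L^\star_{\cdot_h})$, the matched pair of topologically free associative algebras corresponding to $(A_h,\circ_h,\Delta_h)$, is an associative matched pair deformation of $((A,\circ),(A^*,\cdot),R_\circ^*,R_\cdot^* )$, the matched pair of commutative associative algebras corresponding to $(A,\circ,\Delta)$. Moreover, $((A,\{,\},\circ),(A^*,[,],\cdot),-\mathrm{ad}^*_{\{,\}},R^*_\circ,-\mathrm{ad}^*_{[,]},R^*_\cdot)$, the matched pair of Poisson algebras corresponding to $(A,\{,\},\circ,\delta,\Delta)$, coincides with the QCL of $((A_h,\circ_h),(A_h^\star,\cdot_h),R^\star_{\circ_h},L^\star_{\circ_h},R^\star_{\cdot_h},L^\star_{\cdot_h})$. (2) Assume that $((A,\circ),(A^*,\cdot),R_\circ^*,R_\cdot^* )$ is a matched pair of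 commutative associative algebras, that $((A_h,\circ_h),(A_h^\star,\cdot_h),R^\star_{\circ_h},L^\star_{\circ_h},R^\star_{\cdot_h},L^\star_{\cdot_h})$ is an associative matched pair deformation of it, and that the QCL is $((A,\{,\},\circ),(A^*,[,],\cdot),\rho_{\{,\}},R^*_\circ,\rho_{[,]},R^*_\cdot)$. Then $(A_h,\circ_h,\Delta_h)$, the topologically free ASI bialgebra corresponding to $((A_h,\circ_h),(A_h^\star,\cdot_h),R^\star_{\circ_h},L^\star_{\circ_h},R^\star_{\cdot_h},L^\star_{\cdot_h})$, is an ASI bialgebra deformation of $(A,\circ,\Delta)$, the commutative and cocommutative ASI bialgebra corresponding to $((A,\circ),(A^*,\cdot),R_\circ^*,R_\cdot^* )$. Moreover, the Poisson bialgebra corresponding to the matched pair of Poisson algebras $((A,\{,\},\circ),(A^*,[,],\cdot),-\mathrm{ad}^*_{\{,\}},R^*_\circ,-\mathrm{ad}^*_{[,]},R^*_\cdot)$ coincides with the QCL of $(A_h,\circ_h,\Delta_h)$.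
   Context: Conventions. $\mathbf{k}$ is a field of characteristic $0$, $\mathbf{K}=\mathbf{k}[[h]]$; vector spaces, algebras, tensor products are over $\mathbf{k}$; no units/counits required; binary operations are bilinear. $V_h:=V[[h]]\supset V$; $\equiv\pmod h$ means equality modulo $hV_h$. Topologically free $\mathbf{K}$-module: isomorphic to some $V[[h]]$. $\hat\otimes$ is the $h$-adic completion of $\otimes_{\mathbf{K}}$, so $V_h\hat\otimes W_h\cong(V\otimes W)[[h]]$. $\sigma$, $\sigma_{\mathbf{K}}$ are the flips on $A\otimes A$, $A_h\hat\otimes A_h$. $L_\circ(x)y=x\circ y$, $R_\circ(x)y=y\circ x$, $\mathrm{ad}_{\{,\}}(x)y=\{x,y\}$. Duals. $V^*=\mathrm{Hom}_{\mathbf{k}}(V,\mathbf{k})$ with pairing $\langle,\rangle$. For $\varrho:A\to\mathrm{End}(V)$ linear, $\varrho^*:A\to\mathrm{End}(V^* )$ is $\langle\varrho^*(x)u^*,v\rangle=\langle u^*,\varrho(x)v\rangle$ (no sign). $V_h^\star:=(V^* )_h\cong\mathrm{Hom}_{\mathbf{K}}(V_h,\mathbf{K})$ with the $\mathbf{K}$-bilinear pairing $\langle,\rangle_{\mathbf{K}}$ extending $\langle,\rangle$; for $\varrho_h:A_h\to\mathrm{End}_{\mathbf{K}}(V_h)$, $\varrho_h^\star:A_h\to\mathrm{End}_{\mathbf{K}}(V_h^\star)$ is $\langle\varrho_h^\star(x')u^\star,v'\rangle_{\mathbf{K}}=\langle u^\star,\varrho_h(x')v'\rangle_{\mathbf{K}}$.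 For $A$ finite-dimensional, $A^{**}=A$ and $(A_h^\star)^\star=A_h$. Dual operation of a linear map $\Delta:A\to A\otimes A$: the operation $\cdot$ on $A^*$ with $\langle a^*\cdot b^*,x\rangle=\langle a^*\otimes b^*,\Delta(x)\rangle$ (similarly $[,]$ for $\delta$). Topological dual operation of $\Delta_h$: $\cdot_h$ on $A_h^\star$ with $\langle a^\star\cdot_h b^\star,x_h\rangle_{\mathbf{K}}=\langle a^\star\hat\otimes b^\star,\Delta_h(x_h)\rangle_{\mathbf{K}}$. ASI bialgebra $(A,\circ,\Delta)$: $\circ$ associative, $\Delta$ coassociative, and for all $x,y$: $\Delta(x\circ y)=(\mathrm{id}\otimes L_\circ(x))\Delta(y)+(R_\circ(y)\otimes\mathrm{id})\Delta(x)$, $(L_\circ(y)\otimes\mathrm{id}-\mathrm{id}\otimes R_\circ(y))\Delta(x)+\sigma\big((L_\circ(x)\otimes\mathrm{id}-\mathrm{id}\otimes R_\circ(x))\Delta(y)\big)=0$; commutative and cocommutative if $\circ$ is commutative and $\Delta=\sigma\Delta$. Topologically free ASI bialgebra $(A_h,\circ_h,\Delta_h)$: $A_h$ a topologically free $\mathbf{K}$-module, $\circ_h$ associative $\mathbf{K}$-bilinear, $\Delta_h:A_h\to A_h\hat\otimes A_h$ coassociative $\mathbf{K}$-linear, satisfying the same two identities for all $x_h,y_h\in A_h$ with $\circ_h,\Delta_h,\hat\otimes,\sigma_{\mathbf{K}}$ in place of $\circ,\Delta,\otimes,\sigma$. ASI bialgebra deformation of $(A,\circ,\Delta)$: a topologically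 free ASI bialgebra with $A_h=A[[h]]$, $x\circ_h y\equiv x\circ y$, $\Delta_h(x)\equiv\Delta(x)\pmod h$ for $x,y\in A$. Its QCL, in the commutative and cocommutative case, is $(A,\{,\},\circ,\delta,\Delta)$ with $\{x,y\}\equiv\frac{x\circ_h y-y\circ_h x}{h}$, $\delta(x)\equiv\frac{\Delta_h(x)-\sigma_{\mathbf{K}}\Delta_h(x)}{h}\pmod h$. Associative deformation of $(A,\circ)$: an associative $\mathbf{K}$-bilinear $\circ_h$ on $A_h=A[[h]]$ with $x\circ_h y\equiv x\circ y\pmod h$ on $A$; for $\circ$ commutative its QCL is $(A,\{,\},\circ)$ with $\{x,y\}\equiv\frac{x\circ_h y-y\circ_h x}{h}\pmod h$ for all $x,y\in A$. Matched pair of associative algebras $((A,\circ),(B,\cdot),l_\circ,r_\circ,l_\cdot,r_\cdot)$: associative algebras and linear maps $l_\circ,r_\circ:A\to\mathrm{End}(B)$, $l_\cdot,r_\cdot:B\to\mathrm{End}(A)$ such that $(x,u)\odot(y,v)=(x\circ y+l_\cdot(u)y+r_\cdot(v)x,\ l_\circ(x)v+r_\circ(y)u+u\cdot v)$ is associative on $A\oplus B$ (algebra denoted $A\bowtie_{l_\cdot,r_\cdot}^{l_\circ,r_\circ}B$). If $A$, $B$, $A\bowtie B$ are commutative then $l_\circ=r_\circ=:\rho_\circ$, $l_\cdot=r_\cdot=:\rho_\cdot$, and $((A,\circ),(B,\cdot),\rho_\circ,\rho_\cdot)$ is called a matched pair of commutative associative algebras. Matched pairs of topologically free associative algebras: same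 over $\mathbf{K}$ with topologically free associative algebras and $\mathbf{K}$-linear maps. Associative matched pair deformation: a matched pair of topologically free associative algebras with $A_h=A[[h]]$, $B_h=B[[h]]$ whose algebra on $A_h\oplus B_h=(A\oplus B)_h$ is an associative deformation of $A\bowtie_{l_\cdot,r_\cdot}^{l_\circ,r_\circ}B$. Its QCL (commutative case) is $((A,\{,\},\circ),(B,[,],\cdot),\rho_{\{,\}},\rho_\circ,\rho_{[,]},\rho_\cdot)$, with $(A,\{,\},\circ),(B,[,],\cdot)$ the QCLs of $(A_h,\circ_h),(B_h,\cdot_h)$ and $\rho_{\{,\}}(x)v\equiv\frac{l_{\circ_h}(x)v-r_{\circ_h}(x)v}{h}$, $\rho_{[,]}(v)x\equiv\frac{l_{\cdot_h}(v)x-r_{\cdot_h}(v)x}{h}\pmod h$. Poisson algebra: Lie bracket $\{,\}$ and commutative associative $\circ$ with $\{x,y\circ z\}=\{x,y\}\circ z+y\circ\{x,z\}$. Matched pair of Poisson algebras $((P,\{,\},\circ),(Q,[,],\cdot),\rho_{\{,\}},\rho_\circ,\rho_{[,]},\rho_\cdot)$: $P\oplus Q$ with $\llbracket(x,u),(y,v)\rrbracket=(\{x,y\}+\rho_{[,]}(u)y-\rho_{[,]}(v)x,\rho_{\{,\}}(x)v-\rho_{\{,\}}(y)u+[u,v])$ and $(x,u)\odot(y,v)=(x\circ y+\rho_\cdot(u)y+\rho_\cdot(v)x,\rho_\circ(x)v+\rho_\circ(y)u+u\cdot v)$ is a Poisson algebra. Lie coalgebra: $\delta=-\sigma\delta$,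 $(\mathrm{id}+\tau+\tau^2)(\mathrm{id}\otimes\delta)\delta=0$, $\tau(x\otimes y\otimes z)=z\otimes x\otimes y$. Lie bialgebra: Lie algebra and Lie coalgebra with $\delta(\{x,y\})=(\mathrm{ad}(x)\otimes\mathrm{id}+\mathrm{id}\otimes\mathrm{ad}(x))\delta(y)-(\mathrm{ad}(y)\otimes\mathrm{id}+\mathrm{id}\otimes\mathrm{ad}(y))\delta(x)$. Poisson coalgebra $(A,\delta,\Delta)$: Lie coalgebra $\delta$, cocommutative coassociative $\Delta$, $(\mathrm{id}\otimes\Delta)\delta=(\delta\otimes\mathrm{id})\Delta+(\sigma\otimes\mathrm{id})(\mathrm{id}\otimes\delta)\Delta$. Poisson bialgebra $(A,\{,\},\circ,\delta,\Delta)$: Poisson algebra $(A,\{,\},\circ)$, Lie bialgebra $(A,\{,\},\delta)$, Poisson coalgebra $(A,\delta,\Delta)$, commutative cocommutative ASI bialgebra $(A,\circ,\Delta)$, with $\delta(x\circ y)=(L_\circ(y)\otimes\mathrm{id})\delta(x)+(L_\circ(x)\otimes\mathrm{id})\delta(y)+(\mathrm{id}\otimes\mathrm{ad}(x))\Delta(y)+(\mathrm{id}\otimes\mathrm{ad}(y))\Delta(x)$ and $\Delta(\{x,y\})=(\mathrm{ad}(x)\otimes\mathrm{id}+\mathrm{id}\otimes\mathrm{ad}(x))\Delta(y)+(L_\circ(y)\otimes\mathrm{id}-\mathrm{id}\otimes L_\circ(y))\delta(x)$. "Corresponding" (for $A$ finite-dimensional, via dual operations): the (commutative and cocommutative) ASI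 bialgebra $(A,\circ,\Delta)$ corresponds to the matched pair $((A,\circ),(A^*,\cdot),R^*_\circ,L^*_\circ,R^*_\cdot,L^*_\cdot)$ (resp. $((A,\circ),(A^*,\cdot),R^*_\circ,R^*_\cdot)$); the topologically free ASI bialgebra $(A_h,\circ_h,\Delta_h)$ corresponds to $((A_h,\circ_h),(A_h^\star,\cdot_h),R^\star_{\circ_h},L^\star_{\circ_h},R^\star_{\cdot_h},L^\star_{\cdot_h})$; the Poisson bialgebra $(A,\{,\},\circ,\delta,\Delta)$ corresponds to $((A,\{,\},\circ),(A^*,[,],\cdot),-\mathrm{ad}^*_{\{,\}},R^*_\circ,-\mathrm{ad}^*_{[,]},R^*_\cdot)$, where $\cdot,\cdot_h,[,]$ are the (topological) dual operations of $\Delta,\Delta_h,\delta$. In each case one side is an object of its type if and only if the other is. *)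

theory Defs
  imports
    "HOL-Library.Function_Algebras"
    "HOL-Library.Product_Plus"
    "HOL-Computational_Algebra.Formal_Power_Series"
begin

section \<open>Linear maps and operations on subspaces\<close>

text \<open>
  A module is given by a scalar multiplication on an ambient additive group together with a
  carrier that is a submodule. The space \<open>A\<close> of the main result is a whole type, with carrier
  \<open>UNIV\<close>; its dual is a proper subspace of the type of all functions from \<open>A\<close> to the field.
  The scalars range over a commutative ring, so that the same notions serve for a field \<open>k\<close> and for
  \<open>K = k[[h]]\<close>, the latter being the type \<open>'k fps\<close> with \<open>h\<close> written \<^const>\<open>fps_X\<close>.
\<close>

definition submodule :: "('r::comm_ring_1 \<Rightarrow> 'v::ab_group_add \<Rightarrow> 'v) \<Rightarrow> 'v set \<Rightarrow> bool" where
  "submodule s V \<longleftrightarrow> module s \<and> module.subspace s V"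

definition linear_on ::
  "('r::comm_ring_1 \<Rightarrow> 'v::ab_group_add \<Rightarrow> 'v) \<Rightarrow> 'v set \<Rightarrow>
   ('r \<Rightarrow> 'w::ab_group_add \<Rightarrow> 'w) \<Rightarrow> 'w set \<Rightarrow> ('v \<Rightarrow> 'w) \<Rightarrow> bool" where
  "linear_on s V t W f \<longleftrightarrow>
     (\<forall>x\<in>V. f x \<in> W) \<and>
     (\<forall>x\<in>V. \<forall>y\<in>V. f (x + y) = f x + f y) \<and>
     (\<forall>c. \<forall>x\<in>V. f (s c x) = t c (f x))"

text \<open>
  By currying, \<open>bilinear_on s V t W t W \<rho>\<close> also says that \<open>\<rho>\<close> is a linear map from \<open>V\<close> to
  \<open>End(W)\<close>.
\<close>

definition bilinear_on ::
  "('r::comm_ring_1 \<Rightarrow> 'v::ab_group_add \<Rightarrow> 'v) \<Rightarrow> 'v set \<Rightarrow>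
   ('r \<Rightarrow> 'w::ab_group_add \<Rightarrow> 'w) \<Rightarrow> 'w set \<Rightarrow>
   ('r \<Rightarrow> 'u::ab_group_add \<Rightarrow> 'u) \<Rightarrow> 'u set \<Rightarrow> ('v \<Rightarrow> 'w \<Rightarrow> 'u) \<Rightarrow> bool" where
  "bilinear_on s V t W u U f \<longleftrightarrow>
     (\<forall>x\<in>V. linear_on t W u U (f x)) \<and>
     (\<forall>y\<in>W. linear_on s V u U (\<lambda>x. f x y))"

abbreviation binary_operation ::
  "('r::comm_ring_1 \<Rightarrow> 'v::ab_group_add \<Rightarrow> 'v) \<Rightarrow> 'v set \<Rightarrow> ('v \<Rightarrow> 'v \<Rightarrow> 'v) \<Rightarrow> bool" where
  "binary_operation s V m \<equiv> bilinear_on s V s V s V m"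

definition commutative_on :: "'v set \<Rightarrow> ('v \<Rightarrow> 'v \<Rightarrow> 'v) \<Rightarrow> bool" where
  "commutative_on V m \<longleftrightarrow> (\<forall>x\<in>V. \<forall>y\<in>V. m x y = m y x)"

definition assoc_algebra ::
  "('r::comm_ring_1 \<Rightarrow> 'v::ab_group_add \<Rightarrow> 'v) \<Rightarrow> 'v set \<Rightarrow> ('v \<Rightarrow> 'v \<Rightarrow> 'v) \<Rightarrow> bool" where
  "assoc_algebra s V m \<longleftrightarrow> submodule s V \<and> binary_operation s V m \<and>
     (\<forall>x\<in>V. \<forall>y\<in>V. \<forall>z\<in>V. m (m x y) z = m x (m y z))"

definition lie_algebra ::
  "('r::comm_ring_1 \<Rightarrow> 'v::ab_group_add \<Rightarrow> 'v) \<Rightarrow> 'v set \<Rightarrow> ('v \<Rightarrow> 'v \<Rightarrow> 'v) \<Rightarrow> bool" where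
  "lie_algebra s V br \<longleftrightarrow> submodule s V \<and> binary_operation s V br \<and>
     (\<forall>x\<in>V. br x x = 0) \<and>
     (\<forall>x\<in>V. \<forall>y\<in>V. \<forall>z\<in>V. br x (br y z) + br y (br z x) + br z (br x y) = 0)"

definition poisson_algebra ::
  "('r::comm_ring_1 \<Rightarrow> 'v::ab_group_add \<Rightarrow> 'v) \<Rightarrow> 'v set \<Rightarrow>
   ('v \<Rightarrow> 'v \<Rightarrow> 'v) \<Rightarrow> ('v \<Rightarrow> 'v \<Rightarrow> 'v) \<Rightarrow> bool" where
  "poisson_algebra s V br m \<longleftrightarrow>
     lie_algebra s V br \<and> assoc_algebra s V m \<and> commutative_on V m \<and>
     (\<forall>x\<in>V. \<forall>y\<in>V. \<forall>z\<in>V. br x (m y z) = m (br x y) z + m y (br x z))"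

definition mult_left :: "('v \<Rightarrow> 'v \<Rightarrow> 'v) \<Rightarrow> 'v \<Rightarrow> 'v \<Rightarrow> 'v" where
  "mult_left m x y = m x y"

definition mult_right :: "('v \<Rightarrow> 'v \<Rightarrow> 'v) \<Rightarrow> 'v \<Rightarrow> 'v \<Rightarrow> 'v" where
  "mult_right m x y = m y x"

abbreviation (input) ad :: "('v \<Rightarrow> 'v \<Rightarrow> 'v) \<Rightarrow> 'v \<Rightarrow> 'v \<Rightarrow> 'v" where
  "ad br \<equiv> mult_left br"


section \<open>Matched pairs\<close>

definition sum_scale :: "('r \<Rightarrow> 'a \<Rightarrow> 'a) \<Rightarrow> ('r \<Rightarrow> 'b \<Rightarrow> 'b) \<Rightarrow> 'r \<Rightarrow> 'a \<times> 'b \<Rightarrow> 'a \<times> 'b" where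
  "sum_scale s t c p = (s c (fst p), t c (snd p))"

definition bowtie ::
  "('a::ab_group_add \<Rightarrow> 'a \<Rightarrow> 'a) \<Rightarrow> ('b::ab_group_add \<Rightarrow> 'b \<Rightarrow> 'b) \<Rightarrow>
   ('a \<Rightarrow> 'b \<Rightarrow> 'b) \<Rightarrow> ('a \<Rightarrow> 'b \<Rightarrow> 'b) \<Rightarrow> ('b \<Rightarrow> 'a \<Rightarrow> 'a) \<Rightarrow> ('b \<Rightarrow> 'a \<Rightarrow> 'a) \<Rightarrow>
   'a \<times> 'b \<Rightarrow> 'a \<times> 'b \<Rightarrow> 'a \<times> 'b" where
  "bowtie mA mB lA rA lB rB = (\<lambda>(x, u) (y, v).
     (mA x y + lB u y + rB v x, lA x v + rA y u + mB u v))"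

definition matched_pair ::
  "('r::comm_ring_1 \<Rightarrow> 'a::ab_group_add \<Rightarrow> 'a) \<Rightarrow> 'a set \<Rightarrow>
   ('r \<Rightarrow> 'b::ab_group_add \<Rightarrow> 'b) \<Rightarrow> 'b set \<Rightarrow>
   ('a \<Rightarrow> 'a \<Rightarrow> 'a) \<Rightarrow> ('b \<Rightarrow> 'b \<Rightarrow> 'b) \<Rightarrow>
   ('a \<Rightarrow> 'b \<Rightarrow> 'b) \<Rightarrow> ('a \<Rightarrow> 'b \<Rightarrow> 'b) \<Rightarrow> ('b \<Rightarrow> 'a \<Rightarrow> 'a) \<Rightarrow> ('b \<Rightarrow> 'a \<Rightarrow> 'a) \<Rightarrow> bool" where
  "matched_pair s A t B mA mB lA rA lB rB \<longleftrightarrow>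
     assoc_algebra s A mA \<and> assoc_algebra t B mB \<and>
     bilinear_on s A t B t B lA \<and> bilinear_on s A t B t B rA \<and>
     bilinear_on t B s A s A lB \<and> bilinear_on t B s A s A rB \<and>
     assoc_algebra (sum_scale s t) (A \<times> B) (bowtie mA mB lA rA lB rB)"

definition comm_matched_pair ::
  "('r::comm_ring_1 \<Rightarrow> 'a::ab_group_add \<Rightarrow> 'a) \<Rightarrow> 'a set \<Rightarrow>
   ('r \<Rightarrow> 'b::ab_group_add \<Rightarrow> 'b) \<Rightarrow> 'b set \<Rightarrow>
   ('a \<Rightarrow> 'a \<Rightarrow> 'a) \<Rightarrow> ('b \<Rightarrow> 'b \<Rightarrow> 'b) \<Rightarrow> ('a \<Rightarrow> 'b \<Rightarrow> 'b) \<Rightarrow> ('b \<Rightarrow> 'a \<Rightarrow> 'a) \<Rightarrow> bool" where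
  "comm_matched_pair s A t B mA mB \<rho>A \<rho>B \<longleftrightarrow>
     matched_pair s A t B mA mB \<rho>A \<rho>A \<rho>B \<rho>B \<and>
     commutative_on A mA \<and> commutative_on B mB \<and>
     commutative_on (A \<times> B) (bowtie mA mB \<rho>A \<rho>A \<rho>B \<rho>B)"

text \<open>
  The bracket on the direct sum is \<^const>\<open>bowtie\<close> with the right actions negated.
\<close>

definition poisson_matched_pair ::
  "('r::comm_ring_1 \<Rightarrow> 'a::ab_group_add \<Rightarrow> 'a) \<Rightarrow> 'a set \<Rightarrow>
   ('r \<Rightarrow> 'b::ab_group_add \<Rightarrow> 'b) \<Rightarrow> 'b set \<Rightarrow>
   ('a \<Rightarrow> 'a \<Rightarrow> 'a) \<Rightarrow> ('a \<Rightarrow> 'a \<Rightarrow> 'a) \<Rightarrow> ('b \<Rightarrow> 'b \<Rightarrow> 'b) \<Rightarrow> ('b \<Rightarrow> 'b \<Rightarrow> 'b) \<Rightarrow>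
   ('a \<Rightarrow> 'b \<Rightarrow> 'b) \<Rightarrow> ('a \<Rightarrow> 'b \<Rightarrow> 'b) \<Rightarrow> ('b \<Rightarrow> 'a \<Rightarrow> 'a) \<Rightarrow> ('b \<Rightarrow> 'a \<Rightarrow> 'a) \<Rightarrow> bool" where
  "poisson_matched_pair s A t B brA mA brB mB \<rho>brA \<rho>A \<rho>brB \<rho>B \<longleftrightarrow>
     poisson_algebra s A brA mA \<and> poisson_algebra t B brB mB \<and>
     bilinear_on s A t B t B \<rho>brA \<and> bilinear_on s A t B t B \<rho>A \<and>
     bilinear_on t B s A s A \<rho>brB \<and> bilinear_on t B s A s A \<rho>B \<and>
     poisson_algebra (sum_scale s t) (A \<times> B)
       (bowtie brA brB \<rho>brA (\<lambda>x u. - \<rho>brA x u) \<rho>brB (\<lambda>u x. - \<rho>brB u x))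
       (bowtie mA mB \<rho>A \<rho>A \<rho>B \<rho>B)"


section \<open>Duals and tensor products over the field\<close>

definition fun_scale :: "'k::times \<Rightarrow> ('x \<Rightarrow> 'k) \<Rightarrow> 'x \<Rightarrow> 'k" where
  "fun_scale c f = (\<lambda>x. c * f x)"

definition dual_space :: "('k::field \<Rightarrow> 'a::ab_group_add \<Rightarrow> 'a) \<Rightarrow> ('a \<Rightarrow> 'k) set" where
  "dual_space s = {u. Vector_Spaces.linear s (*) u}"

text \<open>
  For \<open>\<rho> : A \<rightarrow> End(A)\<close>, \<open>dual_rep \<rho>\<close> is \<open>\<rho>\<^sup>* : A \<rightarrow> End(A\<^sup>*)\<close> (no sign). For
  \<open>\<rho> : A\<^sup>* \<rightarrow> End(A\<^sup>*)\<close>, \<open>predual_rep s \<rho>\<close> is \<open>\<rho>\<^sup>* : A\<^sup>* \<rightarrow> End(A)\<close> under the identification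
  \<open>A\<^sup>*\<^sup>* = A\<close> for finite-dimensional \<open>A\<close>.
\<close>

definition dual_rep :: "('a \<Rightarrow> 'a \<Rightarrow> 'a) \<Rightarrow> 'a \<Rightarrow> ('a \<Rightarrow> 'k) \<Rightarrow> 'a \<Rightarrow> 'k" where
  "dual_rep \<rho> x u = (\<lambda>v. u (\<rho> x v))"

definition predual_rep ::
  "('k::field \<Rightarrow> 'a::ab_group_add \<Rightarrow> 'a) \<Rightarrow>
   (('a \<Rightarrow> 'k) \<Rightarrow> ('a \<Rightarrow> 'k) \<Rightarrow> 'a \<Rightarrow> 'k) \<Rightarrow> ('a \<Rightarrow> 'k) \<Rightarrow> 'a \<Rightarrow> 'a" where
  "predual_rep s \<rho> u x = (THE y. \<forall>v\<in>dual_space s. v y = \<rho> u v x)"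

definition bilinear_form ::
  "('k::field \<Rightarrow> 'a::ab_group_add \<Rightarrow> 'a) \<Rightarrow> ('a \<Rightarrow> 'a \<Rightarrow> 'k) \<Rightarrow> bool" where
  "bilinear_form s \<beta> \<longleftrightarrow> (\<forall>x. Vector_Spaces.linear s (*) (\<beta> x)) \<and>
     (\<forall>y. Vector_Spaces.linear s (*) (\<lambda>x. \<beta> x y))"

definition trilinear_form ::
  "('k::field \<Rightarrow> 'a::ab_group_add \<Rightarrow> 'a) \<Rightarrow> ('a \<Rightarrow> 'a \<Rightarrow> 'a \<Rightarrow> 'k) \<Rightarrow> bool" where
  "trilinear_form s \<gamma> \<longleftrightarrow> (\<forall>x y. Vector_Spaces.linear s (*) (\<gamma> x y)) \<and>
     (\<forall>x z. Vector_Spaces.linear s (*) (\<lambda>y. \<gamma> x y z)) \<and>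
     (\<forall>y z. Vector_Spaces.linear s (*) (\<lambda>x. \<gamma> x y z))"

text \<open>
  \<open>A \<otimes> A\<close> is realised as the span of the evaluations \<open>x \<otimes> y : \<beta> \<mapsto> \<beta>(x, y)\<close> in the dual of the
  space of bilinear forms on \<open>A\<close>; over a field this is a tensor product, since bilinear forms
  separate the elements of an algebraic tensor product. Tensors are made extensional by the value
  \<open>0\<close> on functions that are not bilinear, so that equality of tensors is equality of functions.
  Likewise for \<open>A \<otimes> A \<otimes> A\<close> and trilinear forms.
\<close>

type_synonym ('a, 'k) tensor2 = "('a \<Rightarrow> 'a \<Rightarrow> 'k) \<Rightarrow> 'k"
type_synonym ('a, 'k) tensor3 = "('a \<Rightarrow> 'a \<Rightarrow> 'a \<Rightarrow> 'k) \<Rightarrow> 'k"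

definition tens ::
  "('k::field \<Rightarrow> 'a::ab_group_add \<Rightarrow> 'a) \<Rightarrow> 'a \<Rightarrow> 'a \<Rightarrow> ('a, 'k) tensor2" where
  "tens s x y = (\<lambda>\<beta>. if bilinear_form s \<beta> then \<beta> x y else 0)"

definition tens3 ::
  "('k::field \<Rightarrow> 'a::ab_group_add \<Rightarrow> 'a) \<Rightarrow> 'a \<Rightarrow> 'a \<Rightarrow> 'a \<Rightarrow> ('a, 'k) tensor3" where
  "tens3 s x y z = (\<lambda>\<gamma>. if trilinear_form s \<gamma> then \<gamma> x y z else 0)"

definition tensor_space ::
  "('k::field \<Rightarrow> 'a::ab_group_add \<Rightarrow> 'a) \<Rightarrow> ('a, 'k) tensor2 set" where
  "tensor_space s = module.span fun_scale {tens s x y |x y. True}"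

text \<open>
  The linear map \<open>x \<otimes> y \<mapsto> \<phi>(x, y)\<close> induced by a bilinear \<open>\<phi>\<close> with values in a space of functions.
\<close>

definition tlift :: "('a \<Rightarrow> 'a \<Rightarrow> 'g \<Rightarrow> 'k) \<Rightarrow> ('a, 'k) tensor2 \<Rightarrow> 'g \<Rightarrow> 'k" where
  "tlift \<phi> t = (\<lambda>g. t (\<lambda>x y. \<phi> x y g))"

definition tlift3 :: "('a \<Rightarrow> 'a \<Rightarrow> 'a \<Rightarrow> 'g \<Rightarrow> 'k) \<Rightarrow> ('a, 'k) tensor3 \<Rightarrow> 'g \<Rightarrow> 'k" where
  "tlift3 \<phi> t = (\<lambda>g. t (\<lambda>x y z. \<phi> x y z g))"

lemma tlift_tens:
  "(\<And>g. bilinear_form s (\<lambda>x y. \<phi> x y g)) \<Longrightarrow> tlift \<phi> (tens s x y) = \<phi> x y"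
  by (simp add: tlift_def tens_def)

lemma tlift3_tens3:
  "(\<And>g. trilinear_form s (\<lambda>x y z. \<phi> x y z g)) \<Longrightarrow> tlift3 \<phi> (tens3 s x y z) = \<phi> x y z"
  by (simp add: tlift3_def tens3_def)

definition tensor_pairing :: "('a \<Rightarrow> 'k::times) \<Rightarrow> ('a \<Rightarrow> 'k) \<Rightarrow> ('a, 'k) tensor2 \<Rightarrow> 'k" where
  "tensor_pairing a b t = t (\<lambda>x y. a x * b y)"

definition dual_operation ::
  "('a \<Rightarrow> ('a, 'k::times) tensor2) \<Rightarrow> ('a \<Rightarrow> 'k) \<Rightarrow> ('a \<Rightarrow> 'k) \<Rightarrow> 'a \<Rightarrow> 'k" where
  "dual_operation \<Delta> a b = (\<lambda>x. tensor_pairing a b (\<Delta> x))"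

text \<open>
  In order: \<open>f \<otimes> g\<close>, the flip \<open>\<sigma>\<close>, \<open>id \<otimes> \<Delta>\<close>, \<open>\<Delta> \<otimes> id\<close>, \<open>\<tau>\<close> and \<open>\<sigma> \<otimes> id\<close>.
\<close>

definition tmap ::
  "('k::field \<Rightarrow> 'a::ab_group_add \<Rightarrow> 'a) \<Rightarrow> ('a \<Rightarrow> 'a) \<Rightarrow> ('a \<Rightarrow> 'a) \<Rightarrow>
   ('a, 'k) tensor2 \<Rightarrow> ('a, 'k) tensor2" where
  "tmap s f g = tlift (\<lambda>x y. tens s (f x) (g y))"

definition tflip ::
  "('k::field \<Rightarrow> 'a::ab_group_add \<Rightarrow> 'a) \<Rightarrow> ('a, 'k) tensor2 \<Rightarrow> ('a, 'k) tensor2" where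
  "tflip s = tlift (\<lambda>x y. tens s y x)"

definition id_tens ::
  "('k::field \<Rightarrow> 'a::ab_group_add \<Rightarrow> 'a) \<Rightarrow> ('a \<Rightarrow> ('a, 'k) tensor2) \<Rightarrow>
   ('a, 'k) tensor2 \<Rightarrow> ('a, 'k) tensor3" where
  "id_tens s \<Delta> = tlift (\<lambda>x y. tlift (\<lambda>u v. tens3 s x u v) (\<Delta> y))"

definition tens_id ::
  "('k::field \<Rightarrow> 'a::ab_group_add \<Rightarrow> 'a) \<Rightarrow> ('a \<Rightarrow> ('a, 'k) tensor2) \<Rightarrow>
   ('a, 'k) tensor2 \<Rightarrow> ('a, 'k) tensor3" where
  "tens_id s \<Delta> = tlift (\<lambda>x y. tlift (\<lambda>u v. tens3 s u v y) (\<Delta> x))"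

definition tcycle ::
  "('k::field \<Rightarrow> 'a::ab_group_add \<Rightarrow> 'a) \<Rightarrow> ('a, 'k) tensor3 \<Rightarrow> ('a, 'k) tensor3" where
  "tcycle s = tlift3 (\<lambda>x y z. tens3 s z x y)"

definition tflip_id ::
  "('k::field \<Rightarrow> 'a::ab_group_add \<Rightarrow> 'a) \<Rightarrow> ('a, 'k) tensor3 \<Rightarrow> ('a, 'k) tensor3" where
  "tflip_id s = tlift3 (\<lambda>x y z. tens3 s y x z)"


section \<open>Bialgebras over the field\<close>

definition comultiplication ::
  "('k::field \<Rightarrow> 'a::ab_group_add \<Rightarrow> 'a) \<Rightarrow> ('a \<Rightarrow> ('a, 'k) tensor2) \<Rightarrow> bool" where
  "comultiplication s \<Delta> \<longleftrightarrow>
     vector_space s \<and> linear_on s UNIV fun_scale (tensor_space s) \<Delta>"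

text \<open>
  The two identities of an ASI bialgebra, with \<open>tm f g\<close> standing for \<open>f \<otimes> g\<close> (or its completion)
  and \<open>fl\<close> for the flip.
\<close>

definition asi_identities ::
  "'v set \<Rightarrow> (('v \<Rightarrow> 'v) \<Rightarrow> ('v \<Rightarrow> 'v) \<Rightarrow> 't::ab_group_add \<Rightarrow> 't) \<Rightarrow> ('t \<Rightarrow> 't) \<Rightarrow>
   ('v \<Rightarrow> 'v \<Rightarrow> 'v) \<Rightarrow> ('v \<Rightarrow> 't) \<Rightarrow> bool" where
  "asi_identities V tm fl m \<Delta> \<longleftrightarrow>
     (\<forall>x\<in>V. \<forall>y\<in>V.
        \<Delta> (m x y) = tm id (mult_left m x) (\<Delta> y) + tm (mult_right m y) id (\<Delta> x) \<and>
        (tm (mult_left m y) id (\<Delta> x) - tm id (mult_right m y) (\<Delta> x)) +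
        fl (tm (mult_left m x) id (\<Delta> y) - tm id (mult_right m x) (\<Delta> y)) = 0)"

definition asi_bialgebra ::
  "('k::field \<Rightarrow> 'a::ab_group_add \<Rightarrow> 'a) \<Rightarrow> ('a \<Rightarrow> 'a \<Rightarrow> 'a) \<Rightarrow>
   ('a \<Rightarrow> ('a, 'k) tensor2) \<Rightarrow> bool" where
  "asi_bialgebra s m \<Delta> \<longleftrightarrow>
     assoc_algebra s UNIV m \<and> comultiplication s \<Delta> \<and>
     (\<forall>x. id_tens s \<Delta> (\<Delta> x) = tens_id s \<Delta> (\<Delta> x)) \<and>
     asi_identities UNIV (tmap s) (tflip s) m \<Delta>"

definition cc_asi_bialgebra ::
  "('k::field \<Rightarrow> 'a::ab_group_add \<Rightarrow> 'a) \<Rightarrow> ('a \<Rightarrow> 'a \<Rightarrow> 'a) \<Rightarrow>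
   ('a \<Rightarrow> ('a, 'k) tensor2) \<Rightarrow> bool" where
  "cc_asi_bialgebra s m \<Delta> \<longleftrightarrow>
     asi_bialgebra s m \<Delta> \<and> commutative_on UNIV m \<and> (\<forall>x. \<Delta> x = tflip s (\<Delta> x))"

definition lie_coalgebra ::
  "('k::field \<Rightarrow> 'a::ab_group_add \<Rightarrow> 'a) \<Rightarrow> ('a \<Rightarrow> ('a, 'k) tensor2) \<Rightarrow> bool" where
  "lie_coalgebra s \<delta> \<longleftrightarrow> comultiplication s \<delta> \<and>
     (\<forall>x. \<delta> x = - tflip s (\<delta> x)) \<and>
     (\<forall>x. let t = id_tens s \<delta> (\<delta> x) in t + tcycle s t + tcycle s (tcycle s t) = 0)"

definition lie_bialgebra ::
  "('k::field \<Rightarrow> 'a::ab_group_add \<Rightarrow> 'a) \<Rightarrow> ('a \<Rightarrow> 'a \<Rightarrow> 'a) \<Rightarrow>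
   ('a \<Rightarrow> ('a, 'k) tensor2) \<Rightarrow> bool" where
  "lie_bialgebra s br \<delta> \<longleftrightarrow> lie_algebra s UNIV br \<and> lie_coalgebra s \<delta> \<and>
     (\<forall>x y. \<delta> (br x y) =
        (tmap s (ad br x) id (\<delta> y) + tmap s id (ad br x) (\<delta> y)) -
        (tmap s (ad br y) id (\<delta> x) + tmap s id (ad br y) (\<delta> x)))"

definition poisson_coalgebra ::
  "('k::field \<Rightarrow> 'a::ab_group_add \<Rightarrow> 'a) \<Rightarrow> ('a \<Rightarrow> ('a, 'k) tensor2) \<Rightarrow>
   ('a \<Rightarrow> ('a, 'k) tensor2) \<Rightarrow> bool" where
  "poisson_coalgebra s \<delta> \<Delta> \<longleftrightarrow> lie_coalgebra s \<delta> \<and> comultiplication s \<Delta> \<and>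
     (\<forall>x. \<Delta> x = tflip s (\<Delta> x)) \<and>
     (\<forall>x. id_tens s \<Delta> (\<Delta> x) = tens_id s \<Delta> (\<Delta> x)) \<and>
     (\<forall>x. id_tens s \<Delta> (\<delta> x) = tens_id s \<delta> (\<Delta> x) + tflip_id s (id_tens s \<delta> (\<Delta> x)))"

definition poisson_bialgebra ::
  "('k::field \<Rightarrow> 'a::ab_group_add \<Rightarrow> 'a) \<Rightarrow> ('a \<Rightarrow> 'a \<Rightarrow> 'a) \<Rightarrow> ('a \<Rightarrow> 'a \<Rightarrow> 'a) \<Rightarrow>
   ('a \<Rightarrow> ('a, 'k) tensor2) \<Rightarrow> ('a \<Rightarrow> ('a, 'k) tensor2) \<Rightarrow> bool" where
  "poisson_bialgebra s br m \<delta> \<Delta> \<longleftrightarrow>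
     poisson_algebra s UNIV br m \<and> lie_bialgebra s br \<delta> \<and>
     poisson_coalgebra s \<delta> \<Delta> \<and> cc_asi_bialgebra s m \<Delta> \<and>
     (\<forall>x y. \<delta> (m x y) =
        tmap s (mult_left m y) id (\<delta> x) + tmap s (mult_left m x) id (\<delta> y) +
        tmap s id (ad br x) (\<Delta> y) + tmap s id (ad br y) (\<Delta> x)) \<and>
     (\<forall>x y. \<Delta> (br x y) =
        (tmap s (ad br x) id (\<Delta> y) + tmap s id (ad br x) (\<Delta> y)) +
        (tmap s (mult_left m y) id (\<delta> x) - tmap s id (mult_left m y) (\<delta> x)))"


section \<open>Topologically free modules\<close>

text \<open>
  \<open>V[[h]]\<close> is carried by the power series with all coefficients in \<open>V\<close>, and \<open>V\<close> is embedded by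
  \<^const>\<open>fps_const\<close>. The completed tensor product of \<open>A[[h]]\<close> with itself is \<open>(A \<otimes> A)[[h]]\<close>, and the
  topological dual of \<open>A[[h]]\<close> is \<open>(A\<^sup>*)[[h]]\<close>; a topologically free module being
  isomorphic to some \<open>V[[h]]\<close>, structures on such modules are stated on \<open>V[[h]]\<close> itself.
\<close>

definition fps_scale ::
  "('k \<Rightarrow> 'v::ab_group_add \<Rightarrow> 'v) \<Rightarrow> 'k fps \<Rightarrow> 'v fps \<Rightarrow> 'v fps" where
  "fps_scale s c f = Abs_fps (\<lambda>n. \<Sum>i\<le>n. s (fps_nth c i) (fps_nth f (n - i)))"

definition fps_space :: "'v set \<Rightarrow> 'v fps set" where
  "fps_space V = {f. \<forall>n. fps_nth f n \<in> V}"

definition cong_h ::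
  "('k::comm_ring_1 \<Rightarrow> 'v::ab_group_add \<Rightarrow> 'v) \<Rightarrow> 'v set \<Rightarrow> 'v fps \<Rightarrow> 'v fps \<Rightarrow> bool" where
  "cong_h s V f g \<longleftrightarrow> (\<exists>w\<in>fps_space V. f - g = fps_scale s fps_X w)"

text \<open>\<open>f\<close> is divisible by \<open>h\<close>, and \<open>f/h \<equiv> a (mod h)\<close> with \<open>a \<in> V\<close>.\<close>

definition quot_cong_h ::
  "('k::comm_ring_1 \<Rightarrow> 'v::ab_group_add \<Rightarrow> 'v) \<Rightarrow> 'v set \<Rightarrow> 'v fps \<Rightarrow> 'v \<Rightarrow> bool" where
  "quot_cong_h s V f a \<longleftrightarrow> a \<in> V \<and>
     (\<exists>q\<in>fps_space V. f = fps_scale s fps_X q \<and> cong_h s V q (fps_const a))"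

definition assoc_deformation ::
  "('k::comm_ring_1 \<Rightarrow> 'v::ab_group_add \<Rightarrow> 'v) \<Rightarrow> 'v set \<Rightarrow> ('v \<Rightarrow> 'v \<Rightarrow> 'v) \<Rightarrow>
   ('v fps \<Rightarrow> 'v fps \<Rightarrow> 'v fps) \<Rightarrow> bool" where
  "assoc_deformation s V m mh \<longleftrightarrow>
     assoc_algebra s V m \<and> assoc_algebra (fps_scale s) (fps_space V) mh \<and>
     (\<forall>x\<in>V. \<forall>y\<in>V. cong_h s V (mh (fps_const x) (fps_const y)) (fps_const (m x y)))"

definition qcl_bracket ::
  "('k::comm_ring_1 \<Rightarrow> 'v::ab_group_add \<Rightarrow> 'v) \<Rightarrow> 'v set \<Rightarrow>
   ('v fps \<Rightarrow> 'v fps \<Rightarrow> 'v fps) \<Rightarrow> ('v \<Rightarrow> 'v \<Rightarrow> 'v) \<Rightarrow> bool" where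
  "qcl_bracket s V mh br \<longleftrightarrow> (\<forall>x\<in>V. \<forall>y\<in>V. quot_cong_h s V
     (mh (fps_const x) (fps_const y) - mh (fps_const y) (fps_const x)) (br x y))"

definition assoc_qcl ::
  "('k::comm_ring_1 \<Rightarrow> 'v::ab_group_add \<Rightarrow> 'v) \<Rightarrow> 'v set \<Rightarrow>
   ('v fps \<Rightarrow> 'v fps \<Rightarrow> 'v fps) \<Rightarrow> ('v \<Rightarrow> 'v \<Rightarrow> 'v) \<Rightarrow> ('v \<Rightarrow> 'v \<Rightarrow> 'v) \<Rightarrow> bool" where
  "assoc_qcl s V mh br m \<longleftrightarrow>
     commutative_on V m \<and> assoc_deformation s V m mh \<and> qcl_bracket s V mh br"

text \<open>The identification of \<open>(A \<oplus> B)[[h]]\<close> with \<open>A[[h]] \<oplus> B[[h]]\<close>.\<close>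

definition fps_join :: "'a fps \<times> 'b fps \<Rightarrow> ('a \<times> 'b) fps" where
  "fps_join p = Abs_fps (\<lambda>n. (fps_nth (fst p) n, fps_nth (snd p) n))"

definition fps_split :: "('a \<times> 'b) fps \<Rightarrow> 'a fps \<times> 'b fps" where
  "fps_split f = (Abs_fps (\<lambda>n. fst (fps_nth f n)), Abs_fps (\<lambda>n. snd (fps_nth f n)))"

definition matched_pair_deformation ::
  "('k::comm_ring_1 \<Rightarrow> 'a::ab_group_add \<Rightarrow> 'a) \<Rightarrow> 'a set \<Rightarrow>
   ('k \<Rightarrow> 'b::ab_group_add \<Rightarrow> 'b) \<Rightarrow> 'b set \<Rightarrow>
   ('a \<Rightarrow> 'a \<Rightarrow> 'a) \<Rightarrow> ('b \<Rightarrow> 'b \<Rightarrow> 'b) \<Rightarrow>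
   ('a \<Rightarrow> 'b \<Rightarrow> 'b) \<Rightarrow> ('a \<Rightarrow> 'b \<Rightarrow> 'b) \<Rightarrow> ('b \<Rightarrow> 'a \<Rightarrow> 'a) \<Rightarrow> ('b \<Rightarrow> 'a \<Rightarrow> 'a) \<Rightarrow>
   ('a fps \<Rightarrow> 'a fps \<Rightarrow> 'a fps) \<Rightarrow> ('b fps \<Rightarrow> 'b fps \<Rightarrow> 'b fps) \<Rightarrow>
   ('a fps \<Rightarrow> 'b fps \<Rightarrow> 'b fps) \<Rightarrow> ('a fps \<Rightarrow> 'b fps \<Rightarrow> 'b fps) \<Rightarrow>
   ('b fps \<Rightarrow> 'a fps \<Rightarrow> 'a fps) \<Rightarrow> ('b fps \<Rightarrow> 'a fps \<Rightarrow> 'a fps) \<Rightarrow> bool" where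
  "matched_pair_deformation s A t B mA mB lA rA lB rB mAh mBh lAh rAh lBh rBh \<longleftrightarrow>
     matched_pair s A t B mA mB lA rA lB rB \<and>
     matched_pair (fps_scale s) (fps_space A) (fps_scale t) (fps_space B)
       mAh mBh lAh rAh lBh rBh \<and>
     assoc_deformation (sum_scale s t) (A \<times> B) (bowtie mA mB lA rA lB rB)
       (\<lambda>f g. fps_join (bowtie mAh mBh lAh rAh lBh rBh (fps_split f) (fps_split g)))"

text \<open>
  The tuple \<open>((A, brA, mA), (B, brB, mB), \<rho>brA, \<rho>A, \<rho>brB, \<rho>B)\<close> is the QCL of the matched pair
  with index \<open>h\<close>, the latter being a deformation of the commutative matched pair
  \<open>((A, mA), (B, mB), \<rho>A, \<rho>B)\<close>.
\<close>

definition matched_pair_qcl ::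
  "('k::comm_ring_1 \<Rightarrow> 'a::ab_group_add \<Rightarrow> 'a) \<Rightarrow> 'a set \<Rightarrow>
   ('k \<Rightarrow> 'b::ab_group_add \<Rightarrow> 'b) \<Rightarrow> 'b set \<Rightarrow>
   ('a fps \<Rightarrow> 'a fps \<Rightarrow> 'a fps) \<Rightarrow> ('b fps \<Rightarrow> 'b fps \<Rightarrow> 'b fps) \<Rightarrow>
   ('a fps \<Rightarrow> 'b fps \<Rightarrow> 'b fps) \<Rightarrow> ('a fps \<Rightarrow> 'b fps \<Rightarrow> 'b fps) \<Rightarrow>
   ('b fps \<Rightarrow> 'a fps \<Rightarrow> 'a fps) \<Rightarrow> ('b fps \<Rightarrow> 'a fps \<Rightarrow> 'a fps) \<Rightarrow>
   ('a \<Rightarrow> 'a \<Rightarrow> 'a) \<Rightarrow> ('a \<Rightarrow> 'a \<Rightarrow> 'a) \<Rightarrow> ('b \<Rightarrow> 'b \<Rightarrow> 'b) \<Rightarrow> ('b \<Rightarrow> 'b \<Rightarrow> 'b) \<Rightarrow>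
   ('a \<Rightarrow> 'b \<Rightarrow> 'b) \<Rightarrow> ('a \<Rightarrow> 'b \<Rightarrow> 'b) \<Rightarrow> ('b \<Rightarrow> 'a \<Rightarrow> 'a) \<Rightarrow> ('b \<Rightarrow> 'a \<Rightarrow> 'a) \<Rightarrow> bool" where
  "matched_pair_qcl s A t B mAh mBh lAh rAh lBh rBh brA mA brB mB \<rho>brA \<rho>A \<rho>brB \<rho>B \<longleftrightarrow>
     comm_matched_pair s A t B mA mB \<rho>A \<rho>B \<and>
     matched_pair_deformation s A t B mA mB \<rho>A \<rho>A \<rho>B \<rho>B mAh mBh lAh rAh lBh rBh \<and>
     assoc_qcl s A mAh brA mA \<and> assoc_qcl t B mBh brB mB \<and>
     (\<forall>x\<in>A. \<forall>v\<in>B.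
        quot_cong_h t B
          (lAh (fps_const x) (fps_const v) - rAh (fps_const x) (fps_const v)) (\<rho>brA x v) \<and>
        quot_cong_h s A
          (lBh (fps_const v) (fps_const x) - rBh (fps_const v) (fps_const x)) (\<rho>brB v x))"


section \<open>Topological duals and completed tensor products\<close>

definition pairing_h :: "('a \<Rightarrow> 'k::comm_ring_1) fps \<Rightarrow> 'a fps \<Rightarrow> 'k fps" where
  "pairing_h u x = Abs_fps (\<lambda>n. \<Sum>i\<le>n. fps_nth u i (fps_nth x (n - i)))"

text \<open>\<open>\<langle>a \<otimes> b, t\<rangle>\<close> over \<open>K\<close> for a completed tensor \<open>t\<close>.\<close>

definition tensor_pairing_h ::
  "('a \<Rightarrow> 'k::comm_ring_1) fps \<Rightarrow> ('a \<Rightarrow> 'k) fps \<Rightarrow> ('a, 'k) tensor2 fps \<Rightarrow> 'k fps" where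
  "tensor_pairing_h a b t = Abs_fps (\<lambda>n. \<Sum>i\<le>n. \<Sum>j\<le>n - i.
     tensor_pairing (fps_nth a i) (fps_nth b j) (fps_nth t (n - i - j)))"

definition dual_operation_h ::
  "('k::field \<Rightarrow> 'a::ab_group_add \<Rightarrow> 'a) \<Rightarrow> ('a fps \<Rightarrow> ('a, 'k) tensor2 fps) \<Rightarrow>
   ('a \<Rightarrow> 'k) fps \<Rightarrow> ('a \<Rightarrow> 'k) fps \<Rightarrow> ('a \<Rightarrow> 'k) fps" where
  "dual_operation_h s \<Delta>h a b = (THE c. c \<in> fps_space (dual_space s) \<and>
     (\<forall>x. pairing_h c x = tensor_pairing_h a b (\<Delta>h x)))"

definition dual_rep_h ::
  "('k::field \<Rightarrow> 'a::ab_group_add \<Rightarrow> 'a) \<Rightarrow> ('a fps \<Rightarrow> 'a fps \<Rightarrow> 'a fps) \<Rightarrow>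
   'a fps \<Rightarrow> ('a \<Rightarrow> 'k) fps \<Rightarrow> ('a \<Rightarrow> 'k) fps" where
  "dual_rep_h s \<rho> x u = (THE w. w \<in> fps_space (dual_space s) \<and>
     (\<forall>v. pairing_h w v = pairing_h u (\<rho> x v)))"

definition predual_rep_h ::
  "('k::field \<Rightarrow> 'a::ab_group_add \<Rightarrow> 'a) \<Rightarrow>
   (('a \<Rightarrow> 'k) fps \<Rightarrow> ('a \<Rightarrow> 'k) fps \<Rightarrow> ('a \<Rightarrow> 'k) fps) \<Rightarrow> ('a \<Rightarrow> 'k) fps \<Rightarrow> 'a fps \<Rightarrow> 'a fps" where
  "predual_rep_h s \<rho> u x =
     (THE y. \<forall>v\<in>fps_space (dual_space s). pairing_h v y = pairing_h (\<rho> u v) x)"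

text \<open>
  The \<open>K\<close>-linear, \<open>h\<close>-adically continuous extension of \<open>x \<otimes> y \<mapsto> \<phi>(x, y)\<close> to the completed
  tensor product. A \<open>K\<close>-linear map is determined by its values on constant series, so the maps
  below depend on \<open>F\<close>, \<open>G\<close> and \<open>\<Delta>h\<close> only through these.
\<close>

definition tlift_h ::
  "('a \<Rightarrow> 'a \<Rightarrow> ('g \<Rightarrow> 'k::comm_ring_1) fps) \<Rightarrow> ('a, 'k) tensor2 fps \<Rightarrow> ('g \<Rightarrow> 'k) fps" where
  "tlift_h \<phi> t = Abs_fps (\<lambda>n. \<Sum>i\<le>n. tlift (\<lambda>x y. fps_nth (\<phi> x y) (n - i)) (fps_nth t i))"

definition tens_h ::
  "('k::field \<Rightarrow> 'a::ab_group_add \<Rightarrow> 'a) \<Rightarrow> 'a fps \<Rightarrow> 'a fps \<Rightarrow> ('a, 'k) tensor2 fps" where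
  "tens_h s x y = Abs_fps (\<lambda>n. \<Sum>i\<le>n. tens s (fps_nth x i) (fps_nth y (n - i)))"

definition tmap_h ::
  "('k::field \<Rightarrow> 'a::ab_group_add \<Rightarrow> 'a) \<Rightarrow> ('a fps \<Rightarrow> 'a fps) \<Rightarrow> ('a fps \<Rightarrow> 'a fps) \<Rightarrow>
   ('a, 'k) tensor2 fps \<Rightarrow> ('a, 'k) tensor2 fps" where
  "tmap_h s F G = tlift_h (\<lambda>x y. tens_h s (F (fps_const x)) (G (fps_const y)))"

definition tflip_h ::
  "('k::field \<Rightarrow> 'a::ab_group_add \<Rightarrow> 'a) \<Rightarrow> ('a, 'k) tensor2 fps \<Rightarrow> ('a, 'k) tensor2 fps" where
  "tflip_h s = tlift_h (\<lambda>x y. fps_const (tens s y x))"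

definition id_tens_h ::
  "('k::field \<Rightarrow> 'a::ab_group_add \<Rightarrow> 'a) \<Rightarrow> ('a fps \<Rightarrow> ('a, 'k) tensor2 fps) \<Rightarrow>
   ('a, 'k) tensor2 fps \<Rightarrow> ('a, 'k) tensor3 fps" where
  "id_tens_h s \<Delta>h = tlift_h (\<lambda>x y.
     tlift_h (\<lambda>u v. fps_const (tens3 s x u v)) (\<Delta>h (fps_const y)))"

definition tens_id_h ::
  "('k::field \<Rightarrow> 'a::ab_group_add \<Rightarrow> 'a) \<Rightarrow> ('a fps \<Rightarrow> ('a, 'k) tensor2 fps) \<Rightarrow>
   ('a, 'k) tensor2 fps \<Rightarrow> ('a, 'k) tensor3 fps" where
  "tens_id_h s \<Delta>h = tlift_h (\<lambda>x y.
     tlift_h (\<lambda>u v. fps_const (tens3 s u v y)) (\<Delta>h (fps_const x)))"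

definition comultiplication_h ::
  "('k::field \<Rightarrow> 'a::ab_group_add \<Rightarrow> 'a) \<Rightarrow> ('a fps \<Rightarrow> ('a, 'k) tensor2 fps) \<Rightarrow> bool" where
  "comultiplication_h s \<Delta>h \<longleftrightarrow> vector_space s \<and>
     linear_on (fps_scale s) (fps_space UNIV)
       (fps_scale fun_scale) (fps_space (tensor_space s)) \<Delta>h"

definition asi_bialgebra_h ::
  "('k::field \<Rightarrow> 'a::ab_group_add \<Rightarrow> 'a) \<Rightarrow> ('a fps \<Rightarrow> 'a fps \<Rightarrow> 'a fps) \<Rightarrow>
   ('a fps \<Rightarrow> ('a, 'k) tensor2 fps) \<Rightarrow> bool" where
  "asi_bialgebra_h s mh \<Delta>h \<longleftrightarrow>
     assoc_algebra (fps_scale s) (fps_space UNIV) mh \<and> comultiplication_h s \<Delta>h \<and>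
     (\<forall>x. id_tens_h s \<Delta>h (\<Delta>h x) = tens_id_h s \<Delta>h (\<Delta>h x)) \<and>
     asi_identities (fps_space UNIV) (tmap_h s) (tflip_h s) mh \<Delta>h"

definition asi_deformation ::
  "('k::field \<Rightarrow> 'a::ab_group_add \<Rightarrow> 'a) \<Rightarrow> ('a \<Rightarrow> 'a \<Rightarrow> 'a) \<Rightarrow> ('a \<Rightarrow> ('a, 'k) tensor2) \<Rightarrow>
   ('a fps \<Rightarrow> 'a fps \<Rightarrow> 'a fps) \<Rightarrow> ('a fps \<Rightarrow> ('a, 'k) tensor2 fps) \<Rightarrow> bool" where
  "asi_deformation s m \<Delta> mh \<Delta>h \<longleftrightarrow>
     asi_bialgebra s m \<Delta> \<and> asi_bialgebra_h s mh \<Delta>h \<and>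
     (\<forall>x y. cong_h s UNIV (mh (fps_const x) (fps_const y)) (fps_const (m x y))) \<and>
     (\<forall>x. cong_h fun_scale (tensor_space s) (\<Delta>h (fps_const x)) (fps_const (\<Delta> x)))"

definition asi_qcl ::
  "('k::field \<Rightarrow> 'a::ab_group_add \<Rightarrow> 'a) \<Rightarrow>
   ('a fps \<Rightarrow> 'a fps \<Rightarrow> 'a fps) \<Rightarrow> ('a fps \<Rightarrow> ('a, 'k) tensor2 fps) \<Rightarrow>
   ('a \<Rightarrow> 'a \<Rightarrow> 'a) \<Rightarrow> ('a \<Rightarrow> 'a \<Rightarrow> 'a) \<Rightarrow>
   ('a \<Rightarrow> ('a, 'k) tensor2) \<Rightarrow> ('a \<Rightarrow> ('a, 'k) tensor2) \<Rightarrow> bool" where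
  "asi_qcl s mh \<Delta>h br m \<delta> \<Delta> \<longleftrightarrow>
     cc_asi_bialgebra s m \<Delta> \<and> asi_deformation s m \<Delta> mh \<Delta>h \<and>
     qcl_bracket s UNIV mh br \<and>
     (\<forall>x. quot_cong_h fun_scale (tensor_space s)
        (\<Delta>h (fps_const x) - tflip_h s (\<Delta>h (fps_const x))) (\<delta> x))"

end

theory Submission
  imports Defs
begin

text \<open>
  Both sides of the correspondence are one structure seen from two angles. On the double \<open>A \<oplus> A\<^sup>*\<close> the
  actions are the transposes of the multiplications, so the form
  \<open>((x, u), (y, v)) \<mapsto> \<langle>u, y\<rangle> + \<langle>v, x\<rangle>\<close> is invariant. Hence associativity of the product \<open>\<odot>\<close> means
  \<open>form (p \<odot> q) (r \<odot> w) = form (q \<odot> r) (w \<odot> p)\<close> for all \<open>p\<close>, \<open>q\<close>, \<open>r\<close>, \<open>w\<close>, a condition that is stable under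
  cyclic rotation. On elements of \<open>A\<close> and \<open>A\<^sup>*\<close> it splits, up to rotation, into associativity of \<open>A\<close>,
  associativity of \<open>A\<^sup>*\<close> (dual to coassociativity), and the two identities of an ASI bialgebra, according
  to whether the two elements of \<open>A\<close> are adjacent or alternate with those of \<open>A\<^sup>*\<close>. This is
  \<open>matched_pair_iff_asi\<close>, proved for modules in duality over any commutative ring. It applies to \<open>A\<close> over
  the field (\<open>cc_asi_bialgebra_iff\<close>) and to \<open>A[[h]]\<close> over \<open>K\<close> (\<open>asi_bialgebra_h_iff\<close>). Over \<open>K\<close> every linear
  map is determined by its values on constants, so no topology is involved.

  Reduction modulo \<open>h\<close> commutes with transposition, so deformations correspond to deformations
  (\<open>asi_deformation_iff\<close>). For the quasi-classical limits, the double of a deformation is itself a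
  deformation of a commutative algebra, so its commutator, divided by \<open>h\<close> and reduced, is a Poisson
  bracket (\<open>poisson_algebra_of_assoc_qcl\<close>). The coefficient of \<open>h\<close> in \<open>R\<^sup>* - L\<^sup>*\<close> is \<open>- ad\<^sup>*\<close>, which
  identifies this bracket with the double of the two brackets on \<open>A\<close> and \<open>A\<^sup>*\<close> and yields the matched
  pair of Poisson algebras. Finally, the identities of a Poisson bialgebra are components of the Jacobi
  identity and the Leibniz rule of the double, tested on \<open>a \<otimes> b\<close> and \<open>a \<otimes> b \<otimes> c\<close>
  (\<open>poisson_bialgebra_of_matched_pair\<close>).
\<close>

section \<open>Modules of power series\<close>

lemma submodule_module: "submodule s V \<Longrightarrow> module s"
  by (simp add: submodule_def)

lemma
  assumes "submodule s V"
  shows submodule_zero: "0 \<in> V"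
    and submodule_add: "x \<in> V \<Longrightarrow> y \<in> V \<Longrightarrow> x + y \<in> V"
    and submodule_scale: "x \<in> V \<Longrightarrow> s c x \<in> V"
    and submodule_neg: "x \<in> V \<Longrightarrow> - x \<in> V"
    and submodule_diff: "x \<in> V \<Longrightarrow> y \<in> V \<Longrightarrow> x - y \<in> V"
    and submodule_sum: "(\<And>i. i \<in> I \<Longrightarrow> g i \<in> V) \<Longrightarrow> (\<Sum>i\<in>I. g i) \<in> V"
proof -
  interpret module s using assms by (rule submodule_module)
  have sub: "subspace V" using assms by (simp add: submodule_def)
  show "0 \<in> V" using sub by (rule subspace_0)
  show "x \<in> V \<Longrightarrow> y \<in> V \<Longrightarrow> x + y \<in> V" using sub by (rule subspace_add)
  show "x \<in> V \<Longrightarrow> s c x \<in> V" using sub by (rule subspace_scale)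
  show "x \<in> V \<Longrightarrow> - x \<in> V" using sub by (rule subspace_neg)
  show "x \<in> V \<Longrightarrow> y \<in> V \<Longrightarrow> x - y \<in> V" using sub by (rule subspace_diff)
  show "(\<And>i. i \<in> I \<Longrightarrow> g i \<in> V) \<Longrightarrow> (\<Sum>i\<in>I. g i) \<in> V" using sub by (rule subspace_sum)
qed

lemma submodule_UNIV: "module s \<Longrightarrow> submodule s UNIV"
  by (simp add: submodule_def module.subspace_UNIV)

lemma fps_scale_nth: "fps_nth (fps_scale s c f) n = (\<Sum>i\<le>n. s (fps_nth c i) (fps_nth f (n - i)))"
  by (simp add: fps_scale_def)

lemma module_fps_scale:
  assumes "module s"
  shows "module (fps_scale s)"
proof -
  interpret module s by fact
  show ?thesis
  proof
    fix a b :: "'a fps" and x y :: "'b fps"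
    show "fps_scale s a (x + y) = fps_scale s a x + fps_scale s a y"
      by (rule fps_ext) (simp add: fps_scale_nth scale_right_distrib sum.distrib)
    show "fps_scale s (a + b) x = fps_scale s a x + fps_scale s b x"
      by (rule fps_ext) (simp add: fps_scale_nth scale_left_distrib sum.distrib)
    show "fps_scale s 1 x = x"
    proof (rule fps_ext)
      fix n
      have "fps_nth (fps_scale s 1 x) n = (\<Sum>i\<le>n. if i = 0 then fps_nth x n else 0)"
        unfolding fps_scale_nth by (rule sum.cong) auto
      then show "fps_nth (fps_scale s 1 x) n = fps_nth x n" by simp
    qed
    show "fps_scale s a (fps_scale s b x) = fps_scale s (a * b) x"
    proof (rule fps_ext)
      fix n
      let ?f = "\<lambda>i j l. s (fps_nth a i * fps_nth b j) (fps_nth x l)"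
      have "fps_nth (fps_scale s a (fps_scale s b x)) n = (\<Sum>i=0..n. \<Sum>j=0..n-i. ?f i j (n - i - j))"
        by (simp add: fps_scale_nth scale_sum_right atLeast0AtMost)
      also have "\<dots> = (\<Sum>j=0..n. \<Sum>i=0..j. ?f i (j - i) (n - j))"
        by (rule fps_mult_assoc_lemma[symmetric])
      also have "\<dots> = fps_nth (fps_scale s (a * b) x) n"
        by (simp add: fps_scale_nth fps_mult_nth scale_sum_left atLeast0AtMost)
      finally show "fps_nth (fps_scale s a (fps_scale s b x)) n = fps_nth (fps_scale s (a * b) x) n" .
    qed
  qed
qed

lemma submodule_fps_space:
  assumes "submodule s V"
  shows "submodule (fps_scale s) (fps_space V)"
proof -
  note V = submodule_zero[OF assms] submodule_add[OF assms] submodule_scale[OF assms]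
    submodule_sum[OF assms]
  interpret M: module "fps_scale s" by (rule module_fps_scale[OF submodule_module[OF assms]])
  show ?thesis unfolding submodule_def M.subspace_def
    by (auto simp: M.module_axioms fps_space_def fps_scale_nth intro: V)
qed

lemma fps_space_UNIV [simp]: "fps_space UNIV = UNIV"
  by (auto simp: fps_space_def)

lemma fps_const_in_fps_space: "submodule s V \<Longrightarrow> x \<in> V \<Longrightarrow> fps_const x \<in> fps_space V"
  by (auto simp: fps_space_def submodule_zero)

lemma fps_scale_X:
  assumes "module s"
  shows "fps_nth (fps_scale s fps_X w) 0 = 0"
    and "fps_nth (fps_scale s fps_X w) (Suc n) = fps_nth w n"
proof -
  interpret module s by fact
  show "fps_nth (fps_scale s fps_X w) 0 = 0" by (simp add: fps_scale_nth)
  have "fps_nth (fps_scale s fps_X w) (Suc n) = (\<Sum>i\<le>Suc n. if i = 1 then fps_nth w n else 0)"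
    unfolding fps_scale_nth by (rule sum.cong) auto
  then show "fps_nth (fps_scale s fps_X w) (Suc n) = fps_nth w n" by simp
qed

lemma fps_scale_const:
  assumes "module s"
  shows "fps_nth (fps_scale s (fps_const c) f) n = s c (fps_nth f n)"
proof -
  interpret module s by fact
  have "fps_nth (fps_scale s (fps_const c) f) n = (\<Sum>i\<le>n. if i = 0 then s c (fps_nth f n) else 0)"
    unfolding fps_scale_nth by (rule sum.cong) auto
  then show ?thesis by simp
qed

lemma fps_scale_const_const:
  assumes "module s"
  shows "fps_scale s (fps_const c) (fps_const x) = fps_const (s c x)"
  by (rule fps_ext) (simp add: fps_scale_const[OF assms] module.scale_zero_right[OF assms])

text \<open>
  Splitting off the constant term is the step of every induction on coefficients; it replaces
  convergence arguments.
\<close>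

lemma fps_split_const:
  assumes "submodule s V" and "f \<in> fps_space V"
  obtains g where "g \<in> fps_space V" and "f = fps_const (fps_nth f 0) + fps_scale s fps_X g"
proof
  let ?g = "Abs_fps (\<lambda>n. fps_nth f (Suc n))"
  show "?g \<in> fps_space V" using assms(2) by (auto simp: fps_space_def)
  show "f = fps_const (fps_nth f 0) + fps_scale s fps_X ?g"
  proof (rule fps_ext)
    fix n show "fps_nth f n = fps_nth (fps_const (fps_nth f 0) + fps_scale s fps_X ?g) n"
      by (cases n) (simp_all add: fps_scale_X[OF submodule_module[OF assms(1)]])
  qed
qed

text \<open>
  Divisibility by \<open>h\<close> is the vanishing of the constant term. Congruences and quotients modulo \<open>h\<close> thus
  become statements about the coefficients of \<open>h\<^sup>0\<close> and \<open>h\<^sup>1\<close>.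
\<close>

lemma cong_h_iff:
  assumes "submodule s V" and "f \<in> fps_space V" and "g \<in> fps_space V"
  shows "cong_h s V f g \<longleftrightarrow> fps_nth f 0 = fps_nth g 0"
proof
  note X = fps_scale_X[OF submodule_module[OF assms(1)]]
  show "cong_h s V f g \<Longrightarrow> fps_nth f 0 = fps_nth g 0"
    unfolding cong_h_def using X(1) by (metis eq_iff_diff_eq_0 fps_sub_nth)
  assume *: "fps_nth f 0 = fps_nth g 0"
  have "f - g \<in> fps_space V"
    using submodule_diff[OF submodule_fps_space[OF assms(1)]] assms by blast
  from fps_split_const[OF assms(1) this] obtain w where
    "w \<in> fps_space V" "f - g = fps_const (fps_nth (f - g) 0) + fps_scale s fps_X w" .
  with * show "cong_h s V f g" unfolding cong_h_def by auto
qed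

lemma quot_cong_h_iff:
  assumes "submodule s V"
  shows "quot_cong_h s V f a \<longleftrightarrow>
    a \<in> V \<and> f \<in> fps_space V \<and> fps_nth f 0 = 0 \<and> fps_nth f 1 = a"
proof
  note mod = submodule_module[OF assms]
  note X = fps_scale_X[OF mod]
  assume "quot_cong_h s V f a"
  then obtain q where q: "a \<in> V" "q \<in> fps_space V" "f = fps_scale s fps_X q"
    "cong_h s V q (fps_const a)"
    unfolding quot_cong_h_def by blast
  then show "a \<in> V \<and> f \<in> fps_space V \<and> fps_nth f 0 = 0 \<and> fps_nth f 1 = a"
    using cong_h_iff[OF assms q(2) fps_const_in_fps_space[OF assms q(1)]]
      submodule_scale[OF submodule_fps_space[OF assms] q(2)]
    by (simp add: X)
next
  note X = fps_scale_X[OF submodule_module[OF assms]]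
  assume f: "a \<in> V \<and> f \<in> fps_space V \<and> fps_nth f 0 = 0 \<and> fps_nth f 1 = a"
  then obtain g where g: "g \<in> fps_space V" "f = fps_const (fps_nth f 0) + fps_scale s fps_X g"
    using fps_split_const[OF assms] by blast
  have "f = fps_scale s fps_X g" using g f by simp
  moreover from this have "fps_nth g 0 = a" using f X(2)[of g 0] by simp
  ultimately show "quot_cong_h s V f a"
    unfolding quot_cong_h_def
    using f g cong_h_iff[OF assms g(1) fps_const_in_fps_space[OF assms]] by auto
qed

section \<open>Linear maps\<close>

lemma
  assumes "linear_on s V t W f"
  shows linear_on_closed: "x \<in> V \<Longrightarrow> f x \<in> W"
    and linear_on_add: "x \<in> V \<Longrightarrow> y \<in> V \<Longrightarrow> f (x + y) = f x + f y"
    and linear_on_scale: "x \<in> V \<Longrightarrow> f (s c x) = t c (f x)"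
  using assms unfolding linear_on_def by blast+

lemma
  assumes "linear_on s V t W f" and "submodule s V" 
  shows linear_on_zero: "f 0 = 0"
    and linear_on_neg: "x \<in> V \<Longrightarrow> f (- x) = - f x"
    and linear_on_diff: "x \<in> V \<Longrightarrow> y \<in> V \<Longrightarrow> f (x - y) = f x - f y"
    and linear_on_sum: "(\<And>i. i \<in> I \<Longrightarrow> g i \<in> V) \<Longrightarrow> f (\<Sum>i\<in>I. g i) = (\<Sum>i\<in>I. f (g i))"
proof -
  note V = submodule_zero[OF assms(2)] submodule_add[OF assms(2)] submodule_neg[OF assms(2)]
  note add = linear_on_add[OF assms(1)]
  show z: "f 0 = 0" using add[of 0 0] V by simp
  show neg: "f (- x) = - f x" if "x \<in> V" for x
    using add[of x "- x"] that V z by (simp add: eq_neg_iff_add_eq_0 add.commute)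
  show "f (x - y) = f x - f y" if "x \<in> V" "y \<in> V" for x y
    using add[of x "- y"] that V neg by simp
  show "f (\<Sum>i\<in>I. g i) = (\<Sum>i\<in>I. f (g i))" if "\<And>i. i \<in> I \<Longrightarrow> g i \<in> V" 
    using that by (induction I rule: infinite_finite_induct)
      (auto simp: z add submodule_sum[OF assms(2)])
qed

lemma
  assumes "bilinear_on s V t W u U f"
  shows bilinear_on_left: "y \<in> W \<Longrightarrow> linear_on s V u U (\<lambda>x. f x y)"
    and bilinear_on_right: "x \<in> V \<Longrightarrow> linear_on t W u U (f x)"
  using assms unfolding bilinear_on_def by blast+

lemma linear_on_compose:
  "linear_on s V t W f \<Longrightarrow> linear_on t W u U g \<Longrightarrow> linear_on s V u U (\<lambda>x. g (f x))"
  by (simp add: linear_on_def)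

text \<open>
  A linear map over power series is automatically continuous for the \<open>h\<close>-adic topology, hence
  determined by its values on constants: write \<open>f = f\<^sub>0 + h g\<close> and compare coefficients.
\<close>

lemma linear_on_fps_eqI:
  assumes "submodule s V" and "submodule t W"
    and F: "linear_on (fps_scale s) (fps_space V) (fps_scale t) W' F"
    and G: "linear_on (fps_scale s) (fps_space V) (fps_scale t) W'' G"
    and const: "\<And>x. x \<in> V \<Longrightarrow> F (fps_const x) = G (fps_const x)"
    and f: "f \<in> fps_space V"
  shows "F f = G f"
proof (rule fps_ext)
  note S = submodule_fps_space[OF assms(1)]
  note X = fps_scale_X[OF submodule_module[OF assms(2)]]
  fix n
  show "fps_nth (F f) n = fps_nth (G f) n" using f
  proof (induction n arbitrary: f)
    case (0 f)
    then obtain g where g: "g \<in> fps_space V" "f = fps_const (fps_nth f 0) + fps_scale s fps_X g"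
      using fps_split_const[OF assms(1)] by blast
    have "fps_nth f 0 \<in> V" using 0 by (simp add: fps_space_def)
    moreover note c = fps_const_in_fps_space[OF assms(1) this]
    moreover note gX = submodule_scale[OF S g(1), of fps_X]
    ultimately show ?case
      using const linear_on_add[OF F c gX] linear_on_add[OF G c gX]
        linear_on_scale[OF F g(1)] linear_on_scale[OF G g(1)]
      by (metis X(1) fps_add_nth g(2))
  next
    case (Suc n f)
    then obtain g where g: "g \<in> fps_space V" "f = fps_const (fps_nth f 0) + fps_scale s fps_X g"
      using fps_split_const[OF assms(1)] by blast
    have "fps_nth f 0 \<in> V" using Suc by (simp add: fps_space_def)
    moreover note c = fps_const_in_fps_space[OF assms(1) this]
    moreover note gX = submodule_scale[OF S g(1), of fps_X]
    ultimately show ?case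
      using const linear_on_add[OF F c gX] linear_on_add[OF G c gX]
        linear_on_scale[OF F g(1)] linear_on_scale[OF G g(1)] Suc.IH[OF g(1)]
      by (metis X(2) fps_add_nth g(2))
  qed
qed

section \<open>The quasi-classical limit of an associative deformation\<close>

text \<open>
  The commutator of a deformation of a commutative algebra starts in degree \<open>1\<close>, and its coefficient
  there is \<open>{f\<^sub>0, g\<^sub>0}\<close>. Jacobi and Leibniz are then the coefficients of \<open>h\<^sup>2\<close> and \<open>h\<close> in the
  corresponding identities for the commutator of an associative product.
\<close>

theorem poisson_algebra_of_assoc_qcl:
  assumes q: "assoc_qcl s V mh br m"
  shows "poisson_algebra s V br m"
proof -
  have comm: "commutative_on V m" and alg: "assoc_algebra s V m"
    and algh: "assoc_algebra (fps_scale s) (fps_space V) mh"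
    and def: "\<forall>x\<in>V. \<forall>y\<in>V. cong_h s V (mh (fps_const x) (fps_const y)) (fps_const (m x y))"
    and qcl: "qcl_bracket s V mh br"
    using q by (auto simp: assoc_qcl_def assoc_deformation_def)
  have sub: "submodule s V" and bil: "binary_operation s V m"
    using alg by (auto simp: assoc_algebra_def)
  have subh: "submodule (fps_scale s) (fps_space V)"
    and bilh: "binary_operation (fps_scale s) (fps_space V) mh"
    and assoch: "\<And>f g k. f \<in> fps_space V \<Longrightarrow> g \<in> fps_space V \<Longrightarrow> k \<in> fps_space V \<Longrightarrow>
        mh (mh f g) k = mh f (mh g k)"
    using algh by (auto simp: assoc_algebra_def)
  note X = fps_scale_X[OF submodule_module[OF sub]]
  note Vc = fps_const_in_fps_space[OF sub]
  note Vh = submodule_add[OF subh] submodule_diff[OF subh] submodule_scale[OF subh]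
  have Cl: "\<And>x y. x \<in> V \<Longrightarrow> y \<in> V \<Longrightarrow> m x y \<in> V"
    using bil by (auto simp: bilinear_on_def linear_on_def)
  have Clh: "\<And>x y. x \<in> fps_space V \<Longrightarrow> y \<in> fps_space V \<Longrightarrow> mh x y \<in> fps_space V"
    using bilh by (auto simp: bilinear_on_def linear_on_def)
  have addL: "\<And>x y z. x \<in> fps_space V \<Longrightarrow> y \<in> fps_space V \<Longrightarrow> z \<in> fps_space V \<Longrightarrow>
      mh (x + y) z = mh x z + mh y z"
    and addR: "\<And>x y z. x \<in> fps_space V \<Longrightarrow> y \<in> fps_space V \<Longrightarrow> z \<in> fps_space V \<Longrightarrow>
      mh x (y + z) = mh x y + mh x z"
    and scaleL: "\<And>c x y. x \<in> fps_space V \<Longrightarrow> y \<in> fps_space V \<Longrightarrow>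
      mh (fps_scale s c x) y = fps_scale s c (mh x y)"
    and scaleR: "\<And>c x y. x \<in> fps_space V \<Longrightarrow> y \<in> fps_space V \<Longrightarrow>
      mh x (fps_scale s c y) = fps_scale s c (mh x y)"
    using bilh by (auto simp: bilinear_on_def linear_on_def)
  have const0: "fps_nth (mh (fps_const x) (fps_const y)) 0 = m x y" if "x \<in> V" "y \<in> V" for x y
    using def that cong_h_iff[OF sub Clh[OF Vc Vc] Vc[OF Cl]] by auto
  have zeroth: "fps_nth (mh f g) 0 = m (fps_nth f 0) (fps_nth g 0)"
    if fg: "f \<in> fps_space V" "g \<in> fps_space V" for f g
  proof -
    obtain f' where f': "f' \<in> fps_space V" "f = fps_const (fps_nth f 0) + fps_scale s fps_X f'"
      using fps_split_const[OF sub fg(1)] .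
    obtain g' where g': "g' \<in> fps_space V" "g = fps_const (fps_nth g 0) + fps_scale s fps_X g'"
      using fps_split_const[OF sub fg(2)] .
    have V0: "fps_nth f 0 \<in> V" "fps_nth g 0 \<in> V" using fg by (auto simp: fps_space_def)
    have "mh f g = mh (fps_const (fps_nth f 0)) g + fps_scale s fps_X (mh f' g)"
      using addL[OF Vc[OF V0(1)] Vh(3)[OF f'(1)] fg(2)] scaleL[OF f'(1) fg(2)] f'(2) by metis
    also have "mh (fps_const (fps_nth f 0)) g = mh (fps_const (fps_nth f 0)) (fps_const (fps_nth g 0))
        + fps_scale s fps_X (mh (fps_const (fps_nth f 0)) g')"
      using addR[OF Vc[OF V0(1)] Vc[OF V0(2)] Vh(3)[OF g'(1)]] scaleR[OF Vc[OF V0(1)] g'(1)] g'(2)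
      by metis
    finally show ?thesis using const0[OF V0] by (simp add: X)
  qed
  define cm where "cm f g = mh f g - mh g f" for f g
  have cmCl: "cm f g \<in> fps_space V" if "f \<in> fps_space V" "g \<in> fps_space V" for f g
    using that Clh Vh by (simp add: cm_def)
  have cm_addL: "cm (f + g) k = cm f k + cm g k"
    and cm_addR: "cm k (f + g) = cm k f + cm k g"
    if "f \<in> fps_space V" "g \<in> fps_space V" "k \<in> fps_space V" for f g k
    using that by (simp_all add: cm_def addL addR)
  interpret Mh: module "fps_scale s" by (rule submodule_module[OF subh])
  have cm_scaleL: "cm (fps_scale s c f) g = fps_scale s c (cm f g)"
    and cm_scaleR: "cm g (fps_scale s c f) = fps_scale s c (cm g f)"
    if "f \<in> fps_space V" "g \<in> fps_space V" for c f g
    using that by (simp_all add: cm_def scaleL scaleR Mh.scale_right_diff_distrib)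
  have cm0: "fps_nth (cm f g) 0 = 0" if "f \<in> fps_space V" "g \<in> fps_space V" for f g
    using zeroth[OF that] zeroth[OF that(2,1)] that comm
    by (simp add: cm_def commutative_on_def fps_space_def)
  have brV: "br x y \<in> V" and cm_const: "fps_nth (cm (fps_const x) (fps_const y)) 1 = br x y"
    if "x \<in> V" "y \<in> V" for x y
    using qcl that by (auto simp: qcl_bracket_def quot_cong_h_iff[OF sub] cm_def)
  have cm1: "fps_nth (cm f g) 1 = br (fps_nth f 0) (fps_nth g 0)"
    if fg: "f \<in> fps_space V" "g \<in> fps_space V" for f g
  proof -
    obtain f' where f': "f' \<in> fps_space V" "f = fps_const (fps_nth f 0) + fps_scale s fps_X f'"
      using fps_split_const[OF sub fg(1)] .
    obtain g' where g': "g' \<in> fps_space V" "g = fps_const (fps_nth g 0) + fps_scale s fps_X g'"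
      using fps_split_const[OF sub fg(2)] .
    have V0: "fps_nth f 0 \<in> V" "fps_nth g 0 \<in> V" using fg by (auto simp: fps_space_def)
    have "cm f g = cm (fps_const (fps_nth f 0)) g + fps_scale s fps_X (cm f' g)"
      using cm_addL[OF Vc[OF V0(1)] Vh(3)[OF f'(1)] fg(2)] cm_scaleL[OF f'(1) fg(2)] f'(2) by metis
    also have "cm (fps_const (fps_nth f 0)) g = cm (fps_const (fps_nth f 0)) (fps_const (fps_nth g 0))
        + fps_scale s fps_X (cm (fps_const (fps_nth f 0)) g')"
      using cm_addR[OF Vc[OF V0(2)] Vh(3)[OF g'(1)] Vc[OF V0(1)]]
        cm_scaleR[OF g'(1) Vc[OF V0(1)]] g'(2)
      by metis
    finally show ?thesis
      using cm_const[OF V0] cm0[OF f'(1) fg(2)] cm0[OF Vc[OF V0(1)] g'(1)] X(2)[of _ 0] by simp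
  qed
  have cm_X: "\<exists>k\<in>fps_space V. cm f g = fps_scale s fps_X k \<and>
      fps_nth k 0 = br (fps_nth f 0) (fps_nth g 0)"
    if fg: "f \<in> fps_space V" "g \<in> fps_space V" for f g
  proof -
    obtain k where k: "k \<in> fps_space V"
      "cm f g = fps_const (fps_nth (cm f g) 0) + fps_scale s fps_X k"
      using fps_split_const[OF sub cmCl[OF fg]] .
    then have "cm f g = fps_scale s fps_X k" using cm0[OF fg] by simp
    with k(1) cm1[OF fg] X(2)[of k 0] show ?thesis by auto
  qed
  have bilbr: "binary_operation s V br"
    unfolding bilinear_on_def linear_on_def
  proof (intro conjI ballI allI)
    fix x y z c assume V: "x \<in> V" "y \<in> V" 
    have cc: "fps_const (s c y) = fps_scale s (fps_const c) (fps_const y)" for c y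
      by (rule fps_scale_const_const[OF submodule_module[OF sub], symmetric])
    show "br x y \<in> V" "br x y \<in> V" using brV V by auto
    show "br x (s c y) = s c (br x y)"
      using cm_const[OF V(1) submodule_scale[OF sub V(2)], of c] cm_scaleR[OF Vc[OF V(2)] Vc[OF V(1)]]
        cm_const[OF V] fps_scale_const[OF submodule_module[OF sub]] cc by simp
    show "br (s c y) x = s c (br y x)"
      using cm_const[OF submodule_scale[OF sub V(2)] V(1), of c] cm_scaleL[OF Vc[OF V(2)] Vc[OF V(1)]]
        cm_const[OF V(2,1)] fps_scale_const[OF submodule_module[OF sub]] cc by simp
    assume z: "z \<in> V"
    show "br x (y + z) = br x y + br x z"
      using cm_const[OF V(1) submodule_add[OF sub V(2) z]]
        cm_addR[OF Vc[OF V(2)] Vc[OF z] Vc[OF V(1)]] cm_const[OF V] cm_const[OF V(1) z]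
      by (simp flip: fps_const_add)
    show "br (y + z) x = br y x + br z x"
      using cm_const[OF submodule_add[OF sub V(2) z] V(1)]
        cm_addL[OF Vc[OF V(2)] Vc[OF z] Vc[OF V(1)]] cm_const[OF V(2,1)] cm_const[OF z V(1)]
      by (simp flip: fps_const_add)
  qed
  have br_self: "br x x = 0" if "x \<in> V" for x
    using cm_const[OF that that] by (simp add: cm_def)
  have cm2: "fps_nth (cm (fps_const x) (cm (fps_const y) (fps_const z))) 2 = br x (br y z)"
    if V: "x \<in> V" "y \<in> V" "z \<in> V" for x y z
  proof -
    obtain k where k: "k \<in> fps_space V" "cm (fps_const y) (fps_const z) = fps_scale s fps_X k"
      "fps_nth k 0 = br y z"
      using cm_X[OF Vc[OF V(2)] Vc[OF V(3)]] by auto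
    then show ?thesis
      using cm_scaleR[OF k(1) Vc[OF V(1)]] cm1[OF Vc[OF V(1)] k(1)] X(2)[of _ 1]
      by (simp add: numeral_2_eq_2)
  qed
  have diffL: "mh (f - g) k = mh f k - mh g k" and diffR: "mh k (f - g) = mh k f - mh k g"
    if "f \<in> fps_space V" "g \<in> fps_space V" "k \<in> fps_space V" for f g k
    using addL[of "f - g" g k] addR[of k "f - g" g] that Vh by (simp_all add: algebra_simps)
  have jac: "br x (br y z) + br y (br z x) + br z (br x y) = 0"
    if V: "x \<in> V" "y \<in> V" "z \<in> V" for x y z
  proof -
    let ?c = fps_const
    note W = Vc[OF V(1)] Vc[OF V(2)] Vc[OF V(3)]
    have "cm (?c x) (cm (?c y) (?c z)) + cm (?c y) (cm (?c z) (?c x)) + cm (?c z) (cm (?c x) (?c y)) = 0"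
      using W by (simp add: cm_def diffL diffR Clh assoch)
    from arg_cong[OF this, of "\<lambda>f. fps_nth f 2"] show ?thesis
      using cm2 V by simp
  qed
  have leib: "br x (m y z) = m (br x y) z + m y (br x z)"
    if V: "x \<in> V" "y \<in> V" "z \<in> V" for x y z
  proof -
    let ?c = fps_const
    note W = Vc[OF V(1)] Vc[OF V(2)] Vc[OF V(3)]
    have id: "cm (?c x) (mh (?c y) (?c z)) = mh (cm (?c x) (?c y)) (?c z) + mh (?c y) (cm (?c x) (?c z))"
      using W by (simp add: cm_def diffL diffR Clh assoch)
    obtain k where k: "k \<in> fps_space V" "cm (?c x) (?c y) = fps_scale s fps_X k"
      "fps_nth k 0 = br x y"
      using cm_X[OF W(1,2)] by auto
    obtain l where l: "l \<in> fps_space V" "cm (?c x) (?c z) = fps_scale s fps_X l"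
      "fps_nth l 0 = br x z"
      using cm_X[OF W(1,3)] by auto
    have "fps_nth (cm (?c x) (mh (?c y) (?c z))) 1 = br x (m y z)"
      using cm1[OF W(1) Clh[OF W(2,3)]] zeroth[OF W(2,3)] by simp
    moreover have "fps_nth (mh (cm (?c x) (?c y)) (?c z)) 1 = m (br x y) z"
      using scaleL[OF k(1) W(3)] k zeroth[OF k(1) W(3)] X(2)[of _ 0] by simp
    moreover have "fps_nth (mh (?c y) (cm (?c x) (?c z))) 1 = m y (br x z)"
      using scaleR[OF W(2) l(1)] l zeroth[OF W(2) l(1)] X(2)[of _ 0] by simp
    ultimately show ?thesis
      using arg_cong[OF id, of "\<lambda>f. fps_nth f 1"] by simp
  qed
  show ?thesis unfolding poisson_algebra_def lie_algebra_def
    using sub bilbr br_self jac leib alg comm by auto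
qed

section \<open>Modules in duality and their doubles\<close>

lemma submodule_sum_scale:
  assumes "submodule s A" "submodule t B"
  shows "submodule (sum_scale s t) (A \<times> B)"
proof -
  interpret A: module s by (rule submodule_module[OF assms(1)])
  interpret B: module t by (rule submodule_module[OF assms(2)])
  have M: "module (sum_scale s t)"
    by unfold_locales
      (auto simp: sum_scale_def plus_prod_def A.scale_right_distrib A.scale_left_distrib
        B.scale_right_distrib B.scale_left_distrib)
  show ?thesis
    using assms
    by (auto simp: submodule_def M module.subspace_def[OF M] sum_scale_def A.subspace_def
        B.subspace_def zero_prod_def)
qed

text \<open>
  The same pair of locales serves twice: over the field for \<open>A\<close> and \<open>A\<^sup>*\<close>, and over \<open>K\<close> for \<open>A[[h]]\<close> and
  \<open>(A\<^sup>*)[[h]]\<close>.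
\<close>

locale paired_modules =
  fixes s :: "'r::comm_ring_1 \<Rightarrow> 'a::ab_group_add \<Rightarrow> 'a" and A :: "'a set"
    and t :: "'r \<Rightarrow> 'b::ab_group_add \<Rightarrow> 'b" and B :: "'b set"
    and P :: "'b \<Rightarrow> 'a \<Rightarrow> 'r"
  assumes subA: "submodule s A" and subB: "submodule t B"
    and P_bilinear: "bilinear_on t B s A (*) UNIV P"
    and nondegA: "\<lbrakk>x \<in> A; \<And>u. u \<in> B \<Longrightarrow> P u x = 0\<rbrakk> \<Longrightarrow> x = 0"
    and nondegB: "\<lbrakk>u \<in> B; \<And>x. x \<in> A \<Longrightarrow> P u x = 0\<rbrakk> \<Longrightarrow> u = 0"
begin

lemmas A_closed = submodule_zero[OF subA] submodule_add[OF subA] submodule_scale[OF subA]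
  submodule_neg[OF subA] submodule_diff[OF subA]
lemmas B_closed = submodule_zero[OF subB] submodule_add[OF subB] submodule_scale[OF subB]
  submodule_neg[OF subB] submodule_diff[OF subB]

lemma P_right:
  assumes "u \<in> B"
  shows "x \<in> A \<Longrightarrow> y \<in> A \<Longrightarrow> P u (x + y) = P u x + P u y"
    and "x \<in> A \<Longrightarrow> P u (s c x) = c * P u x"
    and "P u 0 = 0"
    and "x \<in> A \<Longrightarrow> P u (- x) = - P u x"
    and "x \<in> A \<Longrightarrow> y \<in> A \<Longrightarrow> P u (x - y) = P u x - P u y"
proof -
  note lin = bilinear_on_right[OF P_bilinear assms]
  show "x \<in> A \<Longrightarrow> y \<in> A \<Longrightarrow> P u (x + y) = P u x + P u y" by (rule linear_on_add[OF lin])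
  show "x \<in> A \<Longrightarrow> P u (s c x) = c * P u x" by (rule linear_on_scale[OF lin])
  show "P u 0 = 0" by (rule linear_on_zero[OF lin subA])
  show "x \<in> A \<Longrightarrow> P u (- x) = - P u x" by (rule linear_on_neg[OF lin subA])
  show "x \<in> A \<Longrightarrow> y \<in> A \<Longrightarrow> P u (x - y) = P u x - P u y" by (rule linear_on_diff[OF lin subA])
qed

lemma P_left:
  assumes "x \<in> A"
  shows "u \<in> B \<Longrightarrow> v \<in> B \<Longrightarrow> P (u + v) x = P u x + P v x"
    and "u \<in> B \<Longrightarrow> P (t c u) x = c * P u x"
    and "P 0 x = 0"
    and "u \<in> B \<Longrightarrow> P (- u) x = - P u x"
    and "u \<in> B \<Longrightarrow> v \<in> B \<Longrightarrow> P (u - v) x = P u x - P v x"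
proof -
  note lin = bilinear_on_left[OF P_bilinear assms]
  show "u \<in> B \<Longrightarrow> v \<in> B \<Longrightarrow> P (u + v) x = P u x + P v x" by (rule linear_on_add[OF lin])
  show "u \<in> B \<Longrightarrow> P (t c u) x = c * P u x" by (rule linear_on_scale[OF lin])
  show "P 0 x = 0" by (rule linear_on_zero[OF lin subB])
  show "u \<in> B \<Longrightarrow> P (- u) x = - P u x" by (rule linear_on_neg[OF lin subB])
  show "u \<in> B \<Longrightarrow> v \<in> B \<Longrightarrow> P (u - v) x = P u x - P v x" by (rule linear_on_diff[OF lin subB])
qed

lemma A_eqI:
  assumes "x \<in> A" "y \<in> A" "\<And>u. u \<in> B \<Longrightarrow> P u x = P u y"
  shows "x = y"
  using nondegA[of "x - y"] assms by (simp add: A_closed P_right)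

lemma B_eqI:
  assumes "u \<in> B" "v \<in> B" "\<And>x. x \<in> A \<Longrightarrow> P u x = P v x"
  shows "u = v"
  using nondegB[of "u - v"] assms by (simp add: B_closed P_left)

end

text \<open>
  Two algebras in duality act on each other by the transposes of right and left multiplication,
  \<open>lA = R\<^sup>*\<close>, \<open>rA = L\<^sup>*\<close>, and likewise \<open>lB\<close>, \<open>rB\<close>. The actions are prescribed by their adjunction formulas
  on the carriers alone, because actions that are given by definite descriptions, or that merge in the
  commutative case, are known only there.
\<close>

locale double = paired_modules s A t B P
  for s :: "'r::comm_ring_1 \<Rightarrow> 'a::ab_group_add \<Rightarrow> 'a" and A :: "'a set"
    and t :: "'r \<Rightarrow> 'b::ab_group_add \<Rightarrow> 'b" and B :: "'b set"
    and P :: "'b \<Rightarrow> 'a \<Rightarrow> 'r" +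
  fixes mA :: "'a \<Rightarrow> 'a \<Rightarrow> 'a" and mB :: "'b \<Rightarrow> 'b \<Rightarrow> 'b"
    and lA rA :: "'a \<Rightarrow> 'b \<Rightarrow> 'b" and lB rB :: "'b \<Rightarrow> 'a \<Rightarrow> 'a"
  assumes mA_bilinear: "binary_operation s A mA" and mB_bilinear: "binary_operation t B mB"
    and lA_closed: "x \<in> A \<Longrightarrow> u \<in> B \<Longrightarrow> lA x u \<in> B"
    and rA_closed: "x \<in> A \<Longrightarrow> u \<in> B \<Longrightarrow> rA x u \<in> B"
    and lB_closed: "u \<in> B \<Longrightarrow> x \<in> A \<Longrightarrow> lB u x \<in> A"
    and rB_closed: "u \<in> B \<Longrightarrow> x \<in> A \<Longrightarrow> rB u x \<in> A"
    and lA_adjoint: "\<lbrakk>x \<in> A; u \<in> B; y \<in> A\<rbrakk> \<Longrightarrow> P (lA x u) y = P u (mA y x)"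
    and rA_adjoint: "\<lbrakk>x \<in> A; u \<in> B; y \<in> A\<rbrakk> \<Longrightarrow> P (rA x u) y = P u (mA x y)"
    and lB_adjoint: "\<lbrakk>u \<in> B; v \<in> B; x \<in> A\<rbrakk> \<Longrightarrow> P v (lB u x) = P (mB v u) x"
    and rB_adjoint: "\<lbrakk>u \<in> B; v \<in> B; x \<in> A\<rbrakk> \<Longrightarrow> P v (rB u x) = P (mB u v) x"
begin

lemma mA_simps:
  assumes "x \<in> A" "y \<in> A"
  shows "mA x y \<in> A"
    "z \<in> A \<Longrightarrow> mA (x + y) z = mA x z + mA y z" "z \<in> A \<Longrightarrow> mA z (x + y) = mA z x + mA z y"
    "mA (s c x) y = s c (mA x y)" "mA y (s c x) = s c (mA y x)"
  using bilinear_on_left[OF mA_bilinear] bilinear_on_right[OF mA_bilinear] assms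
  by (auto simp: linear_on_def)

lemma mB_simps:
  assumes "x \<in> B" "y \<in> B"
  shows "mB x y \<in> B"
    "z \<in> B \<Longrightarrow> mB (x + y) z = mB x z + mB y z" "z \<in> B \<Longrightarrow> mB z (x + y) = mB z x + mB z y"
    "mB (t c x) y = t c (mB x y)" "mB y (t c x) = t c (mB y x)"
  using bilinear_on_left[OF mB_bilinear] bilinear_on_right[OF mB_bilinear] assms
  by (auto simp: linear_on_def)

lemma mult_zero:
  "x \<in> A \<Longrightarrow> mA 0 x = 0" "x \<in> A \<Longrightarrow> mA x 0 = 0" "u \<in> B \<Longrightarrow> mB 0 u = 0" "u \<in> B \<Longrightarrow> mB u 0 = 0"
  using linear_on_zero[OF bilinear_on_right[OF mA_bilinear] subA]
    linear_on_zero[OF bilinear_on_left[OF mA_bilinear] subA]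
    linear_on_zero[OF bilinear_on_right[OF mB_bilinear] subB]
    linear_on_zero[OF bilinear_on_left[OF mB_bilinear] subB] by auto

lemmas closed = A_closed B_closed lA_closed rA_closed lB_closed rB_closed mA_simps(1) mB_simps(1)
lemmas adjoint = lA_adjoint rA_adjoint lB_adjoint rB_adjoint

lemma lA_bilinear: "bilinear_on s A t B t B lA"
  unfolding bilinear_on_def linear_on_def
  by (intro conjI ballI allI)
    (auto intro!: B_eqI simp: closed adjoint P_left P_right mA_simps)

lemma rA_bilinear: "bilinear_on s A t B t B rA"
  unfolding bilinear_on_def linear_on_def
  by (intro conjI ballI allI)
    (auto intro!: B_eqI simp: closed adjoint P_left P_right mA_simps)

lemma lB_bilinear: "bilinear_on t B s A s A lB"
  unfolding bilinear_on_def linear_on_def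
  by (intro conjI ballI allI)
    (auto intro!: A_eqI simp: closed adjoint P_left P_right mB_simps)

lemma rB_bilinear: "bilinear_on t B s A s A rB"
  unfolding bilinear_on_def linear_on_def
  by (intro conjI ballI allI)
    (auto intro!: A_eqI simp: closed adjoint P_left P_right mB_simps)

lemma action_zero:
  "x \<in> A \<Longrightarrow> lA x 0 = 0" "x \<in> A \<Longrightarrow> rA x 0 = 0" "x \<in> A \<Longrightarrow> lB 0 x = 0" "x \<in> A \<Longrightarrow> rB 0 x = 0"
  "u \<in> B \<Longrightarrow> lA 0 u = 0" "u \<in> B \<Longrightarrow> rA 0 u = 0" "u \<in> B \<Longrightarrow> lB u 0 = 0" "u \<in> B \<Longrightarrow> rB u 0 = 0"
  using linear_on_zero[OF bilinear_on_right[OF lA_bilinear] subB]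
    linear_on_zero[OF bilinear_on_right[OF rA_bilinear] subB]
    linear_on_zero[OF bilinear_on_left[OF lA_bilinear] subA]
    linear_on_zero[OF bilinear_on_left[OF rA_bilinear] subA]
    linear_on_zero[OF bilinear_on_right[OF lB_bilinear] subA]
    linear_on_zero[OF bilinear_on_right[OF rB_bilinear] subA]
    linear_on_zero[OF bilinear_on_left[OF lB_bilinear] subB]
    linear_on_zero[OF bilinear_on_left[OF rB_bilinear] subB]
  by auto

lemma action_add:
  assumes "x \<in> A" "u \<in> B" "y \<in> A" "v \<in> B"
  shows "lA x (u + v) = lA x u + lA x v" "lA (x + y) u = lA x u + lA y u"
    "rA x (u + v) = rA x u + rA x v" "rA (x + y) u = rA x u + rA y u"
    "lB (u + v) x = lB u x + lB v x" "lB u (x + y) = lB u x + lB u y"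
    "rB (u + v) x = rB u x + rB v x" "rB u (x + y) = rB u x + rB u y"
  using assms lA_bilinear rA_bilinear lB_bilinear rB_bilinear
  by (auto simp: bilinear_on_def linear_on_def)

lemma action_scale:
  assumes "x \<in> A" "u \<in> B"
  shows "lA x (t c u) = t c (lA x u)" "lA (s c x) u = t c (lA x u)"
    "rA x (t c u) = t c (rA x u)" "rA (s c x) u = t c (rA x u)"
    "lB (t c u) x = s c (lB u x)" "lB u (s c x) = s c (lB u x)"
    "rB (t c u) x = s c (rB u x)" "rB u (s c x) = s c (rB u x)"
  using assms lA_bilinear rA_bilinear lB_bilinear rB_bilinear
  by (auto simp: bilinear_on_def linear_on_def)

abbreviation "D \<equiv> A \<times> B"
abbreviation prod (infixl "\<odot>" 70) where "prod \<equiv> bowtie mA mB lA rA lB rB"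

definition form where "form p q = P (snd p) (fst q) + P (snd q) (fst p)"

lemma submodule_double: "submodule (sum_scale s t) D"
  by (rule submodule_sum_scale[OF subA subB])

lemma prod_closed: "p \<in> D \<Longrightarrow> q \<in> D \<Longrightarrow> p \<odot> q \<in> D"
  by (auto simp: bowtie_def closed)

lemma prod_add:
  assumes "p \<in> D" "q \<in> D" "r \<in> D"
  shows "(p + q) \<odot> r = p \<odot> r + q \<odot> r" "r \<odot> (p + q) = r \<odot> p + r \<odot> q"
  using assms by (auto simp: bowtie_def closed mA_simps mB_simps action_add)

lemma prod_bilinear: "binary_operation (sum_scale s t) D (\<odot>)"
proof -
  interpret A: module s by (rule submodule_module[OF subA])
  interpret B: module t by (rule submodule_module[OF subB])
  have "sum_scale s t c p \<odot> q = sum_scale s t c (p \<odot> q)"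
    and "q \<odot> sum_scale s t c p = sum_scale s t c (q \<odot> p)" if "p \<in> D" "q \<in> D" for c p q
    using that by (auto simp: bowtie_def sum_scale_def closed mA_simps mB_simps action_scale
        A.scale_right_distrib B.scale_right_distrib)
  then show ?thesis
    unfolding bilinear_on_def linear_on_def
    by (intro conjI ballI allI) (simp_all only: prod_closed prod_add)
qed

lemma form_add:
  assumes "p \<in> D" "q \<in> D" "r \<in> D"
  shows "form (p + q) r = form p r + form q r" "form r (p + q) = form r p + form r q"
  using assms by (auto simp: form_def P_left P_right)

lemma form_commute: "form p q = form q p"
  by (simp add: form_def add.commute)

text \<open>
  Choosing the transposed multiplications as actions is exactly what makes the natural form on the
  double invariant.
\<close>

lemma form_invariant:
  assumes "p \<in> D" "q \<in> D" "r \<in> D"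
  shows "form (p \<odot> q) r = form p (q \<odot> r)"
  using assms by (auto simp: form_def bowtie_def closed adjoint P_left P_right algebra_simps)

lemma form_eqI:
  assumes "p \<in> D" "q \<in> D" "\<And>r. r \<in> D \<Longrightarrow> form p r = form q r"
  shows "p = q"
proof (rule prod_eqI)
  show "fst p = fst q"
    using assms(1,2) assms(3)[of "(0, u)" for u]
    by (intro A_eqI) (auto simp: form_def P_left P_right closed)
  show "snd p = snd q"
    using assms(1,2) assms(3)[of "(x, 0)" for x]
    by (intro B_eqI) (auto simp: form_def P_left P_right closed)
qed

definition cyc where "cyc p q r w \<longleftrightarrow> form (p \<odot> q) (r \<odot> w) = form (q \<odot> r) (w \<odot> p)"

text \<open>
  Associativity of the double, tested with the invariant form, becomes a condition on four elements
  that is invariant under their cyclic rotation. This is what reduces the many components of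
  associativity to four cases.
\<close>

lemma assoc_iff_cyc:
  "(\<forall>p\<in>D. \<forall>q\<in>D. \<forall>r\<in>D. (p \<odot> q) \<odot> r = p \<odot> (q \<odot> r)) \<longleftrightarrow>
   (\<forall>p\<in>D. \<forall>q\<in>D. \<forall>r\<in>D. \<forall>w\<in>D. cyc p q r w)"
proof -
  have 1: "form ((p \<odot> q) \<odot> r) w = form (p \<odot> q) (r \<odot> w)"
    if "p \<in> D" "q \<in> D" "r \<in> D" "w \<in> D" for p q r w
    by (rule form_invariant) (simp_all only: that prod_closed)
  have 2: "form (p \<odot> (q \<odot> r)) w = form (q \<odot> r) (w \<odot> p)"
    if D: "p \<in> D" "q \<in> D" "r \<in> D" "w \<in> D" for p q r w
    using form_invariant[OF D(4,1) prod_closed[OF D(2,3)]] form_commute by metis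
  show ?thesis
  proof (intro iffI ballI)
    fix p q r w assume "\<forall>p\<in>D. \<forall>q\<in>D. \<forall>r\<in>D. (p \<odot> q) \<odot> r = p \<odot> (q \<odot> r)"
      and D: "p \<in> D" "q \<in> D" "r \<in> D" "w \<in> D"
    then have "(p \<odot> q) \<odot> r = p \<odot> (q \<odot> r)" by blast
    then show "cyc p q r w" unfolding cyc_def 1[OF D, symmetric] 2[OF D, symmetric] by (rule arg_cong)
  next
    fix p q r assume *: "\<forall>p\<in>D. \<forall>q\<in>D. \<forall>r\<in>D. \<forall>w\<in>D. cyc p q r w"
      and D: "p \<in> D" "q \<in> D" "r \<in> D"
    show "(p \<odot> q) \<odot> r = p \<odot> (q \<odot> r)"
    proof (rule form_eqI)
      fix w assume "w \<in> D"
      with * D have "cyc p q r w" by blast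
      then show "form ((p \<odot> q) \<odot> r) w = form (p \<odot> (q \<odot> r)) w"
        unfolding cyc_def 1[OF D \<open>w \<in> D\<close>] 2[OF D \<open>w \<in> D\<close>] .
    qed (simp_all only: D prod_closed)
  qed
qed

lemma cyc_rotate: "cyc p q r w \<longleftrightarrow> cyc q r w p"
  unfolding cyc_def by (metis form_commute)

lemma cyc_add:
  assumes "p \<in> D" "p' \<in> D" "q \<in> D" "r \<in> D" "w \<in> D" "cyc p q r w" "cyc p' q r w"
  shows "cyc (p + p') q r w"
  using assms unfolding cyc_def by (simp add: prod_add form_add prod_closed closed)

abbreviation "pure \<equiv> A \<times> {0} \<union> {0} \<times> B"

lemma pure_D: "p \<in> pure \<Longrightarrow> p \<in> D"
  by (auto simp: closed)

lemma cyc_first: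
  assumes "\<And>p. p \<in> pure \<Longrightarrow> cyc p q r w" "p \<in> D" "q \<in> D" "r \<in> D" "w \<in> D"
  shows "cyc p q r w"
proof -
  have "cyc ((fst p, 0) + (0, snd p)) q r w"
    using assms by (intro cyc_add) (auto simp: closed)
  then show ?thesis by simp
qed

lemma cyc_pureI:
  assumes "\<And>p q r w. p \<in> pure \<Longrightarrow> q \<in> pure \<Longrightarrow> r \<in> pure \<Longrightarrow> w \<in> pure \<Longrightarrow> cyc p q r w"
    and D: "p \<in> D" "q \<in> D" "r \<in> D" "w \<in> D"
  shows "cyc p q r w"
proof -
  have 1: "cyc p q r w" if "p \<in> D" "q \<in> pure" "r \<in> pure" "w \<in> pure" for p q r w
    by (rule cyc_first) (simp_all only: that pure_D assms(1))
  have 2: "cyc p q r w" if pqrw: "p \<in> D" "q \<in> D" "r \<in> pure" "w \<in> pure" for p q r w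
  proof -
    have "cyc q r w p"
    proof (rule cyc_first)
      show "cyc q' r w p" if q': "q' \<in> pure" for q'
        using 1[OF pqrw(1) q' pqrw(3,4)] unfolding cyc_rotate[of p] .
    qed (simp_all only: pqrw pure_D)
    then show ?thesis by (simp only: cyc_rotate[of p])
  qed
  have 3: "cyc p q r w" if pqrw: "p \<in> D" "q \<in> D" "r \<in> D" "w \<in> pure" for p q r w
  proof -
    have "cyc r w p q"
    proof (rule cyc_first)
      show "cyc r' w p q" if r': "r' \<in> pure" for r'
        using 2[OF pqrw(1,2) r' pqrw(4)] unfolding cyc_rotate[of p] cyc_rotate[of q] .
    qed (simp_all only: pqrw pure_D)
    then show ?thesis by (simp only: cyc_rotate[of p] cyc_rotate[of q])
  qed
  have "cyc w p q r"
  proof (rule cyc_first)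
    show "cyc w' p q r" if w': "w' \<in> pure" for w'
      using 3[OF D(1-3) w'] unfolding cyc_rotate[of w'] .
  qed (simp_all only: D)
  then show ?thesis by (simp only: cyc_rotate[of w])
qed

text \<open>
  Up to rotation there are six types of pure quadruples. Four entries from the same algebra give no
  condition and three express its associativity; two entries from each, adjacent or alternating, give
  the two identities below. In terms of a comultiplication dual to \<open>mB\<close>, these are the two identities of
  an ASI bialgebra tested on \<open>u \<otimes> v\<close>.
\<close>

definition adjacent_identity where
  "adjacent_identity x y u v \<longleftrightarrow>
    P (mB u v) (mA x y) = P (mB u (rA x v)) y + P (mB (lA y u) v) x"

definition alternating_identity where
  "alternating_identity x y u v \<longleftrightarrow>
    P (mB (rA y u) v) x - P (mB u (lA y v)) x + (P (mB (rA x v) u) y - P (mB v (lA x u)) y) = 0"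

lemma pure_prod:
  "x \<in> A \<Longrightarrow> y \<in> A \<Longrightarrow> (x, 0) \<odot> (y, 0) = (mA x y, 0)"
  "u \<in> B \<Longrightarrow> v \<in> B \<Longrightarrow> (0, u) \<odot> (0, v) = (0, mB u v)"
  "x \<in> A \<Longrightarrow> v \<in> B \<Longrightarrow> (x, 0) \<odot> (0, v) = (rB v x, lA x v)"
  "u \<in> B \<Longrightarrow> y \<in> A \<Longrightarrow> (0, u) \<odot> (y, 0) = (lB u y, rA y u)"
  by (simp_all add: bowtie_def action_zero mult_zero A_closed(1) B_closed(1))

lemma pureE:
  assumes "p \<in> pure"
  obtains x where "p = (x, 0)" "x \<in> A" | u where "p = (0, u)" "u \<in> B"
  using assms by blast

lemma cyc_adjacent:
  assumes "x \<in> A" "y \<in> A" "u \<in> B" "v \<in> B"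
  shows "cyc (x, 0) (y, 0) (0, u) (0, v) \<longleftrightarrow> adjacent_identity x y u v"
  using assms by (simp add: cyc_def adjacent_identity_def pure_prod P_left P_right form_def closed adjoint mult_zero add.commute)

lemma cyc_alternating:
  assumes "x \<in> A" "y \<in> A" "u \<in> B" "v \<in> B"
  shows "cyc (x, 0) (0, u) (y, 0) (0, v) \<longleftrightarrow> alternating_identity x y u v"
  using assms
  by (simp add: cyc_def alternating_identity_def pure_prod P_left P_right form_def closed adjoint
      algebra_simps) (auto simp: add.commute)

lemma cyc_AAAB:
  assumes "x \<in> A" "y \<in> A" "z \<in> A" "u \<in> B"
  shows "cyc (x, 0) (y, 0) (z, 0) (0, u) \<longleftrightarrow> P u (mA (mA x y) z) = P u (mA x (mA y z))"
  using assms by (simp add: cyc_def pure_prod P_left P_right form_def closed adjoint mult_zero)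

lemma cyc_BBBA:
  assumes "x \<in> A" "u \<in> B" "v \<in> B" "w \<in> B"
  shows "cyc (0, u) (0, v) (0, w) (x, 0) \<longleftrightarrow> P (mB (mB u v) w) x = P (mB u (mB v w)) x"
  using assms by (simp add: cyc_def pure_prod P_left P_right form_def closed adjoint mult_zero)

lemma cyc_AAAA:
  assumes "x \<in> A" "y \<in> A" "z \<in> A" "w \<in> A"
  shows "cyc (x, 0) (y, 0) (z, 0) (w, 0)"
  using assms by (simp add: cyc_def pure_prod P_left P_right form_def closed)

lemma cyc_BBBB:
  assumes "x \<in> B" "y \<in> B" "z \<in> B" "w \<in> B"
  shows "cyc (0, x) (0, y) (0, z) (0, w)"
  using assms by (simp add: cyc_def pure_prod P_left P_right form_def closed)

theorem matched_pair_iff: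
  "matched_pair s A t B mA mB lA rA lB rB \<longleftrightarrow>
    assoc_algebra s A mA \<and> assoc_algebra t B mB \<and>
    (\<forall>x\<in>A. \<forall>y\<in>A. \<forall>u\<in>B. \<forall>v\<in>B. adjacent_identity x y u v \<and> alternating_identity x y u v)"
  (is "_ \<longleftrightarrow> ?asA \<and> ?asB \<and> ?ids")
proof -
  have "(\<forall>p\<in>D. \<forall>q\<in>D. \<forall>r\<in>D. \<forall>w\<in>D. cyc p q r w) \<longleftrightarrow> ?ids" if as: ?asA ?asB
  proof
    assume *: "\<forall>p\<in>D. \<forall>q\<in>D. \<forall>r\<in>D. \<forall>w\<in>D. cyc p q r w"
    show ?ids
    proof (intro ballI)
      fix x y u v assume V: "x \<in> A" "y \<in> A" "u \<in> B" "v \<in> B"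
      then have "cyc (x, 0) (y, 0) (0, u) (0, v)" "cyc (x, 0) (0, u) (y, 0) (0, v)"
        using * by (auto simp: closed)
      with V show "adjacent_identity x y u v \<and> alternating_identity x y u v"
        by (simp add: cyc_adjacent cyc_alternating)
    qed
  next
    assume ids: ?ids
    have AAAB: "cyc (x, 0) (y, 0) (z, 0) (0, u)" if "x \<in> A" "y \<in> A" "z \<in> A" "u \<in> B" for x y z u
      using as(1) that by (simp add: cyc_AAAB assoc_algebra_def)
    have BBBA: "cyc (0, u) (0, v) (0, w) (x, 0)" if "x \<in> A" "u \<in> B" "v \<in> B" "w \<in> B" for x u v w
      using as(2) that by (simp add: cyc_BBBA assoc_algebra_def)
    have AABB: "cyc (x, 0) (y, 0) (0, u) (0, v)" and ABAB: "cyc (x, 0) (0, u) (y, 0) (0, v)"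
      if "x \<in> A" "y \<in> A" "u \<in> B" "v \<in> B" for x y u v
      using ids that by (simp_all add: cyc_adjacent cyc_alternating)
    note types = AAAB BBBA AABB ABAB
    have rot: "cyc q r w p \<Longrightarrow> cyc p q r w" "cyc r w p q \<Longrightarrow> cyc p q r w" "cyc w p q r \<Longrightarrow> cyc p q r w"
      for p q r w
      by (simp_all only: cyc_rotate[of p] cyc_rotate[of q] cyc_rotate[of w])
    have "cyc p q r w" if pure: "p \<in> pure" "q \<in> pure" "r \<in> pure" "w \<in> pure" for p q r w
      by (rule pureE[OF pure(1)]; rule pureE[OF pure(2)]; rule pureE[OF pure(3)];
          rule pureE[OF pure(4)]; simp only:;
          (rule cyc_AAAA cyc_BBBB types | rule rot(1), rule types | rule rot(2), rule types
            | rule rot(3), rule types); assumption)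
    then show "\<forall>p\<in>D. \<forall>q\<in>D. \<forall>r\<in>D. \<forall>w\<in>D. cyc p q r w"
      by (intro ballI) (rule cyc_pureI)
  qed
  then show ?thesis
    unfolding matched_pair_def
    using lA_bilinear rA_bilinear lB_bilinear rB_bilinear assoc_iff_cyc
    by (auto simp: assoc_algebra_def[of "sum_scale s t"] submodule_double prod_bilinear)
qed

end

text \<open>
  A comultiplication dual to \<open>mB\<close>. Tensors enter only through their pairing with pairs of functionals,
  which separates them, and through the transposes of \<open>f \<otimes> g\<close> and of the flip; this is common to \<open>A \<otimes> A\<close>
  and to its completion over \<open>K\<close>.
\<close>

locale tensor_double = double s A t B P mA mB lA rA lB rB
  for s :: "'r::comm_ring_1 \<Rightarrow> 'a::ab_group_add \<Rightarrow> 'a" and A :: "'a set"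
    and t :: "'r \<Rightarrow> 'b::ab_group_add \<Rightarrow> 'b" and B :: "'b set"
    and P :: "'b \<Rightarrow> 'a \<Rightarrow> 'r"
    and mA :: "'a \<Rightarrow> 'a \<Rightarrow> 'a" and mB :: "'b \<Rightarrow> 'b \<Rightarrow> 'b"
    and lA rA :: "'a \<Rightarrow> 'b \<Rightarrow> 'b" and lB rB :: "'b \<Rightarrow> 'a \<Rightarrow> 'a" +
  fixes T :: "'t::ab_group_add set" and TP :: "'b \<Rightarrow> 'b \<Rightarrow> 't \<Rightarrow> 'r"
    and tm :: "('a \<Rightarrow> 'a) \<Rightarrow> ('a \<Rightarrow> 'a) \<Rightarrow> 't \<Rightarrow> 't" and fl :: "'t \<Rightarrow> 't"
    and \<Delta> :: "'a \<Rightarrow> 't"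
  assumes T_add: "w \<in> T \<Longrightarrow> w' \<in> T \<Longrightarrow> w + w' \<in> T"
    and T_diff: "w \<in> T \<Longrightarrow> w' \<in> T \<Longrightarrow> w - w' \<in> T"
    and TP_add: "\<lbrakk>u \<in> B; v \<in> B; w \<in> T; w' \<in> T\<rbrakk> \<Longrightarrow> TP u v (w + w') = TP u v w + TP u v w'"
    and TP_diff: "\<lbrakk>u \<in> B; v \<in> B; w \<in> T; w' \<in> T\<rbrakk> \<Longrightarrow> TP u v (w - w') = TP u v w - TP u v w'"
    and T_eqI: "\<lbrakk>w \<in> T; w' \<in> T; \<And>u v. u \<in> B \<Longrightarrow> v \<in> B \<Longrightarrow> TP u v w = TP u v w'\<rbrakk> \<Longrightarrow> w = w'"
    and tm_closed: "\<lbrakk>linear_on s A s A f; linear_on s A s A g; w \<in> T\<rbrakk> \<Longrightarrow> tm f g w \<in> T"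
    and TP_tm: "\<lbrakk>linear_on s A s A f; linear_on s A s A g; w \<in> T; u \<in> B; v \<in> B; u' \<in> B; v' \<in> B;
        \<And>x. x \<in> A \<Longrightarrow> P u' x = P u (f x); \<And>x. x \<in> A \<Longrightarrow> P v' x = P v (g x)\<rbrakk> \<Longrightarrow>
        TP u v (tm f g w) = TP u' v' w"
    and fl_closed: "w \<in> T \<Longrightarrow> fl w \<in> T"
    and TP_fl: "\<lbrakk>u \<in> B; v \<in> B; w \<in> T\<rbrakk> \<Longrightarrow> TP u v (fl w) = TP v u w"
    and \<Delta>_closed: "x \<in> A \<Longrightarrow> \<Delta> x \<in> T"
    and \<Delta>_dual: "\<lbrakk>u \<in> B; v \<in> B; x \<in> A\<rbrakk> \<Longrightarrow> P (mB u v) x = TP u v (\<Delta> x)"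
begin

lemma linear_mult:
  "linear_on s A s A id" "x \<in> A \<Longrightarrow> linear_on s A s A (mult_left mA x)"
  "x \<in> A \<Longrightarrow> linear_on s A s A (mult_right mA x)"
  using mA_bilinear
  by (auto simp: bilinear_on_def linear_on_def mult_left_def mult_right_def)

lemma TP_mult:
  assumes "u \<in> B" "v \<in> B" "x \<in> A" "w \<in> T"
  shows "TP u v (tm id (mult_left mA x) w) = TP u (rA x v) w"
    "TP u v (tm id (mult_right mA x) w) = TP u (lA x v) w"
    "TP u v (tm (mult_left mA x) id w) = TP (rA x u) v w"
    "TP u v (tm (mult_right mA x) id w) = TP (lA x u) v w"
  using assms by (auto intro!: TP_tm simp: linear_mult closed adjoint mult_left_def mult_right_def)

lemma asi_identities_iff:
  "asi_identities A tm fl mA \<Delta> \<longleftrightarrow>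
    (\<forall>x\<in>A. \<forall>y\<in>A. \<forall>u\<in>B. \<forall>v\<in>B. adjacent_identity x y u v \<and> alternating_identity x y u v)"
proof -
  have eq_iff: "w = w' \<longleftrightarrow> (\<forall>u\<in>B. \<forall>v\<in>B. TP u v w = TP u v w')" if "w \<in> T" "w' \<in> T" for w w'
    using T_eqI that by blast
  have T: "\<Delta> (mA x y) \<in> T" "tm id (mult_left mA x) w \<in> T" "tm id (mult_right mA x) w \<in> T"
    "tm (mult_left mA x) id w \<in> T" "tm (mult_right mA x) id w \<in> T"
    if "x \<in> A" "y \<in> A" "w \<in> T" for x y w
    using that by (auto intro!: \<Delta>_closed tm_closed linear_mult closed)
  have zero: "0 \<in> T" using T_diff[OF \<Delta>_closed \<Delta>_closed, OF A_closed(1) A_closed(1)] by simp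
  have TP_zero: "TP u v 0 = 0" if "u \<in> B" "v \<in> B" for u v
    using TP_diff[OF that zero zero] by simp
  have "\<Delta> (mA x y) = tm id (mult_left mA x) (\<Delta> y) + tm (mult_right mA y) id (\<Delta> x) \<longleftrightarrow>
      (\<forall>u\<in>B. \<forall>v\<in>B. adjacent_identity x y u v)"
    and "(tm (mult_left mA y) id (\<Delta> x) - tm id (mult_right mA y) (\<Delta> x)) +
        fl (tm (mult_left mA x) id (\<Delta> y) - tm id (mult_right mA x) (\<Delta> y)) = 0 \<longleftrightarrow>
      (\<forall>u\<in>B. \<forall>v\<in>B. alternating_identity x y u v)"
    if "x \<in> A" "y \<in> A" for x y
    using that
    by (subst eq_iff;
      simp add: T T_add T_diff TP_add TP_diff TP_fl fl_closed TP_zero zero \<Delta>_closed TP_mult closed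
        adjacent_identity_def alternating_identity_def \<Delta>_dual)+
  then show ?thesis
    unfolding asi_identities_def by blast
qed

theorem matched_pair_iff_asi:
  "matched_pair s A t B mA mB lA rA lB rB \<longleftrightarrow>
    assoc_algebra s A mA \<and> assoc_algebra t B mB \<and> asi_identities A tm fl mA \<Delta>"
  unfolding matched_pair_iff asi_identities_iff ..

end

section \<open>Duals and tensors of a finite-dimensional space\<close>

lemma sum_fun_apply: "(\<Sum>i\<in>I. f i) x = (\<Sum>i\<in>I. f i x)" for f :: "'i \<Rightarrow> 'x \<Rightarrow> 'y::comm_monoid_add"
  by (induction I rule: infinite_finite_induct) auto

lemma module_fun_scale: "module (fun_scale :: 'k::comm_ring_1 \<Rightarrow> ('x \<Rightarrow> 'k) \<Rightarrow> _)"
  by unfold_locales (auto simp: fun_scale_def fun_eq_iff algebra_simps)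

lemma fun_scale_apply [simp]: "fun_scale c f x = c * f x"
  by (simp add: fun_scale_def)

lemma vector_space_mult: "vector_space ((*) :: 'k::field \<Rightarrow> _)"
  by unfold_locales (auto simp: algebra_simps)

definition tensor3_space ::
  "('k::field \<Rightarrow> 'a::ab_group_add \<Rightarrow> 'a) \<Rightarrow> ('a, 'k) tensor3 set" where
  "tensor3_space s = module.span fun_scale {tens3 s x y z |x y z. True}"

lemma submodule_tensor_space: "submodule fun_scale (tensor_space s)"
  by (simp add: submodule_def tensor_space_def module_fun_scale module.subspace_span)

lemma submodule_tensor3_space: "submodule fun_scale (tensor3_space s)"
  by (simp add: submodule_def tensor3_space_def module_fun_scale module.subspace_span)

lemma tens_in_tensor_space: "tens s x y \<in> tensor_space s"
  unfolding tensor_space_def by (rule module.span_base[OF module_fun_scale]) auto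

lemma tens3_in_tensor3_space: "tens3 s x y z \<in> tensor3_space s"
  unfolding tensor3_space_def by (rule module.span_base[OF module_fun_scale]) auto

context vector_space
begin

lemma dual_iff:
  "u \<in> dual_space scale \<longleftrightarrow> (\<forall>x y. u (x + y) = u x + u y) \<and> (\<forall>c x. u (scale c x) = c * u x)"
  by (simp add: dual_space_def Vector_Spaces.linear_iff vector_space_axioms vector_space_mult)

lemma bilinear_form_iff:
  "bilinear_form scale \<beta> \<longleftrightarrow> (\<forall>x. \<beta> x \<in> dual_space scale) \<and> (\<forall>y. (\<lambda>x. \<beta> x y) \<in> dual_space scale)"
  by (simp add: bilinear_form_def dual_space_def)

lemma trilinear_form_iff:
  "trilinear_form scale \<gamma> \<longleftrightarrow> (\<forall>x y. \<gamma> x y \<in> dual_space scale) \<and>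
    (\<forall>x z. (\<lambda>y. \<gamma> x y z) \<in> dual_space scale) \<and> (\<forall>y z. (\<lambda>x. \<gamma> x y z) \<in> dual_space scale)"
  by (simp add: trilinear_form_def dual_space_def)

lemma submodule_dual: "submodule fun_scale (dual_space scale)"
  by (auto simp: submodule_def module_fun_scale module.subspace_def[OF module_fun_scale] dual_iff
      algebra_simps)

lemma bilinear_form_product:
  "a \<in> dual_space scale \<Longrightarrow> b \<in> dual_space scale \<Longrightarrow> bilinear_form scale (\<lambda>x y. a x * b y)"
  by (auto simp: bilinear_form_iff dual_iff algebra_simps)

lemma trilinear_form_product:
  "a \<in> dual_space scale \<Longrightarrow> b \<in> dual_space scale \<Longrightarrow> c \<in> dual_space scale \<Longrightarrow>
    trilinear_form scale (\<lambda>x y z. a x * b y * c z)"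
  by (auto simp: trilinear_form_iff dual_iff algebra_simps)

lemma linear_on_UNIV_iff:
  "linear_on scale UNIV (*) UNIV f \<longleftrightarrow> f \<in> dual_space scale"
  by (simp add: linear_on_def dual_iff)

end

context finite_dimensional_vector_space
begin

abbreviation "dual \<equiv> dual_space scale"
abbreviation "tensors \<equiv> tensor_space scale"

definition crd where "crd b = (\<lambda>x. representation Basis x b)"

lemma crd_dual [simp]: "crd b \<in> dual"
  by (simp add: dual_iff crd_def representation_add representation_scale independent_Basis span_Basis)

lemma crd_expansion: "(\<Sum>b\<in>Basis. scale (crd b x) b) = x"
  unfolding crd_def
  by (rule sum_representation_eq) (auto simp: independent_Basis span_Basis finite_Basis)

lemma dual_sum:
  assumes "u \<in> dual"
  shows "u (\<Sum>i\<in>I. f i) = (\<Sum>i\<in>I. u (f i))"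
  by (rule linear_on_sum[where V=UNIV and s=scale and t="(*)" and W=UNIV])
    (use assms in \<open>auto simp: linear_on_UNIV_iff submodule_UNIV module_axioms\<close>)

lemma dual_expansion:
  assumes "u \<in> dual"
  shows "u x = (\<Sum>b\<in>Basis. u b * crd b x)"
proof -
  have "u x = u (\<Sum>b\<in>Basis. scale (crd b x) b)" by (simp add: crd_expansion)
  also have "\<dots> = (\<Sum>b\<in>Basis. u b * crd b x)"
    using assms by (subst dual_sum) (auto simp: dual_iff mult.commute)
  finally show ?thesis .
qed

lemma dual_expansion_fun:
  assumes "u \<in> dual"
  shows "u = (\<Sum>b\<in>Basis. fun_scale (u b) (crd b))"
  by (rule ext) (simp add: sum_fun_apply dual_expansion[OF assms, symmetric])

lemma eq_by_dual: "(\<And>u. u \<in> dual \<Longrightarrow> u x = u y) \<Longrightarrow> x = y"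
  by (metis (no_types, lifting) crd_dual crd_expansion sum.cong)

lemma bilinear_expansion:
  assumes "bilinear_form scale \<beta>"
  shows "\<beta> x y = (\<Sum>p\<in>Basis. \<Sum>q\<in>Basis. \<beta> p q * (crd p x * crd q y))"
proof -
  have "\<beta> x y = (\<Sum>q\<in>Basis. \<beta> x q * crd q y)"
    using assms by (intro dual_expansion) (simp add: bilinear_form_iff)
  also have "\<dots> = (\<Sum>q\<in>Basis. (\<Sum>p\<in>Basis. \<beta> p q * crd p x) * crd q y)"
    using assms by (intro sum.cong arg_cong2[where f="(*)"] dual_expansion[of "\<lambda>x. \<beta> x q" for q])
      (auto simp: bilinear_form_iff)
  also have "\<dots> = (\<Sum>p\<in>Basis. \<Sum>q\<in>Basis. \<beta> p q * (crd p x * crd q y))"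
    by (subst sum.swap) (simp add: sum_distrib_right mult.assoc)
  finally show ?thesis .
qed

lemma trilinear_expansion:
  assumes "trilinear_form scale \<gamma>"
  shows "\<gamma> x y z = (\<Sum>p\<in>Basis. \<Sum>q\<in>Basis. \<Sum>r\<in>Basis. \<gamma> p q r * (crd p x * crd q y * crd r z))"
proof -
  have "\<gamma> x y z = (\<Sum>p\<in>Basis. \<gamma> p y z * crd p x)"
    using assms dual_expansion[of "\<lambda>x. \<gamma> x y z" x] by (simp add: trilinear_form_iff)
  also have "\<dots> = (\<Sum>p\<in>Basis. (\<Sum>q\<in>Basis. \<Sum>r\<in>Basis. \<gamma> p q r * (crd q y * crd r z)) * crd p x)"
    using assms
    by (intro sum.cong arg_cong2[where f="(*)"] bilinear_expansion)
      (auto simp: trilinear_form_iff bilinear_form_iff)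
  finally show ?thesis by (simp add: sum_distrib_left sum_distrib_right algebra_simps)
qed

definition tcrd where "tcrd t p q = t (\<lambda>x y. crd p x * crd q y)"

text \<open>
  Bilinear forms are combinations of the \<open>crd p \<otimes> crd q\<close>, so a tensor is known from its values on
  these. All manipulations of tensors below rest on this expansion.
\<close>

lemma tensor_expansion:
  assumes "t \<in> tensors"
  shows "t \<beta> = (if bilinear_form scale \<beta> then \<Sum>p\<in>Basis. \<Sum>q\<in>Basis. \<beta> p q * tcrd t p q else 0)"
  using assms unfolding tensor_space_def
proof (induction t rule: module.span_induct_alt[OF module_fun_scale, consumes 1])
  case 1
  then show ?case by (simp add: tcrd_def)
next
  case (2 c t t')
  then obtain x y where t: "t = tens scale x y" by blast
  have "tens scale x y \<beta> =
      (if bilinear_form scale \<beta> then \<Sum>p\<in>Basis. \<Sum>q\<in>Basis. \<beta> p q * tcrd (tens scale x y) p q else 0)"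
    by (simp add: tens_def tcrd_def bilinear_form_product bilinear_expansion[of \<beta> x y])
  then show ?case using 2 t
    by (simp add: tcrd_def algebra_simps sum_distrib_left sum.distrib)
qed

lemma tensor3_expansion:
  assumes "t \<in> tensor3_space scale"
  shows "t \<gamma> = (if trilinear_form scale \<gamma> then \<Sum>p\<in>Basis. \<Sum>q\<in>Basis. \<Sum>r\<in>Basis.
    \<gamma> p q r * t (\<lambda>x y z. crd p x * crd q y * crd r z) else 0)"
  using assms unfolding tensor3_space_def
proof (induction t rule: module.span_induct_alt[OF module_fun_scale, consumes 1])
  case 1
  then show ?case by simp
next
  case (2 c t t')
  then obtain x y z where t: "t = tens3 scale x y z" by blast
  have "tens3 scale x y z \<gamma> =
      (if trilinear_form scale \<gamma> then \<Sum>p\<in>Basis. \<Sum>q\<in>Basis. \<Sum>r\<in>Basis.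
        \<gamma> p q r * tens3 scale x y z (\<lambda>x y z. crd p x * crd q y * crd r z) else 0)"
    by (simp add: tens3_def trilinear_form_product trilinear_expansion[of \<gamma> x y z])
  then show ?case using 2 t
    by (simp add: algebra_simps sum_distrib_left sum.distrib)
qed

lemma tensor_eqI:
  assumes "t \<in> tensors" "t' \<in> tensors"
    and "\<And>a b. a \<in> dual \<Longrightarrow> b \<in> dual \<Longrightarrow> tensor_pairing a b t = tensor_pairing a b t'"
  shows "t = t'"
proof
  have "tcrd t p q = tcrd t' p q" for p q
    using assms(3)[OF crd_dual crd_dual] by (simp add: tcrd_def tensor_pairing_def)
  then show "t \<beta> = t' \<beta>" for \<beta>
    by (simp add: tensor_expansion[OF assms(1)] tensor_expansion[OF assms(2)])
qed

lemma tensor3_eqI: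
  assumes "t \<in> tensor3_space scale" "t' \<in> tensor3_space scale"
    and "\<And>a b c. a \<in> dual \<Longrightarrow> b \<in> dual \<Longrightarrow> c \<in> dual \<Longrightarrow>
      t (\<lambda>x y z. a x * b y * c z) = t' (\<lambda>x y z. a x * b y * c z)"
  shows "t = t'"
proof
  have "t (\<lambda>x y z. crd p x * crd q y * crd r z) = t' (\<lambda>x y z. crd p x * crd q y * crd r z)" for p q r
    by (simp add: assms(3))
  then show "t \<gamma> = t' \<gamma>" for \<gamma>
    by (simp add: tensor3_expansion[OF assms(1), of \<gamma>] tensor3_expansion[OF assms(2), of \<gamma>])
qed

lemma tensor_linear:
  assumes "t \<in> tensors"
  shows "bilinear_form scale \<beta> \<Longrightarrow> bilinear_form scale \<beta>' \<Longrightarrow>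
      t (\<lambda>x y. \<beta> x y + \<beta>' x y) = t \<beta> + t \<beta>'"
    and "bilinear_form scale \<beta> \<Longrightarrow> t (\<lambda>x y. c * \<beta> x y) = c * t \<beta>"
proof -
  assume "bilinear_form scale \<beta>"
  then have "bilinear_form scale (\<lambda>x y. c * \<beta> x y)"
    by (simp add: bilinear_form_iff dual_iff algebra_simps)
  with \<open>bilinear_form scale \<beta>\<close> show "t (\<lambda>x y. c * \<beta> x y) = c * t \<beta>"
    by (simp add: tensor_expansion[OF assms] sum_distrib_left mult.assoc)
next
  assume b: "bilinear_form scale \<beta>" "bilinear_form scale \<beta>'"
  then have "bilinear_form scale (\<lambda>x y. \<beta> x y + \<beta>' x y)"
    by (simp add: bilinear_form_iff dual_iff algebra_simps)
  with b show "t (\<lambda>x y. \<beta> x y + \<beta>' x y) = t \<beta> + t \<beta>'"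
    by (simp add: tensor_expansion[OF assms] sum.distrib algebra_simps)
qed

lemma tlift_expansion:
  assumes "t \<in> tensors" "\<And>g. bilinear_form scale (\<lambda>x y. \<phi> x y g)"
  shows "tlift \<phi> t = (\<Sum>p\<in>Basis. \<Sum>q\<in>Basis. fun_scale (tcrd t p q) (\<phi> p q))"
  by (rule ext)
    (simp add: tlift_def tensor_expansion[OF assms(1)] assms(2) sum_fun_apply mult.commute)

lemma tlift_closed:
  assumes "t \<in> tensors" "\<And>g. bilinear_form scale (\<lambda>x y. \<phi> x y g)"
    and "submodule fun_scale W" "\<And>p q. \<phi> p q \<in> W"
  shows "tlift \<phi> t \<in> W"
  unfolding tlift_expansion[OF assms(1,2)]
  by (intro submodule_sum[OF assms(3)] submodule_scale[OF assms(3)] assms(4))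

lemma tensor_pairing_linear:
  "tensor_pairing a b (t + t') = tensor_pairing a b t + tensor_pairing a b t'"
  "tensor_pairing a b (t - t') = tensor_pairing a b t - tensor_pairing a b t'"
  "tensor_pairing a b (- t) = - tensor_pairing a b t"
  "tensor_pairing a b (fun_scale c t) = c * tensor_pairing a b t"
  "tensor_pairing a b 0 = 0"
  by (simp_all add: tensor_pairing_def)

lemma tensor_pairing_bilinear:
  assumes "t \<in> tensors"
  shows "bilinear_on fun_scale (dual) fun_scale (dual) (*) UNIV
    (\<lambda>a b. tensor_pairing a b t)"
proof -
  have "tensor_pairing (a + a') b t = tensor_pairing a b t + tensor_pairing a' b t"
    and "tensor_pairing b (a + a') t = tensor_pairing b a t + tensor_pairing b a' t"
    and "tensor_pairing (fun_scale c a) b t = c * tensor_pairing a b t"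
    and "tensor_pairing b (fun_scale c a) t = c * tensor_pairing b a t"
    if "a \<in> dual" "a' \<in> dual" "b \<in> dual" for a a' b c
    using that
      tensor_linear(1)[OF assms bilinear_form_product[of a b] bilinear_form_product[of a' b]]
      tensor_linear(1)[OF assms bilinear_form_product[of b a] bilinear_form_product[of b a']]
      tensor_linear(2)[OF assms bilinear_form_product[of a b], of c]
      tensor_linear(2)[OF assms bilinear_form_product[of b a], of c]
    by (simp_all add: tensor_pairing_def algebra_simps)
  then show ?thesis by (simp add: bilinear_on_def linear_on_def)
qed

lemma tmap_closed:
  assumes "linear_on scale UNIV scale UNIV f" "linear_on scale UNIV scale UNIV g"
    and "t \<in> tensors"
  shows "tmap scale f g t \<in> tensors"
  unfolding tmap_def
  using assms
  by (intro tlift_closed[OF assms(3) _ submodule_tensor_space tens_in_tensor_space])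
    (auto simp: tens_def bilinear_form_iff dual_iff linear_on_def)

lemma tflip_closed: "t \<in> tensors \<Longrightarrow> tflip scale t \<in> tensors"
  unfolding tflip_def
  by (intro tlift_closed[OF _ _ submodule_tensor_space tens_in_tensor_space])
    (auto simp: tens_def bilinear_form_iff dual_iff)

lemma tensor_pairing_tmap:
  assumes "a \<in> dual" "b \<in> dual"
  shows "tensor_pairing a b (tmap scale f g t) = tensor_pairing (\<lambda>x. a (f x)) (\<lambda>x. b (g x)) t"
  using assms by (simp add: tmap_def tlift_def tensor_pairing_def tens_def bilinear_form_product)

lemma tensor_pairing_tflip:
  assumes "a \<in> dual" "b \<in> dual"
  shows "tensor_pairing a b (tflip scale t) = tensor_pairing b a t"
  using assms
  by (simp add: tflip_def tlift_def tensor_pairing_def tens_def bilinear_form_product mult.commute)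

lemma comultiplication_iff:
  "comultiplication scale \<Delta> \<longleftrightarrow> (\<forall>x. \<Delta> x \<in> tensors) \<and>
    (\<forall>x y. \<Delta> (x + y) = \<Delta> x + \<Delta> y) \<and> (\<forall>c x. \<Delta> (scale c x) = fun_scale c (\<Delta> x))"
  by (simp add: comultiplication_def linear_on_def vector_space_axioms)

lemma dual_operation_closed:
  "comultiplication scale \<Delta> \<Longrightarrow> dual_operation \<Delta> a b \<in> dual"
  by (simp add: comultiplication_iff dual_iff dual_operation_def tensor_pairing_linear)

lemma dual_operation_bilinear:
  assumes "comultiplication scale \<Delta>"
  shows "binary_operation fun_scale (dual) (dual_operation \<Delta>)"
proof -
  note bil = tensor_pairing_bilinear[OF assms[unfolded comultiplication_iff, THEN conjunct1, rule_format]]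
  show ?thesis
    using bil dual_operation_closed[OF assms]
    by (simp add: bilinear_on_def linear_on_def dual_operation_def fun_eq_iff)
qed

lemma dual_operation_apply: "dual_operation \<Delta> a b x = tensor_pairing a b (\<Delta> x)"
  by (simp add: dual_operation_def)

text \<open>
  \<open>A\<^sup>*\<^sup>* = A\<close>: a functional on \<open>A\<^sup>*\<close> is evaluation at the vector that has its values on the dual basis as
  coordinates.
\<close>

lemma predual_ex1:
  assumes "linear_on fun_scale (dual) (*) UNIV \<Phi>"
  shows "\<exists>!y. \<forall>v\<in>dual. v y = \<Phi> v"
proof
  let ?y = "\<Sum>p\<in>Basis. scale (\<Phi> (crd p)) p"
  show y: "\<forall>v\<in>dual. v ?y = \<Phi> v"
  proof
    fix v assume v: "v \<in> dual"
    have "\<Phi> v = \<Phi> (\<Sum>p\<in>Basis. fun_scale (v p) (crd p))"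
      using dual_expansion_fun[OF v] by simp
    also have "\<dots> = (\<Sum>p\<in>Basis. \<Phi> (fun_scale (v p) (crd p)))"
      by (rule linear_on_sum[OF assms submodule_dual])
        (simp add: submodule_scale[OF submodule_dual])
    also have "\<dots> = (\<Sum>p\<in>Basis. v p * \<Phi> (crd p))"
      by (simp add: linear_on_scale[OF assms])
    also have "\<dots> = v ?y"
      using v by (simp add: dual_sum[OF v] dual_iff mult.commute)
    finally show "v ?y = \<Phi> v" ..
  qed
  show "y = ?y" if "\<forall>v\<in>dual. v y = \<Phi> v" for y
    using bspec[OF that] bspec[OF y] by (intro eq_by_dual) (simp only:)
qed

lemma predual_rep_adjoint:
  assumes "linear_on fun_scale (dual) (*) UNIV (\<lambda>v. \<rho> u v x)" "v \<in> dual"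
  shows "v (predual_rep scale \<rho> u x) = \<rho> u v x"
  using theI'[OF predual_ex1[OF assms(1)]] assms(2) unfolding predual_rep_def by blast

lemma paired_modules_dual:
  "paired_modules scale UNIV fun_scale (dual) (\<lambda>u x. u x)"
proof
  show "submodule scale UNIV" by (rule submodule_UNIV[OF module_axioms])
  show "submodule fun_scale (dual)" by (rule submodule_dual)
  show "bilinear_on fun_scale (dual) scale UNIV (*) UNIV (\<lambda>u x. u x)"
    by (auto simp: bilinear_on_def linear_on_def dual_iff)
  show "x = 0" if "\<And>u. u \<in> dual \<Longrightarrow> u x = 0" for x
  proof (rule eq_by_dual)
    show "u x = u 0" if "u \<in> dual" for u
      using dual_sum[OF that, of _ "{}"] \<open>\<And>u. u \<in> dual \<Longrightarrow> u x = 0\<close> that by simp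
  qed
  show "u = 0" if "\<And>x. x \<in> UNIV \<Longrightarrow> u x = 0" for u :: "'b \<Rightarrow> 'a"
    using that by auto
qed

lemma tensor_double_dual:
  assumes m: "binary_operation scale UNIV m" and \<Delta>: "comultiplication scale \<Delta>"
  shows "tensor_double scale UNIV fun_scale (dual) (\<lambda>u x. u x) m (dual_operation \<Delta>)
    (dual_rep (mult_right m)) (dual_rep (mult_left m))
    (predual_rep scale (mult_right (dual_operation \<Delta>))) (predual_rep scale (mult_left (dual_operation \<Delta>)))
    (tensors) tensor_pairing (tmap scale) (tflip scale) \<Delta>"
proof -
  interpret paired_modules scale UNIV fun_scale "dual" "\<lambda>u x. u x"
    by (rule paired_modules_dual)
  note dot = dual_operation_bilinear[OF \<Delta>]
  have \<Delta>T: "\<Delta> x \<in> tensors" for x using \<Delta> by (simp add: comultiplication_iff)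
  have adjL: "v (predual_rep scale (mult_right (dual_operation \<Delta>)) u x) = dual_operation \<Delta> v u x"
    and adjR: "v (predual_rep scale (mult_left (dual_operation \<Delta>)) u x) = dual_operation \<Delta> u v x"
    if "u \<in> dual" "v \<in> dual" for u v x
    using that tensor_pairing_bilinear[OF \<Delta>T[of x]]
    by (subst predual_rep_adjoint;
        simp add: mult_right_def mult_left_def dual_operation_apply bilinear_on_def)+
  note T = submodule_tensor_space[of scale]
  show ?thesis
  proof
    show "dual_rep (mult_right m) x u \<in> dual"
      and "dual_rep (mult_left m) x u \<in> dual" if "u \<in> dual" for x u
      using m that
      by (auto simp: dual_rep_def mult_right_def mult_left_def dual_iff bilinear_on_def linear_on_def)
    show "tensor_pairing u v (tmap scale f g w) = tensor_pairing u' v' w"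
      if "u \<in> dual" "v \<in> dual" "\<And>x. x \<in> UNIV \<Longrightarrow> u' x = u (f x)"
        "\<And>x. x \<in> UNIV \<Longrightarrow> v' x = v (g x)" for u v u' v' f g w
    proof -
      have "u' = (\<lambda>x. u (f x))" "v' = (\<lambda>x. v (g x))" using that by auto
      then show ?thesis using that(1,2) by (simp add: tensor_pairing_tmap)
    qed
  qed (use m dot \<Delta>T in \<open>auto simp: dual_rep_def mult_right_def mult_left_def adjL adjR
      submodule_add[OF T] submodule_diff[OF T] tensor_pairing_linear tmap_closed tflip_closed
      tensor_pairing_tflip dual_operation_apply intro: tensor_eqI\<close>)
qed

end

section \<open>Bialgebras and matched pairs over a field\<close>

context finite_dimensional_vector_space
begin

lemma tlift3_closed:
  assumes "t \<in> tensor3_space scale" "\<And>g. trilinear_form scale (\<lambda>x y z. \<phi> x y z g)"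
    and "submodule fun_scale W" "\<And>p q r. \<phi> p q r \<in> W"
  shows "tlift3 \<phi> t \<in> W"
proof -
  have "tlift3 \<phi> t = (\<Sum>p\<in>Basis. \<Sum>q\<in>Basis. \<Sum>r\<in>Basis.
      fun_scale (t (\<lambda>x y z. crd p x * crd q y * crd r z)) (\<phi> p q r))"
  proof
    show "tlift3 \<phi> t g = (\<Sum>p\<in>Basis. \<Sum>q\<in>Basis. \<Sum>r\<in>Basis.
      fun_scale (t (\<lambda>x y z. crd p x * crd q y * crd r z)) (\<phi> p q r)) g" for g
      by (subst (1) tlift3_def, subst tensor3_expansion[OF assms(1)])
        (simp add: assms(2) sum_fun_apply mult.commute)
  qed
  then show ?thesis
    by (simp add: submodule_sum[OF assms(3)] submodule_scale[OF assms(3)] assms(4))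
qed

text \<open>
  The coproduct of one tensor factor, with the other factor as a parameter, is bilinear in the pair.
  The case distinction is forced by tensors vanishing off the multilinear forms.
\<close>

lemma inner_lift_bilinear:
  assumes \<delta>: "comultiplication scale \<delta>"
  shows "bilinear_form scale (\<lambda>x y. tlift (\<lambda>u v. tens3 scale x u v) (\<delta> y) \<gamma>)" (is ?right)
    and "bilinear_form scale (\<lambda>x y. tlift (\<lambda>u v. tens3 scale u v y) (\<delta> x) \<gamma>)" (is ?left)
proof -
  have \<delta>T: "\<delta> x \<in> tensors" for x using \<delta> by (simp add: comultiplication_iff)
  have zero: "t (\<lambda>x y. 0) = 0" if "t \<in> tensors" for t
    by (simp add: tensor_expansion[OF that])
  have "?right \<and> ?left"
  proof (cases "trilinear_form scale \<gamma>")
    case True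
    then have b: "bilinear_form scale (\<gamma> x)" "bilinear_form scale (\<lambda>u v. \<gamma> u v x)" for x
      by (simp_all add: trilinear_form_iff bilinear_form_iff)
    have g: "\<gamma> (x + y) = (\<lambda>u v. \<gamma> x u v + \<gamma> y u v)" "\<gamma> (scale c x) = (\<lambda>u v. c * \<gamma> x u v)"
      "(\<lambda>u v. \<gamma> u v (x + y)) = (\<lambda>u v. \<gamma> u v x + \<gamma> u v y)"
      "(\<lambda>u v. \<gamma> u v (scale c x)) = (\<lambda>u v. c * \<gamma> u v x)" for x y c
      using True by (simp_all add: trilinear_form_iff dual_iff fun_eq_iff)
    have \<delta>lin: "\<delta> (x + y) = \<delta> x + \<delta> y" "\<delta> (scale c x) = fun_scale c (\<delta> x)" for x y c
      using \<delta> by (simp_all add: comultiplication_iff)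
    have "bilinear_form scale (\<lambda>x y. \<delta> y (\<gamma> x))" "bilinear_form scale (\<lambda>x y. \<delta> x (\<lambda>u v. \<gamma> u v y))"
      by (subst bilinear_form_iff; simp add: dual_iff g \<delta>lin tensor_linear[OF \<delta>T] b)+
    then show ?thesis
      using True by (simp_all add: tlift_def tens3_def)
  next
    case False
    then show ?thesis
      by (simp_all add: tlift_def tens3_def zero[OF \<delta>T] bilinear_form_iff dual_iff)
  qed
  then show ?right ?left by blast+
qed

lemma id_tens_closed:
  assumes "comultiplication scale \<delta>" "t \<in> tensors"
  shows "id_tens scale \<delta> t \<in> tensor3_space scale"
proof -
  have \<delta>T: "\<delta> x \<in> tensors" for x using assms by (simp add: comultiplication_iff)
  show ?thesis unfolding id_tens_def
    by (intro tlift_closed[OF assms(2) inner_lift_bilinear(1)[OF assms(1)] submodule_tensor3_space]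
        tlift_closed[OF \<delta>T _ submodule_tensor3_space tens3_in_tensor3_space])
      (auto simp: tens3_def bilinear_form_iff trilinear_form_iff dual_iff)
qed

lemma tens_id_closed:
  assumes "comultiplication scale \<delta>" "t \<in> tensors"
  shows "tens_id scale \<delta> t \<in> tensor3_space scale"
proof -
  have \<delta>T: "\<delta> x \<in> tensors" for x using assms by (simp add: comultiplication_iff)
  show ?thesis unfolding tens_id_def
    by (intro tlift_closed[OF assms(2) inner_lift_bilinear(2)[OF assms(1)] submodule_tensor3_space]
        tlift_closed[OF \<delta>T _ submodule_tensor3_space tens3_in_tensor3_space])
      (auto simp: tens3_def bilinear_form_iff trilinear_form_iff dual_iff)
qed

lemma tcycle_closed: "t \<in> tensor3_space scale \<Longrightarrow> tcycle scale t \<in> tensor3_space scale"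
  unfolding tcycle_def
  by (intro tlift3_closed[OF _ _ submodule_tensor3_space tens3_in_tensor3_space])
    (auto simp: tens3_def trilinear_form_iff dual_iff)

lemma tflip_id_closed: "t \<in> tensor3_space scale \<Longrightarrow> tflip_id scale t \<in> tensor3_space scale"
  unfolding tflip_id_def
  by (intro tlift3_closed[OF _ _ submodule_tensor3_space tens3_in_tensor3_space])
    (auto simp: tens3_def trilinear_form_iff dual_iff)

abbreviation tri where "tri a b c \<equiv> (\<lambda>x y z. a x * b y * c z)"

lemma id_tens_pairing:
  assumes "comultiplication scale \<delta>" "t \<in> tensors"
    and "a \<in> dual" "b \<in> dual" "c \<in> dual"
  shows "id_tens scale \<delta> t (tri a b c) = tensor_pairing a (dual_operation \<delta> b c) t"
proof -
  have \<delta>T: "\<delta> x \<in> tensors" for x using assms by (simp add: comultiplication_iff)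
  have "\<delta> y (\<lambda>u v. a x * b u * c v) = a x * \<delta> y (\<lambda>u v. b u * c v)" for x y
    using tensor_linear(2)[OF \<delta>T bilinear_form_product[OF assms(4,5)], of y "a x"]
    by (simp add: mult.assoc)
  then show ?thesis
    using assms
    by (simp add: id_tens_def tlift_def tens3_def trilinear_form_product dual_operation_def
        tensor_pairing_def)
qed

lemma tens_id_pairing:
  assumes "comultiplication scale \<delta>" "t \<in> tensors"
    and "a \<in> dual" "b \<in> dual" "c \<in> dual"
  shows "tens_id scale \<delta> t (tri a b c) = tensor_pairing (dual_operation \<delta> a b) c t"
proof -
  have \<delta>T: "\<delta> x \<in> tensors" for x using assms by (simp add: comultiplication_iff)
  have "\<delta> x (\<lambda>u v. a u * b v * c y) = \<delta> x (\<lambda>u v. a u * b v) * c y" for x y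
    using tensor_linear(2)[OF \<delta>T bilinear_form_product[OF assms(3,4)], of x "c y"]
    by (simp add: mult.commute)
  then show ?thesis
    using assms
    by (simp add: tens_id_def tlift_def tens3_def trilinear_form_product dual_operation_def
        tensor_pairing_def)
qed

lemma tcycle_pairing:
  assumes "a \<in> dual" "b \<in> dual" "c \<in> dual"
  shows "tcycle scale t (tri a b c) = t (tri b c a)"
proof -
  have "(\<lambda>x y z. a z * b x * c y) = tri b c a" by (auto simp: mult_ac)
  then show ?thesis
    using assms by (simp add: tcycle_def tlift3_def tens3_def trilinear_form_product)
qed

lemma tflip_id_pairing:
  assumes "a \<in> dual" "b \<in> dual" "c \<in> dual"
  shows "tflip_id scale t (tri a b c) = t (tri b a c)"
proof -
  have "(\<lambda>x y z. a y * b x * c z) = tri b a c" by (auto simp: mult_ac)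
  then show ?thesis
    using assms by (simp add: tflip_id_def tlift3_def tens3_def trilinear_form_product)
qed

text \<open>
  Tested on \<open>a \<otimes> b \<otimes> c\<close> and evaluated at \<open>x\<close>, the two sides of coassociativity are
  \<open>a \<cdot> (b \<cdot> c)\<close> and \<open>(a \<cdot> b) \<cdot> c\<close> for the dual operation.
\<close>

lemma coassociative_iff:
  assumes \<Delta>: "comultiplication scale \<Delta>"
  shows "(\<forall>x. id_tens scale \<Delta> (\<Delta> x) = tens_id scale \<Delta> (\<Delta> x)) \<longleftrightarrow>
    assoc_algebra fun_scale (dual) (dual_operation \<Delta>)"
proof -
  have \<Delta>T: "\<Delta> x \<in> tensors" for x using \<Delta> by (simp add: comultiplication_iff)
  have "id_tens scale \<Delta> (\<Delta> x) = tens_id scale \<Delta> (\<Delta> x) \<longleftrightarrow>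
    (\<forall>a\<in>dual. \<forall>b\<in>dual. \<forall>c\<in>dual.
      dual_operation \<Delta> (dual_operation \<Delta> a b) c x = dual_operation \<Delta> a (dual_operation \<Delta> b c) x)" for x
  proof
    assume *: "id_tens scale \<Delta> (\<Delta> x) = tens_id scale \<Delta> (\<Delta> x)"
    show "\<forall>a\<in>dual. \<forall>b\<in>dual. \<forall>c\<in>dual.
      dual_operation \<Delta> (dual_operation \<Delta> a b) c x = dual_operation \<Delta> a (dual_operation \<Delta> b c) x"
      unfolding dual_operation_apply[of _ _ _ x]
      using id_tens_pairing[OF \<Delta> \<Delta>T[of x]] tens_id_pairing[OF \<Delta> \<Delta>T[of x]]
      unfolding * by simp
  next
    assume "\<forall>a\<in>dual. \<forall>b\<in>dual. \<forall>c\<in>dual.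
      dual_operation \<Delta> (dual_operation \<Delta> a b) c x = dual_operation \<Delta> a (dual_operation \<Delta> b c) x"
    then show "id_tens scale \<Delta> (\<Delta> x) = tens_id scale \<Delta> (\<Delta> x)"
      by (intro tensor3_eqI id_tens_closed tens_id_closed \<Delta> \<Delta>T)
        (simp add: id_tens_pairing[OF \<Delta> \<Delta>T] tens_id_pairing[OF \<Delta> \<Delta>T] dual_operation_apply)
  qed
  then show ?thesis
    by (auto simp: assoc_algebra_def submodule_dual dual_operation_bilinear[OF \<Delta>] fun_eq_iff)
qed

lemma cocommutative_iff:
  assumes \<Delta>: "comultiplication scale \<Delta>"
  shows "(\<forall>x. \<Delta> x = tflip scale (\<Delta> x)) \<longleftrightarrow> commutative_on (dual) (dual_operation \<Delta>)"
proof -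
  have \<Delta>T: "\<Delta> x \<in> tensors" for x using \<Delta> by (simp add: comultiplication_iff)
  show ?thesis
  proof
    assume "\<forall>x. \<Delta> x = tflip scale (\<Delta> x)"
    then show "commutative_on (dual) (dual_operation \<Delta>)"
      unfolding commutative_on_def dual_operation_def
      by (metis tensor_pairing_tflip)
  next
    assume "commutative_on (dual) (dual_operation \<Delta>)"
    then show "\<forall>x. \<Delta> x = tflip scale (\<Delta> x)"
      by (intro allI tensor_eqI tflip_closed \<Delta>T)
        (simp add: commutative_on_def tensor_pairing_tflip dual_operation_def fun_eq_iff)
  qed
qed

text \<open>Commutativity of a multiplication makes its left and right transposes agree on the carrier.\<close>

lemma comm_tensor_double_dual:
  assumes m: "binary_operation scale UNIV m" and \<Delta>: "comultiplication scale \<Delta>"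
    and comm: "commutative_on UNIV m" "commutative_on (dual) (dual_operation \<Delta>)"
  shows "tensor_double scale UNIV fun_scale (dual) (\<lambda>u x. u x) m (dual_operation \<Delta>)
    (dual_rep (mult_right m)) (dual_rep (mult_right m))
    (predual_rep scale (mult_right (dual_operation \<Delta>))) (predual_rep scale (mult_right (dual_operation \<Delta>)))
    (tensors) tensor_pairing (tmap scale) (tflip scale) \<Delta>"
proof -
  interpret T: tensor_double scale UNIV fun_scale "dual" "\<lambda>u x. u x" m "dual_operation \<Delta>"
    "dual_rep (mult_right m)" "dual_rep (mult_left m)"
    "predual_rep scale (mult_right (dual_operation \<Delta>))" "predual_rep scale (mult_left (dual_operation \<Delta>))"
    "tensors" tensor_pairing "tmap scale" "tflip scale" \<Delta>
    by (rule tensor_double_dual[OF m \<Delta>])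
  have eq: "dual_rep (mult_right m) = dual_rep (mult_left m)"
    using comm(1) by (simp add: dual_rep_def mult_left_def mult_right_def commutative_on_def fun_eq_iff)
  show ?thesis
  proof (intro tensor_double.intro double.intro paired_modules_dual
      tensor_double.axioms(2)[OF tensor_double_dual[OF m \<Delta>]])
    have "v (predual_rep scale (mult_right (dual_operation \<Delta>)) u x) = dual_operation \<Delta> u v x"
      if "u \<in> dual" "v \<in> dual" for u v x
      using T.lB_adjoint[OF that, of x] comm(2) that by (simp add: commutative_on_def)
    then show "double_axioms scale UNIV fun_scale (dual) (\<lambda>u x. u x) m (dual_operation \<Delta>)
        (dual_rep (mult_right m)) (dual_rep (mult_right m))
        (predual_rep scale (mult_right (dual_operation \<Delta>)))
        (predual_rep scale (mult_right (dual_operation \<Delta>)))"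
      unfolding double_axioms_def
      using m T.mB_bilinear T.lA_closed T.lA_adjoint T.lB_adjoint comm(1)
      by (auto simp: commutative_on_def)
  qed
qed

theorem cc_asi_bialgebra_iff:
  assumes m: "binary_operation scale UNIV m" and \<Delta>: "comultiplication scale \<Delta>"
  shows "cc_asi_bialgebra scale m \<Delta> \<longleftrightarrow>
    comm_matched_pair scale UNIV fun_scale (dual) m (dual_operation \<Delta>)
      (dual_rep (mult_right m)) (predual_rep scale (mult_right (dual_operation \<Delta>)))"
proof (cases "commutative_on UNIV m \<and> commutative_on (dual) (dual_operation \<Delta>)")
  case True
  then interpret T: tensor_double scale UNIV fun_scale "dual" "\<lambda>u x. u x" m "dual_operation \<Delta>"
    "dual_rep (mult_right m)" "dual_rep (mult_right m)"
    "predual_rep scale (mult_right (dual_operation \<Delta>))" "predual_rep scale (mult_right (dual_operation \<Delta>))"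
    "tensors" tensor_pairing "tmap scale" "tflip scale" \<Delta>
    using comm_tensor_double_dual[OF m \<Delta>] by blast
  have "commutative_on (UNIV \<times> dual) (bowtie m (dual_operation \<Delta>)
      (dual_rep (mult_right m)) (dual_rep (mult_right m))
      (predual_rep scale (mult_right (dual_operation \<Delta>))) (predual_rep scale (mult_right (dual_operation \<Delta>))))"
    using True by (auto simp: commutative_on_def bowtie_def algebra_simps)
  then show ?thesis
    using True coassociative_iff[OF \<Delta>] cocommutative_iff[OF \<Delta>] \<Delta>
    unfolding cc_asi_bialgebra_def comm_matched_pair_def asi_bialgebra_def T.matched_pair_iff_asi
    by blast
next
  case False
  then show ?thesis
    using cocommutative_iff[OF \<Delta>] by (auto simp: cc_asi_bialgebra_def comm_matched_pair_def)
qed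

text \<open>
  In coordinates \<open>\<delta> x\<close> is the sum of \<open>f(e\<^sup>p, e\<^sup>q)(x) (e\<^sub>p \<otimes> e\<^sub>q)\<close>; it is a tensor because the basis is finite.
\<close>

lemma comultiplication_of_dual_operation:
  assumes "binary_operation fun_scale (dual) f"
  shows "\<exists>!\<delta>. comultiplication scale \<delta> \<and>
    (\<forall>a\<in>dual. \<forall>b\<in>dual. dual_operation \<delta> a b = f a b)"
proof (rule ex_ex1I)
  let ?\<delta> = "\<lambda>x. \<Sum>p\<in>Basis. \<Sum>q\<in>Basis. fun_scale (f (crd p) (crd q) x) (tens scale p q)"
  note T = submodule_tensor_space[of scale]
  have fd: "f a b \<in> dual" if "a \<in> dual" "b \<in> dual" for a b
    using assms that by (simp add: bilinear_on_def linear_on_def)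
  then have fcrd: "f (crd p) (crd q) (x + y) = f (crd p) (crd q) x + f (crd p) (crd q) y"
    "f (crd p) (crd q) (scale c x) = c * f (crd p) (crd q) x" for p q x y c
    using crd_dual[unfolded dual_iff] unfolding dual_iff by blast+
  have "comultiplication scale ?\<delta>"
    unfolding comultiplication_iff
    by (auto simp: fun_eq_iff sum_fun_apply fcrd sum.distrib sum_distrib_left algebra_simps
        intro!: submodule_sum[OF T] submodule_scale[OF T] tens_in_tensor_space)
  moreover have "dual_operation ?\<delta> a b = f a b" if ab: "a \<in> dual" "b \<in> dual" for a b
  proof
    fix x
    have "(\<lambda>a b. f a b x) a b = (\<Sum>p\<in>Basis. \<Sum>q\<in>Basis. f (crd p) (crd q) x * (a p * b q))"
    proof -
      have L: "linear_on fun_scale (dual) fun_scale (dual) (\<lambda>a. f a b)"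
        if "b \<in> dual" for b
        using bilinear_on_left[OF assms that] .
      have R: "linear_on fun_scale (dual) fun_scale (dual) (f a)"
        if "a \<in> dual" for a
        using bilinear_on_right[OF assms that] .
      have "f a b = f (\<Sum>p\<in>Basis. fun_scale (a p) (crd p)) b"
        using dual_expansion_fun[OF ab(1)] by simp
      also have "\<dots> = (\<Sum>p\<in>Basis. fun_scale (a p) (f (crd p) b))"
        by (subst linear_on_sum[OF L[OF ab(2)] submodule_dual])
          (simp_all add: submodule_scale[OF submodule_dual] linear_on_scale[OF L[OF ab(2)]])
      finally have 1: "f a b = (\<Sum>p\<in>Basis. fun_scale (a p) (f (crd p) b))" .
      have 2: "f (crd p) b = (\<Sum>q\<in>Basis. fun_scale (b q) (f (crd p) (crd q)))" for p
      proof -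
        have "f (crd p) b = f (crd p) (\<Sum>q\<in>Basis. fun_scale (b q) (crd q))"
          using dual_expansion_fun[OF ab(2)] by simp
        also have "\<dots> = (\<Sum>q\<in>Basis. fun_scale (b q) (f (crd p) (crd q)))"
          by (subst linear_on_sum[OF R[OF crd_dual] submodule_dual])
            (simp_all add: submodule_scale[OF submodule_dual] linear_on_scale[OF R[OF crd_dual]])
        finally show ?thesis .
      qed
      show ?thesis
        by (subst 1, subst 2) (simp add: sum_fun_apply sum_distrib_left mult_ac)
    qed
    moreover have "dual_operation ?\<delta> a b x = (\<Sum>p\<in>Basis. \<Sum>q\<in>Basis. f (crd p) (crd q) x * (a p * b q))"
      using ab
      by (simp add: dual_operation_def tensor_pairing_def sum_fun_apply tens_def bilinear_form_product)
    ultimately show "dual_operation ?\<delta> a b x = f a b x" by simp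
  qed
  ultimately show "\<exists>\<delta>. comultiplication scale \<delta> \<and>
    (\<forall>a\<in>dual. \<forall>b\<in>dual. dual_operation \<delta> a b = f a b)"
    by blast
next
  fix \<delta> \<delta>'
  assume *: "comultiplication scale \<delta> \<and>
      (\<forall>a\<in>dual. \<forall>b\<in>dual. dual_operation \<delta> a b = f a b)"
    "comultiplication scale \<delta>' \<and>
      (\<forall>a\<in>dual. \<forall>b\<in>dual. dual_operation \<delta>' a b = f a b)"
  show "\<delta> = \<delta>'"
  proof
    show "\<delta> x = \<delta>' x" for x
    proof (rule tensor_eqI)
      show "tensor_pairing a b (\<delta> x) = tensor_pairing a b (\<delta>' x)"
        if "a \<in> dual" "b \<in> dual" for a b
        using * that by (metis dual_operation_def)
    qed (use * in \<open>auto simp: comultiplication_iff\<close>)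
  qed
qed

end

section \<open>Poisson bialgebras\<close>

context finite_dimensional_vector_space
begin

text \<open>
  Each identity of a Poisson bialgebra, tested on \<open>a \<otimes> b\<close> or \<open>a \<otimes> b \<otimes> c\<close>, is one component of an
  identity of the Poisson algebra \<open>A \<oplus> A\<^sup>*\<close>: the Jacobi identity gives the Lie bialgebra cocycle
  condition, and the Leibniz rule gives the two mixed compatibilities.
\<close>

theorem poisson_bialgebra_of_matched_pair:
  assumes PM: "poisson_matched_pair scale UNIV fun_scale (dual) br m dbr (dual_operation \<Delta>)
      (\<lambda>x u. - dual_rep (ad br) x u) (dual_rep (mult_right m))
      (\<lambda>u x. - predual_rep scale (ad dbr) u x)
      (predual_rep scale (mult_right (dual_operation \<Delta>)))"
    and cc: "cc_asi_bialgebra scale m \<Delta>" and \<delta>: "comultiplication scale \<delta>"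
    and dbr: "\<forall>a\<in>dual. \<forall>b\<in>dual. dual_operation \<delta> a b = dbr a b"
  shows "poisson_bialgebra scale br m \<delta> \<Delta>"
proof -
  define dot where "dot = dual_operation \<Delta>"
  define \<alpha> where "\<alpha> = predual_rep scale (ad dbr)"
  define \<rho> where "\<rho> = predual_rep scale (mult_right dot)"
  let ?A = "UNIV :: 'b set" and ?B = "dual"
  note PM' = PM[folded dot_def, folded \<alpha>_def \<rho>_def, unfolded poisson_matched_pair_def]
  have \<Delta>: "comultiplication scale \<Delta>" using cc by (simp add: cc_asi_bialgebra_def asi_bialgebra_def)
  have T: "\<Delta> x \<in> tensors" "\<delta> x \<in> tensors" for x
    using \<Delta> \<delta> by (simp_all add: comultiplication_iff)
  interpret paired_modules scale UNIV fun_scale "dual" "\<lambda>u x. u x"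
    by (rule paired_modules_dual)
  have PA: "poisson_algebra scale ?A br m" and PB: "poisson_algebra fun_scale ?B dbr dot"
    using PM' by blast+
  have bbr: "binary_operation scale ?A br" and bm: "binary_operation scale ?A m"
    and bdbr: "binary_operation fun_scale ?B dbr" and bdot: "binary_operation fun_scale ?B dot"
    using PA PB by (auto simp: poisson_algebra_def lie_algebra_def assoc_algebra_def)
  have eqs: "br x (y + z) = br x y + br x z" "br (y + z) x = br y x + br z x"
    "br x (- y) = - br x y" "br (- y) x = - br y x" "br 0 x = 0" "br x 0 = 0"
    "m 0 x = 0" "m x 0 = 0" "m x (- y) = - m x y" "m (- y) x = - m y x" for x y z
    using linear_on_neg[OF bilinear_on_left[OF bbr] subA] linear_on_neg[OF bilinear_on_right[OF bbr] subA]
      linear_on_zero[OF bilinear_on_left[OF bbr] subA] linear_on_zero[OF bilinear_on_right[OF bbr] subA]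
      linear_on_neg[OF bilinear_on_left[OF bm] subA] linear_on_neg[OF bilinear_on_right[OF bm] subA]
      linear_on_zero[OF bilinear_on_left[OF bm] subA] linear_on_zero[OF bilinear_on_right[OF bm] subA]
      bilinear_on_left[OF bbr] bilinear_on_right[OF bbr]
    by (auto simp: linear_on_def)
  have zeroB: "dbr 0 a = 0" "dbr a 0 = 0" "dot 0 a = 0" "dot a 0 = 0" if "a \<in> ?B" for a
    using linear_on_zero[OF bilinear_on_left[OF bdbr that] subB]
      linear_on_zero[OF bilinear_on_right[OF bdbr that] subB]
      linear_on_zero[OF bilinear_on_left[OF bdot that] subB]
      linear_on_zero[OF bilinear_on_right[OF bdot that] subB] by auto
  have dbrB: "dbr a b \<in> ?B" and dotB: "dot a b \<in> ?B" if "a \<in> ?B" "b \<in> ?B" for a b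
    using bilinear_on_right[OF bdbr] bilinear_on_right[OF bdot] that by (auto simp: linear_on_def)
  have comp: "(\<lambda>z. a (br x z)) \<in> ?B" "(\<lambda>z. a (m x z)) \<in> ?B"
    "(\<lambda>z. - a (br x z)) \<in> ?B" if "a \<in> ?B" for a x
  proof -
    show "(\<lambda>z. a (br x z)) \<in> ?B" "(\<lambda>z. a (m x z)) \<in> ?B"
      using bilinear_on_right[OF bbr] bilinear_on_right[OF bm] that
      by (auto simp: dual_iff linear_on_def)
    from B_closed(4)[OF this(1)] show "(\<lambda>z. - a (br x z)) \<in> ?B"
      by (simp add: fun_Compl_def)
  qed
  have negB: "dbr (\<lambda>z. - a (br x z)) b = - dbr (\<lambda>z. a (br x z)) b"
    "dbr b (\<lambda>z. - a (br x z)) = - dbr b (\<lambda>z. a (br x z))"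
    "dot (\<lambda>z. - a (br x z)) b = - dot (\<lambda>z. a (br x z)) b"
    "dot b (\<lambda>z. - a (br x z)) = - dot b (\<lambda>z. a (br x z))" if "a \<in> ?B" "b \<in> ?B" for a b x
    using linear_on_neg[OF bilinear_on_left[OF bdbr that(2)] subB comp(1)[OF that(1), of x]]
      linear_on_neg[OF bilinear_on_right[OF bdbr that(2)] subB comp(1)[OF that(1), of x]]
      linear_on_neg[OF bilinear_on_left[OF bdot that(2)] subB comp(1)[OF that(1), of x]]
      linear_on_neg[OF bilinear_on_right[OF bdot that(2)] subB comp(1)[OF that(1), of x]]
    by (simp_all add: fun_Compl_def)
  have comm: "m x y = m y x" for x y
    using PA by (simp add: poisson_algebra_def commutative_on_def)
  have br_anti: "br y x = - br x y" for x y
  proof -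
    have "br (x + y) (x + y) = 0" "br x x = 0" "br y y = 0"
      using PA by (auto simp: poisson_algebra_def lie_algebra_def)
    then have "br y x + br x y = 0" by (simp add: eqs)
    then show ?thesis by (simp add: eq_neg_iff_add_eq_0)
  qed
  have anti: "dbr a b x = - dbr b a x" if "a \<in> ?B" "b \<in> ?B" for a b x
  proof -
    have "dbr (a + b) (a + b) = 0" "dbr a a = 0" "dbr b b = 0"
      using PB that B_closed by (auto simp: poisson_algebra_def lie_algebra_def)
    moreover have "dbr (a + b) (a + b) = dbr a a + dbr b a + (dbr a b + dbr b b)"
      using that B_closed
        linear_on_add[OF bilinear_on_left[OF bdbr]] linear_on_add[OF bilinear_on_right[OF bdbr]]
      by simp
    ultimately have "(dbr b a + dbr a b) x = 0" by simp
    then show ?thesis by (simp add: eq_neg_iff_add_eq_0 add.commute)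
  qed
  have \<alpha>: "v (\<alpha> u x) = dbr u v x" and \<rho>: "v (\<rho> u x) = dot v u x"
    if "u \<in> ?B" "v \<in> ?B" for u v x
    using that bdbr bdot unfolding \<alpha>_def \<rho>_def
    by (subst predual_rep_adjoint; simp add: bilinear_on_def linear_on_def mult_left_def mult_right_def)+
  have B0: "a 0 = 0" "a (- x) = - a x" "a (x + y) = a x + a y" if "a \<in> ?B" for a x y
    using P_right[OF that] by auto
  have \<alpha>0: "\<alpha> 0 x = 0" "\<rho> 0 x = 0" for x
    by (rule A_eqI; simp add: \<alpha> \<rho> zeroB B_closed B0)+
  have \<alpha>0': "\<alpha> u 0 = 0" "\<rho> u 0 = 0" if "u \<in> ?B" for u
    by (rule A_eqI; simp add: \<alpha> \<rho> that B0 dbrB dotB)+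
  define Br where "Br = bowtie br dbr (\<lambda>x u. - dual_rep (ad br) x u) (\<lambda>x u. - (- dual_rep (ad br) x u))
    (\<lambda>u x. - \<alpha> u x) (\<lambda>u x. - (- \<alpha> u x))"
  define Mu where "Mu = bowtie m dot (dual_rep (mult_right m)) (dual_rep (mult_right m)) \<rho> \<rho>"
  have PD: "poisson_algebra (sum_scale scale fun_scale) (?A \<times> ?B) Br Mu"
    using PM' unfolding Br_def Mu_def by blast
  have jac: "\<And>p q r. p \<in> ?A \<times> ?B \<Longrightarrow> q \<in> ?A \<times> ?B \<Longrightarrow> r \<in> ?A \<times> ?B \<Longrightarrow>
      Br p (Br q r) + Br q (Br r p) + Br r (Br p q) = 0"
    and leib: "\<And>p q r. p \<in> ?A \<times> ?B \<Longrightarrow> q \<in> ?A \<times> ?B \<Longrightarrow> r \<in> ?A \<times> ?B \<Longrightarrow>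
      Br p (Mu q r) = Mu (Br p q) r + Mu q (Br p r)"
    using PD unfolding poisson_algebra_def lie_algebra_def by blast+
  have Br_pure: "Br (0, a) (0, b) = (0, dbr a b)" "Br (x, 0) (0, b) = (\<alpha> b x, \<lambda>v. - b (br x v))"
    "Br (0, a) (y, 0) = (- \<alpha> a y, \<lambda>v. a (br y v))"
    if "a \<in> ?B" "b \<in> ?B" for a b x y
    using that
    by (simp_all add: Br_def Mu_def bowtie_def eqs \<alpha>0 \<alpha>0' dual_rep_def mult_left_def zeroB fun_eq_iff B0)
  have Br_snd: "snd (Br (0, a) (y, v)) x = a (br y x) + dbr a v x"
    "snd (Br (y, 0) (0, a)) x = - a (br y x)"
    if "a \<in> ?B" "v \<in> ?B" for a v x y
    using that
    by (simp_all add: Br_def Mu_def bowtie_def eqs \<alpha>0 \<alpha>0' dual_rep_def mult_left_def zeroB fun_eq_iff B0)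
  have Br_fst: "fst (Br (0, a) (y, v)) = - \<alpha> a y" if "a \<in> ?B" "v \<in> ?B" for a v y
    using that by (simp add: Br_def bowtie_def eqs \<alpha>0')
  have Mu_simps: "Mu (x, 0) (y, 0) = (m x y, 0)" "Mu (0, a) (0, b) = (0, dot a b)"
    "fst (Mu (x, u) (y, 0)) = m x y + \<rho> u y" "fst (Mu (x, 0) (y, u)) = m x y + \<rho> u x"
    "snd (Mu (x, u) (0, b)) y = b (m y x) + dot u b y"
    "snd (Mu (0, a) (x, u)) y = a (m y x) + dot a u y"
    if "a \<in> ?B" "b \<in> ?B" "u \<in> ?B" for a b u x y
    using that
    by (simp_all add: Br_def Mu_def bowtie_def eqs \<alpha>0 \<alpha>0' dual_rep_def mult_right_def zeroB fun_eq_iff B0 B_closed)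
  have cocycle: "dbr a b (br x y) = dbr (\<lambda>z. a (br x z)) b y + dbr a (\<lambda>z. b (br x z)) y -
      (dbr (\<lambda>z. a (br y z)) b x + dbr a (\<lambda>z. b (br y z)) x)"
    if ab: "a \<in> ?B" "b \<in> ?B" for a b x y
  proof -
    \<comment> \<open>Jacobi identity for \<open>y\<close>, \<open>a\<close>, \<open>b\<close>, its component in the dual evaluated at \<open>x\<close>\<close>
    have "snd (Br (y, 0) (Br (0, a) (0, b)) + Br (0, a) (Br (0, b) (y, 0)) +
        Br (0, b) (Br (y, 0) (0, a))) x = 0"
      using jac[of "(y, 0)" "(0, a)" "(0, b)"] ab B_closed by simp
    then have "dbr a b (br x y) + (dbr a (\<lambda>z. b (br y z)) x - dbr (\<lambda>z. a (br x z)) b y) +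
        (dbr (\<lambda>z. a (br y z)) b x - dbr a (\<lambda>z. b (br x z)) y) = 0"
      using ab \<alpha>[OF ab(1) comp(1)[OF ab(2), of x], of y] \<alpha>[OF ab(2) comp(1)[OF ab(1), of x], of y]
        anti[OF ab(2) comp(1)[OF ab(1)]] br_anti[of y x]
      by (simp add: Br_pure Br_snd dbrB comp eqs B0 negB br_anti[of _ x])
    then show ?thesis by algebra
  qed
  have leib\<delta>: "dbr a b (m x y) = dbr (\<lambda>z. a (m y z)) b x + dbr (\<lambda>z. a (m x z)) b y +
      dot a (\<lambda>z. b (br x z)) y + dot a (\<lambda>z. b (br y z)) x"
    if ab: "a \<in> ?B" "b \<in> ?B" for a b x y
  proof -
    \<comment> \<open>Leibniz rule for \<open>b\<close> acting on the product of \<open>x\<close> and \<open>y\<close>, its component in \<open>A\<close> paired with \<open>a\<close>\<close>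
    have "a (fst (Br (0, b) (Mu (x, 0) (y, 0)))) =
        a (fst (Mu (Br (0, b) (x, 0)) (y, 0) + Mu (x, 0) (Br (0, b) (y, 0))))"
      using leib[of "(0, b)" "(x, 0)" "(y, 0)"] ab B_closed by simp
    then have "- dbr b a (m x y) = a (m (- \<alpha> b x) y) + dot a (\<lambda>z. b (br x z)) y +
        (a (m x (- \<alpha> b y)) + dot a (\<lambda>z. b (br y z)) x)"
      using ab by (simp add: Br_pure Br_fst Mu_simps comp B0 \<alpha> \<rho> B_closed)
    moreover have "a (m (- \<alpha> b x) y) = - dbr b (\<lambda>z. a (m y z)) x"
      "a (m x (- \<alpha> b y)) = - dbr b (\<lambda>z. a (m x z)) y"
      using \<alpha>[OF ab(2) comp(2)[OF ab(1), of y], of x] \<alpha>[OF ab(2) comp(2)[OF ab(1), of x], of y] ab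
      by (simp_all add: eqs B0 comm[of _ y])
    ultimately show ?thesis
      using anti[OF ab] anti[OF ab(2) comp(2)[OF ab(1)]] by simp
  qed
  have leib\<Delta>: "dot a b (br x y) = dot (\<lambda>z. a (br x z)) b y + dot a (\<lambda>z. b (br x z)) y +
      (dbr (\<lambda>z. a (m y z)) b x - dbr a (\<lambda>z. b (m y z)) x)"
    if ab: "a \<in> ?B" "b \<in> ?B" for a b x y
  proof -
    \<comment> \<open>Leibniz rule for \<open>x\<close> acting on the product of \<open>a\<close> and \<open>b\<close>, its dual component evaluated at \<open>y\<close>\<close>
    have "snd (Br (x, 0) (Mu (0, a) (0, b))) y =
        snd (Mu (Br (x, 0) (0, a)) (0, b) + Mu (0, a) (Br (x, 0) (0, b))) y"
      using leib[of "(x, 0)" "(0, a)" "(0, b)"] ab B_closed by simp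
    then have "- dot a b (br x y) = b (m y (\<alpha> a x)) - dot (\<lambda>z. a (br x z)) b y +
        (a (m y (\<alpha> b x)) - dot a (\<lambda>z. b (br x z)) y)"
      using ab by (simp add: Br_pure Br_snd Mu_simps comp negB dotB)
    moreover have "b (m y (\<alpha> a x)) = dbr a (\<lambda>z. b (m y z)) x"
      "a (m y (\<alpha> b x)) = dbr b (\<lambda>z. a (m y z)) x"
      using \<alpha>[OF ab(1) comp(2)[OF ab(2), of y], of x] \<alpha>[OF ab(2) comp(2)[OF ab(1), of y], of x]
      by simp_all
    ultimately show ?thesis
      using anti[OF ab(2) comp(2)[OF ab(1)]] by (simp add: algebra_simps)
  qed
  have d\<delta>: "dual_operation \<delta> a b = dbr a b" "tensor_pairing a b (\<delta> x) = dbr a b x"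
    if "a \<in> ?B" "b \<in> ?B" for a b x
    using dbr that by (auto simp: fun_eq_iff dual_operation_apply)
  have d\<Delta>: "dual_operation \<Delta> a b = dot a b" "tensor_pairing a b (\<Delta> x) = dot a b x" for a b x
    by (simp_all add: dot_def dual_operation_apply)
  have lin: "linear_on scale ?A scale ?A (mult_left br x)" "linear_on scale ?A scale ?A (mult_left m x)"
    "linear_on scale ?A scale ?A id" for x
    using bilinear_on_right[OF bbr, of x] bilinear_on_right[OF bm, of x]
    by (simp_all add: linear_on_def mult_left_def)
  note tensor = submodule_add[OF submodule_tensor_space] submodule_diff[OF submodule_tensor_space]
    submodule_neg[OF submodule_tensor_space] tmap_closed tflip_closed lin T
  note test = tensor_pairing_linear tensor_pairing_tmap tensor_pairing_tflip mult_left_def d\<delta> d\<Delta> comp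
  have lieco: "lie_coalgebra scale \<delta>"
    unfolding lie_coalgebra_def Let_def
  proof (intro conjI allI \<delta>)
    fix x
    show "\<delta> x = - tflip scale (\<delta> x)"
      by (rule tensor_eqI) (simp_all add: tensor test anti[of _ _ x, symmetric])
    note T3 = id_tens_closed[OF \<delta> T(2)] tcycle_closed
      submodule_add[OF submodule_tensor3_space] submodule_zero[OF submodule_tensor3_space]
    show "id_tens scale \<delta> (\<delta> x) + tcycle scale (id_tens scale \<delta> (\<delta> x)) +
        tcycle scale (tcycle scale (id_tens scale \<delta> (\<delta> x))) = 0"
    proof (rule tensor3_eqI)
      fix a b c assume abc: "a \<in> ?B" "b \<in> ?B" "c \<in> ?B"
      have "dbr a (dbr b c) + dbr b (dbr c a) + dbr c (dbr a b) = 0"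
        using PB abc by (simp add: poisson_algebra_def lie_algebra_def)
      then have "(dbr a (dbr b c) + dbr b (dbr c a) + dbr c (dbr a b)) x = 0 x" by (rule fun_cong)
      with abc show "(id_tens scale \<delta> (\<delta> x) + tcycle scale (id_tens scale \<delta> (\<delta> x)) +
          tcycle scale (tcycle scale (id_tens scale \<delta> (\<delta> x)))) (tri a b c) = 0 (tri a b c)"
        by (simp add: tcycle_pairing id_tens_pairing[OF \<delta> T(2)] test dbrB)
    qed (simp_all add: T3)
  qed
  have poisco: "id_tens scale \<Delta> (\<delta> x) =
      tens_id scale \<delta> (\<Delta> x) + tflip_id scale (id_tens scale \<delta> (\<Delta> x))" for x
  proof (rule tensor3_eqI)
    fix a b c assume abc: "a \<in> ?B" "b \<in> ?B" "c \<in> ?B"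
    have "dbr a (dot b c) = dot (dbr a b) c + dot b (dbr a c)"
      using PB abc by (simp add: poisson_algebra_def)
    then have "dbr a (dot b c) x = dot (dbr a b) c x + dot b (dbr a c) x" by simp
    with abc show "id_tens scale \<Delta> (\<delta> x) (tri a b c) =
        (tens_id scale \<delta> (\<Delta> x) + tflip_id scale (id_tens scale \<delta> (\<Delta> x))) (tri a b c)"
      by (simp add: tflip_id_pairing id_tens_pairing[OF \<delta> T(1)] tens_id_pairing[OF \<delta> T(1)]
          id_tens_pairing[OF \<Delta> T(2)] test dotB)
  qed (simp_all add: id_tens_closed tens_id_closed tflip_id_closed \<delta> \<Delta> T
      submodule_add[OF submodule_tensor3_space])
  have "lie_bialgebra scale br \<delta>"
    unfolding lie_bialgebra_def
  proof (intro conjI allI lieco)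
    show "lie_algebra scale ?A br" using PA by (simp add: poisson_algebra_def)
    show "\<delta> (br x y) = (tmap scale (ad br x) id (\<delta> y) + tmap scale id (ad br x) (\<delta> y)) -
        (tmap scale (ad br y) id (\<delta> x) + tmap scale id (ad br y) (\<delta> x))" for x y
      by (rule tensor_eqI) (simp_all add: tensor test cocycle)
  qed
  moreover have "poisson_coalgebra scale \<delta> \<Delta>"
    using lieco poisco cc
    by (simp add: poisson_coalgebra_def cc_asi_bialgebra_def asi_bialgebra_def)
  moreover have "\<delta> (m x y) = tmap scale (mult_left m y) id (\<delta> x) + tmap scale (mult_left m x) id (\<delta> y) +
      tmap scale id (ad br x) (\<Delta> y) + tmap scale id (ad br y) (\<Delta> x)" for x y
    by (rule tensor_eqI) (simp_all add: tensor test leib\<delta>)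
  moreover have "\<Delta> (br x y) = (tmap scale (ad br x) id (\<Delta> y) + tmap scale id (ad br x) (\<Delta> y)) +
      (tmap scale (mult_left m y) id (\<delta> x) - tmap scale id (mult_left m y) (\<delta> x))" for x y
    by (rule tensor_eqI) (simp_all add: tensor test leib\<Delta>)
  ultimately show ?thesis
    using PA cc unfolding poisson_bialgebra_def by blast
qed

end

section \<open>Topological duals and completed tensors\<close>

lemma sum_swap2:
  "(\<Sum>i\<in>I. \<Sum>p\<in>P. \<Sum>q\<in>Q. f i p q) = (\<Sum>p\<in>P. \<Sum>q\<in>Q. \<Sum>i\<in>I. f i p q)"
  by (subst sum.swap) (intro sum.cong refl sum.swap)

lemma sum_swap22:
  "(\<Sum>i\<in>I. \<Sum>j\<in>J i. \<Sum>p\<in>P. \<Sum>q\<in>Q. f i j p q) = (\<Sum>p\<in>P. \<Sum>q\<in>Q. \<Sum>i\<in>I. \<Sum>j\<in>J i. f i j p q)"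
  by (simp only: sum_swap2[where I="J _"] sum_swap2[where I=I])

text \<open>
  Covectors and tensors are functions into the field. Reading a power series of such functions as a
  function into power series turns the convolution formulas below into sums of products in \<open>K\<close>.
\<close>

definition ev :: "('g \<Rightarrow> 'k::comm_ring_1) fps \<Rightarrow> 'g \<Rightarrow> 'k fps" where
  "ev f g = Abs_fps (\<lambda>n. fps_nth f n g)"

lemma ev_nth [simp]: "fps_nth (ev f g) n = fps_nth f n g"
  by (simp add: ev_def)

lemma ev_eqI: "(\<And>g. ev f g = ev f' g) \<Longrightarrow> f = f'"
  by (intro fps_ext ext) (metis ev_nth)

lemma ev_add [simp]: "ev (f + f') g = ev f g + ev f' g"
  by (rule fps_ext) simp

lemma ev_diff [simp]: "ev (f - f') g = ev f g - ev f' g"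
  by (rule fps_ext) simp

lemma ev_zero [simp]: "ev 0 g = 0"
  by (rule fps_ext) simp

lemma ev_sum: "ev (\<Sum>i\<in>I. f i) g = (\<Sum>i\<in>I. ev (f i) g)"
  by (induction I rule: infinite_finite_induct) auto

lemma ev_scale [simp]: "ev (fps_scale fun_scale c f) g = c * ev f g"
  by (rule fps_ext) (simp add: fps_scale_nth fps_mult_nth sum_fun_apply atLeast0AtMost)

lemma ev_const [simp]: "ev (fps_const f) g = fps_const (f g)"
  by (rule fps_ext) simp

context finite_dimensional_vector_space
begin

abbreviation "hscale \<equiv> fps_scale scale"
abbreviation "hdual \<equiv> fps_space (dual)"
abbreviation "hdual_scale \<equiv> fps_scale (fun_scale :: 'a \<Rightarrow> ('b \<Rightarrow> 'a) \<Rightarrow> 'b \<Rightarrow> 'a)"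
abbreviation "htensors \<equiv> fps_space (tensors)"
abbreviation "htensor_scale \<equiv> fps_scale (fun_scale :: 'a \<Rightarrow> ('b, 'a) tensor2 \<Rightarrow> _)"

lemma module_h: "module hscale"
  by (rule module_fps_scale[OF module_axioms])

lemma submodule_h: "submodule hscale UNIV"
  by (rule submodule_UNIV[OF module_h])

lemma submodule_hdual: "submodule hdual_scale hdual"
  by (rule submodule_fps_space[OF submodule_dual])

lemma submodule_htensors: "submodule htensor_scale htensors"
  by (rule submodule_fps_space[OF submodule_tensor_space])

lemma hdual_nth: "u \<in> hdual \<Longrightarrow> fps_nth u n \<in> dual"
  by (simp add: fps_space_def)

lemma hdual_const: "u \<in> dual \<Longrightarrow> fps_const u \<in> hdual"
  by (rule fps_const_in_fps_space[OF submodule_dual])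

lemma dual_zero: "u \<in> dual \<Longrightarrow> u 0 = 0"
  using dual_sum[of u _ "{}"] by simp

definition crdh where "crdh b x = Abs_fps (\<lambda>n. crd b (fps_nth x n))"

lemma crdh_nth [simp]: "fps_nth (crdh b x) n = crd b (fps_nth x n)"
  by (simp add: crdh_def)

lemma crd_linear: "crd b (x + y) = crd b x + crd b y" "crd b (scale c x) = c * crd b x" "crd b 0 = 0"
  "crd b (\<Sum>i\<in>I. f i) = (\<Sum>i\<in>I. crd b (f i))"
  using crd_dual[of b] dual_zero[OF crd_dual] dual_sum[OF crd_dual] unfolding dual_iff by auto

lemma crdh_add: "crdh b (x + y) = crdh b x + crdh b y"
  by (rule fps_ext) (simp add: crd_linear)

lemma crdh_scale: "crdh b (hscale c x) = c * crdh b x"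
  by (rule fps_ext) (simp add: fps_scale_nth fps_mult_nth crd_linear atLeast0AtMost)

lemma crdh_const: "crdh b (fps_const x) = fps_const (crd b x)"
  by (rule fps_ext) (simp add: crd_linear)

lemma fps_scale_const_right:
  "module t \<Longrightarrow> fps_nth (fps_scale t c (fps_const x)) n = t (fps_nth c n) x"
  unfolding fps_scale_nth
proof -
  assume t: "module t"
  have "(\<Sum>i\<le>n. t (fps_nth c i) (fps_nth (fps_const x) (n - i))) = (\<Sum>i\<le>n. if i = n then t (fps_nth c n) x else 0)"
    by (rule sum.cong) (auto simp: module.scale_zero_right[OF t])
  then show "(\<Sum>i\<le>n. t (fps_nth c i) (fps_nth (fps_const x) (n - i))) = t (fps_nth c n) x" by simp
qed

lemma h_expansion: "(\<Sum>b\<in>Basis. hscale (crdh b x) (fps_const b)) = x"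
  by (rule fps_ext)
    (simp add: fps_sum_nth fps_scale_const_right[OF module_axioms] crd_expansion)

lemma hdual_expansion:
  assumes "u \<in> hdual"
  shows "(\<Sum>b\<in>Basis. hdual_scale (ev u b) (fps_const (crd b))) = u"
  by (rule fps_ext)
    (simp add: fps_sum_nth fps_scale_const_right[OF module_fun_scale]
      dual_expansion_fun[OF hdual_nth[OF assms], symmetric])

lemma pairing_expansion:
  assumes "u \<in> hdual"
  shows "pairing_h u x = (\<Sum>b\<in>Basis. ev u b * crdh b x)"
proof (rule fps_ext)
  fix n
  have "fps_nth (pairing_h u x) n = (\<Sum>i\<le>n. \<Sum>b\<in>Basis. fps_nth u i b * crd b (fps_nth x (n - i)))"
    by (simp add: pairing_h_def dual_expansion[OF hdual_nth[OF assms], symmetric])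
  also have "\<dots> = fps_nth (\<Sum>b\<in>Basis. ev u b * crdh b x) n"
    by (subst sum.swap) (simp add: fps_sum_nth fps_mult_nth atLeast0AtMost)
  finally show "fps_nth (pairing_h u x) n = fps_nth (\<Sum>b\<in>Basis. ev u b * crdh b x) n" .
qed

lemma pairing_const_right:
  assumes "u \<in> hdual"
  shows "pairing_h u (fps_const x) = ev u x"
  unfolding pairing_expansion[OF assms]
  by (rule fps_ext)
    (simp add: crdh_const fps_sum_nth dual_expansion[OF hdual_nth[OF assms], of _ x])

lemma pairing_const_left: "fps_nth (pairing_h (fps_const u) x) n = u (fps_nth x n)"
proof -
  have "fps_nth (pairing_h (fps_const u) x) n = (\<Sum>i\<le>n. if i = 0 then u (fps_nth x n) else 0)"
    unfolding pairing_h_def fps_nth_Abs_fps by (rule sum.cong) auto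
  then show ?thesis by simp
qed

lemma pairing_bilinear: "bilinear_on hdual_scale hdual hscale UNIV (*) UNIV pairing_h"
proof -
  have "u + v \<in> hdual" "hdual_scale c u \<in> hdual" if "u \<in> hdual" "v \<in> hdual" for u v c
    using submodule_add[OF submodule_hdual] submodule_scale[OF submodule_hdual] that by auto
  then show ?thesis
    by (simp add: bilinear_on_def linear_on_def pairing_expansion crdh_add crdh_scale
        algebra_simps sum.distrib sum_distrib_left)
qed

lemma paired_modules_h:
  "paired_modules hscale UNIV hdual_scale hdual pairing_h"
proof
  show "x = 0" if *: "\<And>u. u \<in> hdual \<Longrightarrow> pairing_h u x = 0" for x
  proof (rule fps_ext)
    fix n
    have "u (fps_nth x n) = u 0" if "u \<in> dual" for u
      using *[OF hdual_const[OF that]] pairing_const_left[of u x n] dual_zero[OF that] by simp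
    then show "fps_nth x n = fps_nth 0 n" using eq_by_dual by simp
  qed
  show "u = 0" if "u \<in> hdual" "\<And>x. x \<in> UNIV \<Longrightarrow> pairing_h u x = 0" for u
    using that(2) pairing_const_right[OF that(1)] by (intro ev_eqI) (metis UNIV_I ev_zero)
qed (fact submodule_h submodule_hdual pairing_bilinear)+

lemma h_linear_expansion:
  assumes "linear_on hscale UNIV (*) UNIV \<Phi>"
  shows "\<Phi> x = (\<Sum>b\<in>Basis. crdh b x * \<Phi> (fps_const b))"
proof -
  have "\<Phi> x = \<Phi> (\<Sum>b\<in>Basis. hscale (crdh b x) (fps_const b))" by (simp add: h_expansion)
  also have "\<dots> = (\<Sum>b\<in>Basis. crdh b x * \<Phi> (fps_const b))"
    by (subst linear_on_sum[OF assms submodule_h]) (simp_all add: linear_on_scale[OF assms])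
  finally show ?thesis .
qed

text \<open>
  \<open>(A\<^sup>*)[[h]]\<close> is the \<open>K\<close>-linear dual of \<open>A[[h]]\<close>, and conversely. This makes the descriptions by
  which the topological duals of operations and representations are given meaningful.
\<close>

lemma hdual_represents:
  assumes "linear_on hscale UNIV (*) UNIV \<Phi>"
  shows "\<exists>!w. w \<in> hdual \<and> (\<forall>v. pairing_h w v = \<Phi> v)"
proof -
  interpret paired_modules hscale UNIV hdual_scale hdual pairing_h by (rule paired_modules_h)
  let ?w = "Abs_fps (\<lambda>n x. fps_nth (\<Phi> (fps_const x)) n)"
  have "fps_nth (\<Phi> (fps_const (x + y))) n = fps_nth (\<Phi> (fps_const x)) n + fps_nth (\<Phi> (fps_const y)) n"
    for x y n using assms by (simp add: linear_on_def flip: fps_const_add)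
  moreover have "fps_nth (\<Phi> (fps_const (scale c x))) n = c * fps_nth (\<Phi> (fps_const x)) n" for c x n
    using assms by (simp add: linear_on_def flip: fps_scale_const_const[OF module_axioms])
  ultimately have w: "?w \<in> hdual"
    by (simp add: fps_space_def dual_iff)
  have "ev ?w x = \<Phi> (fps_const x)" for x by (rule fps_ext) simp
  then have "pairing_h ?w v = \<Phi> v" for v
    by (simp add: pairing_expansion[OF w] h_linear_expansion[OF assms, of v] mult.commute)
  with w show ?thesis
    by (intro ex1I[of _ ?w]) (auto intro: B_eqI)
qed

lemma h_represents:
  assumes "linear_on hdual_scale hdual (*) UNIV \<Psi>"
  shows "\<exists>!y. \<forall>v\<in>hdual. pairing_h v y = \<Psi> v"
proof -
  interpret paired_modules hscale UNIV hdual_scale hdual pairing_h by (rule paired_modules_h)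
  let ?y = "\<Sum>p\<in>Basis. hscale (\<Psi> (fps_const (crd p))) (fps_const p)"
  have "pairing_h v ?y = \<Psi> v" if v: "v \<in> hdual" for v
  proof -
    note lin = bilinear_on_right[OF pairing_bilinear v]
    have "\<Psi> v = \<Psi> (\<Sum>b\<in>Basis. hdual_scale (ev v b) (fps_const (crd b)))"
      by (simp add: hdual_expansion[OF v])
    also have "\<dots> = (\<Sum>b\<in>Basis. ev v b * \<Psi> (fps_const (crd b)))"
      by (subst linear_on_sum[OF assms submodule_hdual])
        (simp_all add: linear_on_scale[OF assms] submodule_scale[OF submodule_hdual] hdual_const)
    also have "\<dots> = pairing_h v ?y"
      by (subst linear_on_sum[OF lin submodule_h])
        (simp_all add: linear_on_scale[OF lin] pairing_const_right[OF v] mult.commute)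
    finally show ?thesis ..
  qed
  then show ?thesis
    by (intro ex1I[of _ ?y]) (auto intro: A_eqI)
qed

definition evt where "evt t p q = Abs_fps (\<lambda>n. tcrd (fps_nth t n) p q)"

lemma evt_nth [simp]: "fps_nth (evt t p q) n = tcrd (fps_nth t n) p q"
  by (simp add: evt_def)

lemma evt_ev: "evt t p q = ev t (\<lambda>x y. crd p x * crd q y)"
  by (rule fps_ext) (simp add: tcrd_def)

lemma htensor_nth: "t \<in> htensors \<Longrightarrow> fps_nth t n \<in> tensors"
  by (simp add: fps_space_def)

lemma htensor_eqI:
  assumes "t \<in> htensors" "t' \<in> htensors" "\<And>p q. evt t p q = evt t' p q"
  shows "t = t'"
proof (intro fps_ext ext)
  fix n \<beta>
  have "tcrd (fps_nth t n) p q = tcrd (fps_nth t' n) p q" for p q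
    using assms(3)[of p q] by (metis evt_nth)
  then show "fps_nth t n \<beta> = fps_nth t' n \<beta>"
    by (simp add: tensor_expansion[OF htensor_nth[OF assms(1)]]
        tensor_expansion[OF htensor_nth[OF assms(2)]])
qed

lemma tensor_pairing_expansion:
  assumes "t \<in> tensors" "a \<in> dual" "b \<in> dual"
  shows "tensor_pairing a b t = (\<Sum>p\<in>Basis. \<Sum>q\<in>Basis. a p * (b q * tcrd t p q))"
  unfolding tensor_pairing_def tensor_expansion[OF assms(1), of "\<lambda>x y. a x * b y"]
  using bilinear_form_product[OF assms(2,3)] by (simp add: mult.assoc)

text \<open>
  In coordinates over \<open>K\<close> the pairing is trilinear by inspection, and transposition of \<open>F \<otimes> G\<close> and of
  the flip is an exchange of finite sums.
\<close>

lemma tensor_pairing_h_expansion: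
  assumes "a \<in> hdual" "b \<in> hdual" "t \<in> htensors"
  shows "tensor_pairing_h a b t = (\<Sum>p\<in>Basis. \<Sum>q\<in>Basis. ev a p * (ev b q * evt t p q))"
proof (rule fps_ext)
  fix n
  have "fps_nth (tensor_pairing_h a b t) n = (\<Sum>i\<le>n. \<Sum>j\<le>n - i. \<Sum>p\<in>Basis. \<Sum>q\<in>Basis.
      fps_nth a i p * (fps_nth b j q * tcrd (fps_nth t (n - i - j)) p q))"
    by (simp add: tensor_pairing_h_def
        tensor_pairing_expansion[OF htensor_nth[OF assms(3)] hdual_nth[OF assms(1)] hdual_nth[OF assms(2)]])
  also have "\<dots> = (\<Sum>p\<in>Basis. \<Sum>q\<in>Basis. \<Sum>i\<le>n. \<Sum>j\<le>n - i.
      fps_nth a i p * (fps_nth b j q * tcrd (fps_nth t (n - i - j)) p q))"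
    by (rule sum_swap22)
  also have "\<dots> = fps_nth (\<Sum>p\<in>Basis. \<Sum>q\<in>Basis. ev a p * (ev b q * evt t p q)) n"
    by (simp add: fps_sum_nth fps_mult_nth sum_distrib_left atLeast0AtMost)
  finally show "fps_nth (tensor_pairing_h a b t) n = \<dots>" .
qed

lemma tlift_h_expansion:
  assumes "t \<in> htensors" "\<And>k g. bilinear_form scale (\<lambda>x y. fps_nth (\<phi> x y) k g)"
  shows "tlift_h \<phi> t = (\<Sum>p\<in>Basis. \<Sum>q\<in>Basis. fps_scale fun_scale (evt t p q) (\<phi> p q))"
proof (rule fps_ext)
  fix n
  have "fps_nth (tlift_h \<phi> t) n = (\<Sum>i\<le>n. \<Sum>p\<in>Basis. \<Sum>q\<in>Basis.
      fun_scale (tcrd (fps_nth t i) p q) (fps_nth (\<phi> p q) (n - i)))"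
    by (simp add: tlift_h_def tlift_expansion[OF htensor_nth[OF assms(1)] assms(2)])
  also have "\<dots> = (\<Sum>p\<in>Basis. \<Sum>q\<in>Basis. \<Sum>i\<le>n.
      fun_scale (tcrd (fps_nth t i) p q) (fps_nth (\<phi> p q) (n - i)))"
    by (rule sum_swap2)
  also have "\<dots> = fps_nth (\<Sum>p\<in>Basis. \<Sum>q\<in>Basis. fps_scale fun_scale (evt t p q) (\<phi> p q)) n"
    by (simp add: fps_sum_nth fps_scale_nth)
  finally show "fps_nth (tlift_h \<phi> t) n = \<dots>" .
qed

lemma tens_h_closed: "tens_h scale x y \<in> htensors"
  by (auto simp: tens_h_def fps_space_def
      intro!: submodule_sum[OF submodule_tensor_space] tens_in_tensor_space)

lemma evt_tens_h: "evt (tens_h scale x y) p q = crdh p x * crdh q y"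
  by (rule fps_ext)
    (simp add: tens_h_def tcrd_def sum_fun_apply tens_def bilinear_form_product fps_mult_nth
      atLeast0AtMost)

lemma tens_h_bilinear:
  assumes F: "linear_on hscale UNIV hscale UNIV F" and G: "linear_on hscale UNIV hscale UNIV G"
  shows "bilinear_form scale (\<lambda>x y. fps_nth (tens_h scale (F (fps_const x)) (G (fps_const y))) k \<beta>)"
proof (cases "bilinear_form scale \<beta>")
  case True
  have lin: "fps_nth (H (fps_const (x + y))) i = fps_nth (H (fps_const x)) i + fps_nth (H (fps_const y)) i"
    "fps_nth (H (fps_const (scale c x))) i = scale c (fps_nth (H (fps_const x)) i)"
    if "linear_on hscale UNIV hscale UNIV H" for H x y c i
    using linear_on_add[OF that, of "fps_const x" "fps_const y"]
      linear_on_scale[OF that, of "fps_const x" "fps_const c"]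
    by (simp_all add: fps_scale_const_const[OF module_axioms] fps_scale_const[OF module_axioms])
  have "\<beta> (x + y) z = \<beta> x z + \<beta> y z" "\<beta> z (x + y) = \<beta> z x + \<beta> z y"
    "\<beta> (scale c x) z = c * \<beta> x z" "\<beta> z (scale c x) = c * \<beta> z x" for x y z c
    using True by (auto simp: bilinear_form_iff dual_iff)
  then have "bilinear_form scale
      (\<lambda>x y. \<Sum>i\<le>k. \<beta> (fps_nth (F (fps_const x)) i) (fps_nth (G (fps_const y)) (k - i)))"
    by (subst bilinear_form_iff) (simp add: dual_iff lin[OF F] lin[OF G] sum.distrib sum_distrib_left)
  with True show ?thesis
    by (simp add: tens_h_def sum_fun_apply tens_def)
next
  case False
  then have "fps_nth (tens_h scale (F (fps_const x)) (G (fps_const y))) k \<beta> = 0" for x y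
    by (simp add: tens_h_def sum_fun_apply tens_def)
  then show ?thesis
    by (simp add: bilinear_form_iff dual_iff)
qed

lemma tmap_h_closed:
  assumes "linear_on hscale UNIV hscale UNIV F" "linear_on hscale UNIV hscale UNIV G" "t \<in> htensors"
  shows "tmap_h scale F G t \<in> htensors"
  unfolding tmap_h_def tlift_h_expansion[OF assms(3) tens_h_bilinear[OF assms(1,2)]]
  by (intro submodule_sum[OF submodule_htensors] submodule_scale[OF submodule_htensors] tens_h_closed)

lemma evt_tmap_h:
  assumes "linear_on hscale UNIV hscale UNIV F" "linear_on hscale UNIV hscale UNIV G" "t \<in> htensors"
  shows "evt (tmap_h scale F G t) p q =
    (\<Sum>i\<in>Basis. \<Sum>j\<in>Basis. evt t i j * (crdh p (F (fps_const i)) * crdh q (G (fps_const j))))"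
  unfolding tmap_h_def tlift_h_expansion[OF assms(3) tens_h_bilinear[OF assms(1,2)]]
  by (simp add: evt_ev[of "sum _ _"] ev_sum evt_tens_h[unfolded evt_ev])

lemma tensor_pairing_tmap_h:
  assumes F: "linear_on hscale UNIV hscale UNIV F" and G: "linear_on hscale UNIV hscale UNIV G"
    and t: "t \<in> htensors" and u: "u \<in> hdual" "v \<in> hdual" "u' \<in> hdual" "v' \<in> hdual"
    and adj: "\<And>x. pairing_h u' x = pairing_h u (F x)" "\<And>x. pairing_h v' x = pairing_h v (G x)"
  shows "tensor_pairing_h u v (tmap_h scale F G t) = tensor_pairing_h u' v' t"
proof -
  have "ev u' i = (\<Sum>p\<in>Basis. ev u p * crdh p (F (fps_const i)))"
    "ev v' i = (\<Sum>p\<in>Basis. ev v p * crdh p (G (fps_const i)))" for i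
    using adj[of "fps_const i"]
    by (simp_all only: pairing_const_right[OF u(3)] pairing_const_right[OF u(4)]
        pairing_expansion[OF u(1)] pairing_expansion[OF u(2)])
  moreover have "(\<Sum>p\<in>Basis. f p) * ((\<Sum>q\<in>Basis. g q) * e) = (\<Sum>p\<in>Basis. \<Sum>q\<in>Basis. f p * (g q * e))"
    for f g :: "'b \<Rightarrow> 'a fps" and e
    unfolding sum_distrib_right by (intro sum.cong refl) (simp add: sum_distrib_left)
  ultimately have "tensor_pairing_h u' v' t = (\<Sum>i\<in>Basis. \<Sum>j\<in>Basis. \<Sum>p\<in>Basis. \<Sum>q\<in>Basis.
      ev u p * (ev v q * (evt t i j * (crdh p (F (fps_const i)) * crdh q (G (fps_const j))))))"
    using u t by (simp add: tensor_pairing_h_expansion mult_ac)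
  also have "\<dots> = (\<Sum>p\<in>Basis. \<Sum>q\<in>Basis. \<Sum>i\<in>Basis. \<Sum>j\<in>Basis.
      ev u p * (ev v q * (evt t i j * (crdh p (F (fps_const i)) * crdh q (G (fps_const j))))))"
    by (rule sum_swap22)
  also have "\<dots> = tensor_pairing_h u v (tmap_h scale F G t)"
    using u t
    by (simp add: tensor_pairing_h_expansion tmap_h_closed F G evt_tmap_h sum_distrib_left)
  finally show ?thesis ..
qed

lemma tlift_h_const:
  assumes "t \<in> htensors"
  shows "fps_nth (tlift_h (\<lambda>x y. fps_const (\<phi> x y)) t) n = tlift \<phi> (fps_nth t n)"
proof -
  have zero: "tlift (\<lambda>x y. 0) (fps_nth t i) = 0" for i
    by (rule ext) (simp add: tlift_def tensor_expansion[OF htensor_nth[OF assms]])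
  have "fps_nth (tlift_h (\<lambda>x y. fps_const (\<phi> x y)) t) n =
      (\<Sum>i\<le>n. if i = n then tlift \<phi> (fps_nth t n) else 0)"
    unfolding tlift_h_def fps_nth_Abs_fps
    by (rule sum.cong) (auto simp: zero)
  then show ?thesis by simp
qed

lemma tflip_h_nth: "t \<in> htensors \<Longrightarrow> fps_nth (tflip_h scale t) n = tflip scale (fps_nth t n)"
  by (simp add: tflip_h_def tflip_def tlift_h_const)

lemma tflip_h_closed: "t \<in> htensors \<Longrightarrow> tflip_h scale t \<in> htensors"
  by (simp add: fps_space_def[of "tensors"] tflip_h_nth tflip_closed)

lemma evt_tflip_h: "t \<in> htensors \<Longrightarrow> evt (tflip_h scale t) p q = evt t q p"
  using tensor_pairing_tflip[OF crd_dual crd_dual]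
  by (intro fps_ext) (simp add: tflip_h_nth tcrd_def tensor_pairing_def)

lemma tensor_pairing_tflip_h:
  assumes "u \<in> hdual" "v \<in> hdual" "t \<in> htensors"
  shows "tensor_pairing_h u v (tflip_h scale t) = tensor_pairing_h v u t"
  using assms
  by (subst (2) tensor_pairing_h_expansion; simp add: tensor_pairing_h_expansion tflip_h_closed evt_tflip_h)
    (subst sum.swap, simp add: mult_ac)

lemma evt_linear:
  "evt (t + t') p q = evt t p q + evt t' p q" "evt (t - t') p q = evt t p q - evt t' p q"
  "evt (htensor_scale c t) p q = c * evt t p q"
  by (simp_all add: evt_ev)

lemma tensor_pairing_h_linear:
  assumes "u \<in> hdual" "v \<in> hdual" "t \<in> htensors"
  shows "t' \<in> htensors \<Longrightarrow> tensor_pairing_h u v (t + t') = tensor_pairing_h u v t + tensor_pairing_h u v t'"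
    and "t' \<in> htensors \<Longrightarrow> tensor_pairing_h u v (t - t') = tensor_pairing_h u v t - tensor_pairing_h u v t'"
    and "tensor_pairing_h u v (htensor_scale c t) = c * tensor_pairing_h u v t"
  using assms submodule_add[OF submodule_htensors] submodule_diff[OF submodule_htensors]
    submodule_scale[OF submodule_htensors]
  by (simp_all add: tensor_pairing_h_expansion evt_linear algebra_simps sum.distrib
      sum_subtractf sum_distrib_left)

lemma tensor_pairing_h_bilinear:
  assumes "t \<in> htensors"
  shows "bilinear_on hdual_scale hdual hdual_scale hdual (*) UNIV (\<lambda>u v. tensor_pairing_h u v t)"
  using assms submodule_add[OF submodule_hdual] submodule_scale[OF submodule_hdual]
  by (simp add: bilinear_on_def linear_on_def tensor_pairing_h_expansion algebra_simps sum.distrib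
      sum_distrib_left)

lemma tensor_pairing_h_const:
  "fps_nth (tensor_pairing_h (fps_const a) v t) n = (\<Sum>j\<le>n. tensor_pairing a (fps_nth v j) (fps_nth t (n - j)))"
  if "a \<in> dual" "v \<in> hdual" "t \<in> htensors"
proof -
  have zero: "tensor_pairing 0 (fps_nth v j) (fps_nth t i) = 0" for i j
    by (simp add: tensor_pairing_def tensor_expansion[OF htensor_nth[OF that(3)]])
  have "fps_nth (tensor_pairing_h (fps_const a) v t) n =
    (\<Sum>i\<le>n. if i = 0 then \<Sum>j\<le>n. tensor_pairing a (fps_nth v j) (fps_nth t (n - j)) else 0)"
    unfolding tensor_pairing_h_def fps_nth_Abs_fps
    by (rule sum.cong) (auto simp: zero)
  then show ?thesis by simp
qed

lemma tensor_pairing_h_const2: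
  "fps_nth (tensor_pairing_h v (fps_const a) t) n = (\<Sum>j\<le>n. tensor_pairing (fps_nth v j) a (fps_nth t (n - j)))"
  if "a \<in> dual" "v \<in> hdual" "t \<in> htensors"
proof -
  have zero: "tensor_pairing (fps_nth v j) 0 (fps_nth t i) = 0" for i j
    by (simp add: tensor_pairing_def tensor_expansion[OF htensor_nth[OF that(3)]])
  have "(\<Sum>j\<le>n - i. tensor_pairing (fps_nth v i) (fps_nth (fps_const a) j) (fps_nth t (n - i - j))) =
      (\<Sum>j\<le>n - i. if j = 0 then tensor_pairing (fps_nth v i) a (fps_nth t (n - i)) else 0)" for i
    by (rule sum.cong) (auto simp: zero)
  then show ?thesis
    by (simp add: tensor_pairing_h_def)
qed

lemma comultiplication_h_iff:
  "comultiplication_h scale \<Delta>h \<longleftrightarrow> (\<forall>x. \<Delta>h x \<in> htensors) \<and>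
    (\<forall>x y. \<Delta>h (x + y) = \<Delta>h x + \<Delta>h y) \<and> (\<forall>c x. \<Delta>h (hscale c x) = htensor_scale c (\<Delta>h x))"
  by (simp add: comultiplication_h_def linear_on_def vector_space_axioms)

lemma dual_operation_h_spec:
  assumes \<Delta>h: "comultiplication_h scale \<Delta>h" and "u \<in> hdual" "v \<in> hdual"
  shows "dual_operation_h scale \<Delta>h u v \<in> hdual"
    and "pairing_h (dual_operation_h scale \<Delta>h u v) x = tensor_pairing_h u v (\<Delta>h x)"
proof -
  have "linear_on hscale UNIV (*) UNIV (\<lambda>x. tensor_pairing_h u v (\<Delta>h x))"
    using assms by (simp add: linear_on_def comultiplication_h_iff tensor_pairing_h_linear)
  from theI'[OF hdual_represents[OF this]]
  show "dual_operation_h scale \<Delta>h u v \<in> hdual"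
    and "pairing_h (dual_operation_h scale \<Delta>h u v) x = tensor_pairing_h u v (\<Delta>h x)"
    by (auto simp: dual_operation_h_def)
qed

lemma dual_rep_h_spec:
  assumes "linear_on hscale UNIV hscale UNIV (\<rho> x)" and "u \<in> hdual"
  shows "dual_rep_h scale \<rho> x u \<in> hdual"
    and "pairing_h (dual_rep_h scale \<rho> x u) v = pairing_h u (\<rho> x v)"
proof -
  have "linear_on hscale UNIV (*) UNIV (\<lambda>v. pairing_h u (\<rho> x v))"
    by (rule linear_on_compose[OF assms(1) bilinear_on_right[OF pairing_bilinear assms(2)]])
  from theI'[OF hdual_represents[OF this]]
  show "dual_rep_h scale \<rho> x u \<in> hdual"
    and "pairing_h (dual_rep_h scale \<rho> x u) v = pairing_h u (\<rho> x v)"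
    by (auto simp: dual_rep_h_def)
qed

lemma predual_rep_h_spec:
  assumes "linear_on hdual_scale hdual hdual_scale hdual (\<rho> u)" and "v \<in> hdual"
  shows "pairing_h v (predual_rep_h scale \<rho> u x) = pairing_h (\<rho> u v) x"
proof -
  have "linear_on hdual_scale hdual (*) UNIV (\<lambda>v. pairing_h (\<rho> u v) x)"
    by (rule linear_on_compose[OF assms(1) bilinear_on_left[OF pairing_bilinear]]) simp
  from theI'[OF h_represents[OF this]] assms(2)
  show "pairing_h v (predual_rep_h scale \<rho> u x) = pairing_h (\<rho> u v) x"
    by (auto simp: predual_rep_h_def)
qed

lemma dual_operation_h_bilinear:
  assumes \<Delta>h: "comultiplication_h scale \<Delta>h"
  shows "binary_operation hdual_scale hdual (dual_operation_h scale \<Delta>h)"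
proof -
  interpret paired_modules hscale UNIV hdual_scale hdual pairing_h by (rule paired_modules_h)
  have \<Delta>hT: "\<Delta>h x \<in> htensors" for x using \<Delta>h by (simp add: comultiplication_h_iff)
  note spec = dual_operation_h_spec[OF \<Delta>h]
  have "tensor_pairing_h (u + v) w (\<Delta>h x) = tensor_pairing_h u w (\<Delta>h x) + tensor_pairing_h v w (\<Delta>h x)"
    "tensor_pairing_h w (u + v) (\<Delta>h x) = tensor_pairing_h w u (\<Delta>h x) + tensor_pairing_h w v (\<Delta>h x)"
    "tensor_pairing_h (hdual_scale c u) w (\<Delta>h x) = c * tensor_pairing_h u w (\<Delta>h x)"
    "tensor_pairing_h w (hdual_scale c u) (\<Delta>h x) = c * tensor_pairing_h w u (\<Delta>h x)"
    if "u \<in> hdual" "v \<in> hdual" "w \<in> hdual" for u v w c x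
    using tensor_pairing_h_bilinear[OF \<Delta>hT[of x]] that by (auto simp: bilinear_on_def linear_on_def)
  then show ?thesis
    unfolding bilinear_on_def linear_on_def
    by (intro conjI ballI allI) (auto intro!: B_eqI simp: spec B_closed P_left)
qed

lemma tensor_double_h:
  assumes mh: "binary_operation hscale UNIV mh" and \<Delta>h: "comultiplication_h scale \<Delta>h"
  defines "doth \<equiv> dual_operation_h scale \<Delta>h"
  shows "tensor_double hscale UNIV hdual_scale hdual pairing_h mh doth
    (dual_rep_h scale (mult_right mh)) (dual_rep_h scale (mult_left mh))
    (predual_rep_h scale (mult_right doth)) (predual_rep_h scale (mult_left doth))
    htensors tensor_pairing_h (tmap_h scale) (tflip_h scale) \<Delta>h"
proof -
  interpret paired_modules hscale UNIV hdual_scale hdual pairing_h by (rule paired_modules_h)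
  have \<Delta>hT: "\<Delta>h x \<in> htensors" for x using \<Delta>h by (simp add: comultiplication_h_iff)
  note spec = dual_operation_h_spec[OF \<Delta>h, folded doth_def]
  have bdoth: "binary_operation hdual_scale hdual doth"
    unfolding doth_def by (rule dual_operation_h_bilinear[OF \<Delta>h])
  have lin: "linear_on hscale UNIV hscale UNIV (mult_right mh x)"
    "linear_on hscale UNIV hscale UNIV (mult_left mh x)" for x
    using bilinear_on_left[OF mh, of x] bilinear_on_right[OF mh, of x]
    by (simp_all add: linear_on_def mult_right_def mult_left_def)
  have linB: "linear_on hdual_scale hdual hdual_scale hdual (mult_right doth u)"
    "linear_on hdual_scale hdual hdual_scale hdual (mult_left doth u)" if "u \<in> hdual" for u
    using bilinear_on_left[OF bdoth that] bilinear_on_right[OF bdoth that]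
    by (simp_all add: linear_on_def mult_right_def mult_left_def)
  show ?thesis
  proof (intro tensor_double.intro double.intro paired_modules_h)
    show "double_axioms hscale UNIV hdual_scale hdual pairing_h mh doth
        (dual_rep_h scale (mult_right mh)) (dual_rep_h scale (mult_left mh))
        (predual_rep_h scale (mult_right doth)) (predual_rep_h scale (mult_left doth))"
      unfolding double_axioms_def
      by (auto simp: mh bdoth dual_rep_h_spec[where \<rho>="mult_right mh", OF lin(1)]
          dual_rep_h_spec[where \<rho>="mult_left mh", OF lin(2)]
          predual_rep_h_spec[where \<rho>="mult_right doth", OF linB(1)]
          predual_rep_h_spec[where \<rho>="mult_left doth", OF linB(2)])
        (simp_all add: mult_right_def mult_left_def)
    have eq: "w = w'" if w: "w \<in> htensors" "w' \<in> htensors"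
      and *: "\<And>u v. u \<in> hdual \<Longrightarrow> v \<in> hdual \<Longrightarrow> tensor_pairing_h u v w = tensor_pairing_h u v w'" for w w'
    proof (rule htensor_eqI[OF w])
      have "evt w p q = tensor_pairing_h (fps_const (crd p)) (fps_const (crd q)) w" if "w \<in> htensors" for w p q
      proof (rule fps_ext)
        fix n
        have zero: "tensor_pairing (crd p) 0 (fps_nth w i) = 0" for i
          by (simp add: tensor_pairing_def tensor_expansion[OF htensor_nth[OF that]])
        have "fps_nth (tensor_pairing_h (fps_const (crd p)) (fps_const (crd q)) w) n =
            (\<Sum>j\<le>n. if j = 0 then tcrd (fps_nth w n) p q else 0)"
          unfolding tensor_pairing_h_const[OF crd_dual hdual_const[OF crd_dual] that]
          by (rule sum.cong) (auto simp: zero, simp add: tensor_pairing_def tcrd_def)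
        then show "fps_nth (evt w p q) n =
            fps_nth (tensor_pairing_h (fps_const (crd p)) (fps_const (crd q)) w) n" by simp
      qed
      then show "evt w p q = evt w' p q" for p q
        using w *[OF hdual_const[OF crd_dual] hdual_const[OF crd_dual]] by simp
    qed
    show "tensor_double_axioms hscale UNIV hdual pairing_h doth htensors tensor_pairing_h
        (tmap_h scale) (tflip_h scale) \<Delta>h"
      unfolding tensor_double_axioms_def
      using eq tensor_pairing_tmap_h
      by (auto simp: submodule_add[OF submodule_htensors] submodule_diff[OF submodule_htensors]
          tensor_pairing_h_linear tmap_h_closed tflip_h_closed tensor_pairing_tflip_h \<Delta>hT spec)
  qed
qed

end

section \<open>Coassociativity over power series\<close>

context finite_dimensional_vector_space
begin

lemma comultiplication_coefficient:
  assumes "comultiplication_h scale \<Delta>h"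
  shows "comultiplication scale (\<lambda>x. fps_nth (\<Delta>h (fps_const x)) k)"
proof -
  have "\<Delta>h (fps_const (x + y)) = \<Delta>h (fps_const x) + \<Delta>h (fps_const y)"
    "\<Delta>h (fps_const (scale c x)) = htensor_scale (fps_const c) (\<Delta>h (fps_const x))" for x y c
    using assms
    by (simp_all add: comultiplication_h_iff flip: fps_const_add fps_scale_const_const[OF module_axioms])
  then show ?thesis
    using assms
    by (simp add: comultiplication_iff comultiplication_h_iff fps_space_def
        fps_scale_const[OF module_fun_scale])
qed

lemma dual_operation_h_coefficient:
  assumes \<Delta>h: "comultiplication_h scale \<Delta>h" and a: "a \<in> dual" and b: "b \<in> dual"
  shows "fps_nth (dual_operation_h scale \<Delta>h (fps_const a) (fps_const b)) k =
    dual_operation (\<lambda>x. fps_nth (\<Delta>h (fps_const x)) k) a b"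
proof
  fix x
  note spec = dual_operation_h_spec[OF \<Delta>h hdual_const[OF a] hdual_const[OF b]]
  have T: "\<Delta>h (fps_const x) \<in> htensors" using \<Delta>h by (simp add: comultiplication_h_iff)
  have zero: "tensor_pairing a 0 (fps_nth (\<Delta>h (fps_const x)) i) = 0" for i
    by (simp add: tensor_pairing_def tensor_expansion[OF htensor_nth[OF T]])
  have "fps_nth (dual_operation_h scale \<Delta>h (fps_const a) (fps_const b)) k x =
      fps_nth (tensor_pairing_h (fps_const a) (fps_const b) (\<Delta>h (fps_const x))) k"
    by (simp flip: spec(2) add: pairing_const_right[OF spec(1)])
  also have "\<dots> = (\<Sum>j\<le>k. if j = 0 then tensor_pairing a b (fps_nth (\<Delta>h (fps_const x)) k) else 0)"
    unfolding tensor_pairing_h_const[OF a hdual_const[OF b] T]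
    by (rule sum.cong) (auto simp: zero)
  finally show "fps_nth (dual_operation_h scale \<Delta>h (fps_const a) (fps_const b)) k x =
      dual_operation (\<lambda>x. fps_nth (\<Delta>h (fps_const x)) k) a b x"
    by (simp add: dual_operation_def)
qed

text \<open>
  Reduces triple tensors over \<open>K\<close> to those over the field, one coefficient at a time.
\<close>

lemma id_tens_h_nth:
  assumes "comultiplication_h scale \<Delta>h"
  shows "fps_nth (id_tens_h scale \<Delta>h t) n =
      (\<Sum>i\<le>n. id_tens scale (\<lambda>x. fps_nth (\<Delta>h (fps_const x)) (n - i)) (fps_nth t i))" (is ?id)
    and "fps_nth (tens_id_h scale \<Delta>h t) n =
      (\<Sum>i\<le>n. tens_id scale (\<lambda>x. fps_nth (\<Delta>h (fps_const x)) (n - i)) (fps_nth t i))" (is ?di)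
proof -
  have T: "\<Delta>h x \<in> htensors" for x using assms by (simp add: comultiplication_h_iff)
  show ?id ?di
    unfolding id_tens_h_def tens_id_h_def id_tens_def tens_id_def
    by (subst tlift_h_def, simp add: tlift_h_const[OF T])+
qed

text \<open>
  Coassociativity only sees constant functionals, since these separate each coefficient of a tensor;
  associativity of \<open>(A\<^sup>*)[[h]]\<close> then follows from that on constants by \<open>K\<close>-trilinearity.
\<close>

lemma coassociative_h_iff:
  assumes \<Delta>h: "comultiplication_h scale \<Delta>h"
  defines "doth \<equiv> dual_operation_h scale \<Delta>h"
  shows "(\<forall>x. id_tens_h scale \<Delta>h (\<Delta>h x) = tens_id_h scale \<Delta>h (\<Delta>h x)) \<longleftrightarrow>
    assoc_algebra hdual_scale hdual doth"
proof -
  interpret paired_modules hscale UNIV hdual_scale hdual pairing_h by (rule paired_modules_h)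
  note spec = dual_operation_h_spec[OF \<Delta>h, folded doth_def]
  have bdoth: "binary_operation hdual_scale hdual doth"
    unfolding doth_def by (rule dual_operation_h_bilinear[OF \<Delta>h])
  have T: "\<Delta>h x \<in> htensors" for x using \<Delta>h by (simp add: comultiplication_h_iff)
  let ?\<delta> = "\<lambda>k x. fps_nth (\<Delta>h (fps_const x)) k"
  note \<delta> = comultiplication_coefficient[OF \<Delta>h]
  have doth_nth: "fps_nth (doth (fps_const a) (fps_const b)) k = dual_operation (?\<delta> k) a b"
    if "a \<in> dual" "b \<in> dual" for a b k
    unfolding doth_def by (rule dual_operation_h_coefficient[OF \<Delta>h that])
  have idt: "fps_nth (id_tens_h scale \<Delta>h t) n (tri a b c) =
      fps_nth (tensor_pairing_h (fps_const a) (doth (fps_const b) (fps_const c)) t) n" (is "?id = ?r")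
    and tid: "fps_nth (tens_id_h scale \<Delta>h t) n (tri a b c) =
      fps_nth (tensor_pairing_h (doth (fps_const a) (fps_const b)) (fps_const c) t) n" (is "?di = ?l")
    if "a \<in> dual" "b \<in> dual" "c \<in> dual" "t \<in> htensors" for a b c t n
  proof -
    note h = htensor_nth[OF that(4)]
    have "?id =
        (\<Sum>i\<le>n. tensor_pairing a (dual_operation (?\<delta> (n - i)) b c) (fps_nth t i))"
      using that by (simp add: id_tens_h_nth[OF \<Delta>h] sum_fun_apply id_tens_pairing[OF \<delta> h])
    also have "\<dots> = (\<Sum>i\<le>n. tensor_pairing a (dual_operation (?\<delta> i) b c) (fps_nth t (n - i)))"
      by (rule sum.reindex_bij_witness[of _ "\<lambda>i. n - i" "\<lambda>i. n - i"]) auto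
    finally show "?id = ?r"
      using that by (simp add: tensor_pairing_h_const spec hdual_const doth_nth)
    have "?di =
        (\<Sum>i\<le>n. tensor_pairing (dual_operation (?\<delta> (n - i)) a b) c (fps_nth t i))"
      using that by (simp add: id_tens_h_nth[OF \<Delta>h] sum_fun_apply tens_id_pairing[OF \<delta> h])
    also have "\<dots> = (\<Sum>i\<le>n. tensor_pairing (dual_operation (?\<delta> i) a b) c (fps_nth t (n - i)))"
      by (rule sum.reindex_bij_witness[of _ "\<lambda>i. n - i" "\<lambda>i. n - i"]) auto
    finally show "?di = ?l"
      using that by (simp add: tensor_pairing_h_const2 spec hdual_const doth_nth)
  qed
  have closed3: "fps_nth (id_tens_h scale \<Delta>h t) n \<in> tensor3_space scale"
    "fps_nth (tens_id_h scale \<Delta>h t) n \<in> tensor3_space scale" if "t \<in> htensors" for t n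
    unfolding id_tens_h_nth[OF \<Delta>h]
    by (intro submodule_sum[OF submodule_tensor3_space] id_tens_closed tens_id_closed \<delta> htensor_nth[OF that])+
  have "(\<forall>x. id_tens_h scale \<Delta>h (\<Delta>h x) = tens_id_h scale \<Delta>h (\<Delta>h x)) \<longleftrightarrow>
    (\<forall>a\<in>dual. \<forall>b\<in>dual. \<forall>c\<in>dual.
      doth (doth (fps_const a) (fps_const b)) (fps_const c) =
      doth (fps_const a) (doth (fps_const b) (fps_const c)))" (is "?co \<longleftrightarrow> ?const")
  proof
    assume ?co
    show ?const
    proof (intro ballI B_eqI)
      fix a b c x assume abc: "a \<in> dual" "b \<in> dual" "c \<in> dual"
      show "pairing_h (doth (doth (fps_const a) (fps_const b)) (fps_const c)) x =
          pairing_h (doth (fps_const a) (doth (fps_const b) (fps_const c))) x"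
        using abc \<open>?co\<close> idt[OF abc T[of x]] tid[OF abc T[of x]]
        by (intro fps_ext) (simp add: spec hdual_const)
    qed (simp_all add: spec hdual_const)
  next
    assume ?const
    show ?co
    proof (intro allI fps_ext tensor3_eqI)
      fix x n a b c assume abc: "a \<in> dual" "b \<in> dual" "c \<in> dual"
      have "tensor_pairing_h (fps_const a) (doth (fps_const b) (fps_const c)) (\<Delta>h x) =
          tensor_pairing_h (doth (fps_const a) (fps_const b)) (fps_const c) (\<Delta>h x)"
        using abc \<open>?const\<close> spec(1) by (simp flip: spec(2) add: hdual_const)
      then show "fps_nth (id_tens_h scale \<Delta>h (\<Delta>h x)) n (tri a b c) =
          fps_nth (tens_id_h scale \<Delta>h (\<Delta>h x)) n (tri a b c)"
        by (simp add: idt[OF abc T] tid[OF abc T])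
    qed (simp_all add: closed3 T)
  qed
  also have "\<dots> \<longleftrightarrow> (\<forall>a\<in>hdual. \<forall>b\<in>hdual. \<forall>c\<in>hdual. doth (doth a b) c = doth a (doth b c))"
  proof
    assume const: ?const
    have L: "linear_on hdual_scale hdual hdual_scale hdual (\<lambda>a. doth a b)" if "b \<in> hdual" for b
      by (rule bilinear_on_left[OF bdoth that])
    have R: "linear_on hdual_scale hdual hdual_scale hdual (\<lambda>b. doth a b)" if "a \<in> hdual" for a
      by (rule bilinear_on_right[OF bdoth that])
    note eqI = linear_on_fps_eqI[OF submodule_dual submodule_dual]
    have 1: "doth (doth (fps_const a) (fps_const b)) c = doth (fps_const a) (doth (fps_const b) c)"
      if "a \<in> dual" "b \<in> dual" "c \<in> hdual" for a b c
      by (rule eqI[OF R linear_on_compose[OF R R] _ that(3)]) (use const that spec hdual_const in auto)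
    have 2: "doth (doth (fps_const a) b) c = doth (fps_const a) (doth b c)"
      if "a \<in> dual" "b \<in> hdual" "c \<in> hdual" for a b c
      by (rule eqI[OF linear_on_compose[OF R L] linear_on_compose[OF L R] _ that(2)])
        (use 1 that spec hdual_const in auto)
    have "doth (doth a b) c = doth a (doth b c)"
      if "a \<in> hdual" "b \<in> hdual" "c \<in> hdual" for a b c
      by (rule eqI[OF linear_on_compose[OF L L] L _ that(1)]) (use 2 that spec in auto)
    then show "\<forall>a\<in>hdual. \<forall>b\<in>hdual. \<forall>c\<in>hdual. doth (doth a b) c = doth a (doth b c)" by blast
  qed (simp add: hdual_const)
  finally show ?thesis
    by (simp add: assoc_algebra_def submodule_hdual bdoth)
qed

theorem asi_bialgebra_h_iff:
  assumes mh: "binary_operation hscale UNIV mh" and \<Delta>h: "comultiplication_h scale \<Delta>h"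
  defines "doth \<equiv> dual_operation_h scale \<Delta>h"
  shows "asi_bialgebra_h scale mh \<Delta>h \<longleftrightarrow>
    matched_pair hscale UNIV hdual_scale hdual mh doth
      (dual_rep_h scale (mult_right mh)) (dual_rep_h scale (mult_left mh))
      (predual_rep_h scale (mult_right doth)) (predual_rep_h scale (mult_left doth))"
  unfolding asi_bialgebra_h_def doth_def
    tensor_double.matched_pair_iff_asi[OF tensor_double_h[OF mh \<Delta>h]] coassociative_h_iff[OF \<Delta>h]
  using \<Delta>h by auto

end

section \<open>Power series with coefficients in a direct sum\<close>

lemma fps_join_split [simp]: "fps_join (fps_split f) = f" "fps_split (fps_join p) = p"
  by (auto simp: fps_join_def fps_split_def fps_eq_iff prod_eq_iff)

lemma fps_split_add: "fps_split (f + g) = fps_split f + fps_split g"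
  by (simp add: fps_split_def fps_eq_iff plus_prod_def)

lemma fps_join_add: "fps_join (p + q) = fps_join p + fps_join q"
  by (simp add: fps_join_def fps_eq_iff plus_prod_def)

lemma fps_split_scale:
  "fps_split (fps_scale (sum_scale s t) c f) = sum_scale (fps_scale s) (fps_scale t) c (fps_split f)"
  by (simp add: fps_split_def fps_eq_iff sum_scale_def fps_scale_nth fst_sum snd_sum)

lemma fps_join_scale:
  "fps_join (sum_scale (fps_scale s) (fps_scale t) c p) = fps_scale (sum_scale s t) c (fps_join p)"
  by (metis fps_join_split fps_split_scale)

lemma fps_split_const_pair: "fps_split (fps_const (x, u)) = (fps_const x, fps_const u)"
  by (simp add: fps_split_def fps_eq_iff)

lemma fps_split_space: "fps_split f \<in> fps_space A \<times> fps_space B \<longleftrightarrow> f \<in> fps_space (A \<times> B)"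
  by (auto simp: fps_split_def fps_space_def mem_Times_iff)

lemma fps_join_space: "fps_join p \<in> fps_space (A \<times> B) \<longleftrightarrow> p \<in> fps_space A \<times> fps_space B"
  by (auto simp: fps_join_def fps_space_def mem_Times_iff)

lemma assoc_algebra_fps_join:
  assumes A: "submodule s A" and B: "submodule t B"
    and mu: "assoc_algebra (sum_scale (fps_scale s) (fps_scale t)) (fps_space A \<times> fps_space B) mu"
  shows "assoc_algebra (fps_scale (sum_scale s t)) (fps_space (A \<times> B))
    (\<lambda>f g. fps_join (mu (fps_split f) (fps_split g)))"
proof -
  let ?D = "fps_space A \<times> fps_space B"
  have cl: "mu p q \<in> ?D"
    and addR: "mu p (q + r) = mu p q + mu p r" and addL: "mu (q + r) p = mu q p + mu r p"
    and scR: "mu p (sum_scale (fps_scale s) (fps_scale t) c q) =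
      sum_scale (fps_scale s) (fps_scale t) c (mu p q)"
    and scL: "mu (sum_scale (fps_scale s) (fps_scale t) c q) p =
      sum_scale (fps_scale s) (fps_scale t) c (mu q p)"
    and ass: "mu (mu p q) r = mu p (mu q r)"
    if "p \<in> ?D" "q \<in> ?D" "r \<in> ?D" for p q r c
    using mu that unfolding assoc_algebra_def bilinear_on_def linear_on_def by blast+
  show ?thesis
    unfolding assoc_algebra_def bilinear_on_def linear_on_def
    by (intro conjI ballI allI submodule_fps_space[OF submodule_sum_scale[OF A B]])
      (simp_all only: fps_join_space fps_join_split fps_split_add fps_split_scale
        fps_split_space[symmetric] cl addR addL scR scL ass fps_join_add fps_join_scale)
qed

section \<open>Deformations of bialgebras and of matched pairs\<close>

locale bialgebra_data = finite_dimensional_vector_space scale Basis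
  for scale :: "'k::field \<Rightarrow> 'a::ab_group_add \<Rightarrow> 'a" and Basis :: "'a set" +
  fixes m :: "'a \<Rightarrow> 'a \<Rightarrow> 'a" and \<Delta> :: "'a \<Rightarrow> ('a, 'k) tensor2"
    and mh :: "'a fps \<Rightarrow> 'a fps \<Rightarrow> 'a fps" and \<Delta>h :: "'a fps \<Rightarrow> ('a, 'k) tensor2 fps"
  assumes m: "binary_operation scale UNIV m" and \<Delta>: "comultiplication scale \<Delta>"
    and mh: "binary_operation hscale UNIV mh" and \<Delta>h: "comultiplication_h scale \<Delta>h"
begin

abbreviation "dot \<equiv> dual_operation \<Delta>"
abbreviation "doth \<equiv> dual_operation_h scale \<Delta>h"
abbreviation "RA \<equiv> dual_rep (mult_right m)"
abbreviation "RB \<equiv> predual_rep scale (mult_right dot)"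
abbreviation "lAh \<equiv> dual_rep_h scale (mult_right mh)"
abbreviation "rAh \<equiv> dual_rep_h scale (mult_left mh)"
abbreviation "lBh \<equiv> predual_rep_h scale (mult_right doth)"
abbreviation "rBh \<equiv> predual_rep_h scale (mult_left doth)"
abbreviation "adA br \<equiv> (\<lambda>x u. - dual_rep (ad br) x u)"
abbreviation "adB dbr \<equiv> (\<lambda>u x. - predual_rep scale (ad dbr) u x)"
abbreviation "pair0 \<equiv> bowtie m dot RA RA RB RB"
abbreviation "pairh \<equiv> bowtie mh doth lAh rAh lBh rBh"
abbreviation "joinh \<equiv> \<lambda>f g. fps_join (pairh (fps_split f) (fps_split g))"
abbreviation c where "c \<equiv> fps_const"

sublocale K: tensor_double hscale UNIV hdual_scale hdual pairing_h mh doth lAh rAh lBh rBh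
  htensors tensor_pairing_h "tmap_h scale" "tflip_h scale" \<Delta>h
  by (rule tensor_double_h[OF mh \<Delta>h])

lemma \<Delta>hT: "\<Delta>h x \<in> htensors"
  using \<Delta>h by (simp add: comultiplication_h_iff)

lemma doth_nth:
  "a \<in> dual \<Longrightarrow> b \<in> dual \<Longrightarrow> fps_nth (doth (c a) (c b)) n x = tensor_pairing a b (fps_nth (\<Delta>h (c x)) n)"
  by (simp add: dual_operation_h_coefficient[OF \<Delta>h] dual_operation_def)

lemma action_A_nth:
  assumes "u \<in> dual"
  shows "fps_nth (lAh (c x) (c u)) n y = u (fps_nth (mh (c y) (c x)) n)" (is ?l)
    and "fps_nth (rAh (c x) (c u)) n y = u (fps_nth (mh (c x) (c y)) n)" (is ?r)
proof -
  note u = hdual_const[OF assms]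
  have "ev (lAh (c x) (c u)) y = pairing_h (c u) (mh (c y) (c x))"
    and "ev (rAh (c x) (c u)) y = pairing_h (c u) (mh (c x) (c y))"
    using K.lA_adjoint[OF UNIV_I u UNIV_I, of "c x" "c y"] K.rA_adjoint[OF UNIV_I u UNIV_I, of "c x" "c y"]
    by (simp_all add: pairing_const_right K.lA_closed K.rA_closed u)
  then show ?l ?r
    by (metis ev_nth pairing_const_left)+
qed

lemma action_B_nth:
  assumes "u \<in> dual" "v \<in> dual"
  shows "v (fps_nth (lBh (c u) (c x)) n) = fps_nth (doth (c v) (c u)) n x" (is ?l)
    and "v (fps_nth (rBh (c u) (c x)) n) = fps_nth (doth (c u) (c v)) n x" (is ?r)
proof -
  note uv = hdual_const[OF assms(1)] hdual_const[OF assms(2)]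
  have "pairing_h (c v) (lBh (c u) (c x)) = ev (doth (c v) (c u)) x"
    and "pairing_h (c v) (rBh (c u) (c x)) = ev (doth (c u) (c v)) x"
    using K.lB_adjoint[OF uv, of "c x"] K.rB_adjoint[OF uv, of "c x"]
    by (simp_all add: pairing_const_right K.mB_simps(1) uv)
  then show ?l ?r
    by (metis ev_nth pairing_const_left)+
qed

lemma joinh_const: "joinh (c (x, u)) (c (y, v)) = fps_join (pairh (c x, c u) (c y, c v))"
  by (simp add: fps_split_const_pair)

lemma joinh_nth:
  "fps_nth (joinh (c (x, u)) (c (y, v))) n =
    (fps_nth (mh (c x) (c y)) n + fps_nth (lBh (c u) (c y)) n + fps_nth (rBh (c v) (c x)) n,
     fps_nth (lAh (c x) (c v)) n + fps_nth (rAh (c y) (c u)) n + fps_nth (doth (c u) (c v)) n)"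
  unfolding joinh_const by (simp add: bowtie_def fps_join_def)

lemma submodule_double: "submodule (sum_scale scale fun_scale) (UNIV \<times> dual)"
  by (rule submodule_sum_scale[OF submodule_UNIV[OF module_axioms] submodule_dual])

lemma joinh_closed: "p \<in> UNIV \<times> dual \<Longrightarrow> q \<in> UNIV \<times> dual \<Longrightarrow> joinh (c p) (c q) \<in> fps_space (UNIV \<times> dual)"
  unfolding fps_join_space
  by (auto simp: fps_split_const_pair bowtie_def hdual_const K.closed)

text \<open>
  The actions in a matched pair are transposes of its two multiplications, so their constant terms are
  determined by those of the multiplications.
\<close>

lemma constant_terms_iff:
  assumes comm: "comm_matched_pair scale UNIV fun_scale dual m dot RA RB"
  shows "(\<forall>p\<in>UNIV \<times> dual. \<forall>q\<in>UNIV \<times> dual. fps_nth (joinh (c p) (c q)) 0 = pair0 p q) \<longleftrightarrow>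
    (\<forall>x y. fps_nth (mh (c x) (c y)) 0 = m x y) \<and> (\<forall>x. fps_nth (\<Delta>h (c x)) 0 = \<Delta> x)"
    (is "?L \<longleftrightarrow> ?M \<and> ?D")
proof -
  have cm: "commutative_on UNIV m" "commutative_on dual dot"
    using comm by (auto simp: comm_matched_pair_def)
  interpret F: tensor_double scale UNIV fun_scale dual "\<lambda>u x. u x" m dot RA RA RB RB
    "tensors" tensor_pairing "tmap scale" "tflip scale" \<Delta>
    by (rule comm_tensor_double_dual[OF m \<Delta> cm])
  have D_iff: "?D \<longleftrightarrow> (\<forall>a\<in>dual. \<forall>b\<in>dual. fps_nth (doth (c a) (c b)) 0 = dot a b)"
  proof
    assume ?D then show "\<forall>a\<in>dual. \<forall>b\<in>dual. fps_nth (doth (c a) (c b)) 0 = dot a b"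
      by (auto simp: doth_nth dual_operation_def intro!: ext)
  next
    assume "\<forall>a\<in>dual. \<forall>b\<in>dual. fps_nth (doth (c a) (c b)) 0 = dot a b"
    then have "tensor_pairing a b (fps_nth (\<Delta>h (c x)) 0) = tensor_pairing a b (\<Delta> x)"
      if "a \<in> dual" "b \<in> dual" for a b x
      using that by (metis doth_nth dual_operation_apply)
    then show ?D
      using \<Delta> by (intro allI tensor_eqI htensor_nth[OF \<Delta>hT]) (auto simp: comultiplication_iff)
  qed
  show ?thesis
  proof
    assume L: ?L
    have "fps_nth (mh (c x) (c y)) 0 = m x y" for x y
    proof -
      have "fst (fps_nth (joinh (c (x, 0)) (c (y, 0))) 0) = fst (pair0 (x, 0) (y, 0))"
        using L F.B_closed(1) by (metis SigmaI UNIV_I)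
      then show ?thesis
        unfolding joinh_nth by (simp add: F.pure_prod K.action_zero)
    qed
    moreover have "fps_nth (doth (c a) (c b)) 0 = dot a b" if "a \<in> dual" "b \<in> dual" for a b
    proof -
      have "snd (fps_nth (joinh (c (0, a)) (c (0, b))) 0) = snd (pair0 (0, a) (0, b))"
        using L that by (metis SigmaI UNIV_I)
      then show ?thesis
        using that unfolding joinh_nth by (simp add: F.pure_prod K.action_zero hdual_const)
    qed
    ultimately show "?M \<and> ?D" using D_iff by blast
  next
    assume MD: "?M \<and> ?D"
    have M: "fps_nth (mh (c x) (c y)) 0 = m x y" for x y using MD by blast
    have dot0: "fps_nth (doth (c a) (c b)) 0 = dot a b" if "a \<in> dual" "b \<in> dual" for a b
      using MD D_iff that by blast
    have "fps_nth (lAh (c x) (c u)) 0 = RA x u" "fps_nth (rAh (c x) (c u)) 0 = RA x u" if "u \<in> dual" for x u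
      using that cm(1)
      by (simp_all add: fun_eq_iff action_A_nth M dual_rep_def mult_right_def commutative_on_def)
    moreover have "fps_nth (lBh (c u) (c x)) 0 = RB u x" "fps_nth (rBh (c u) (c x)) 0 = RB u x"
      if "u \<in> dual" for x u
      using that cm(2)
      by (auto intro!: eq_by_dual simp: action_B_nth dot0 F.adjoint commutative_on_def)
    ultimately show ?L
      by (auto simp: joinh_nth M dot0) (simp_all add: bowtie_def)
  qed
qed

lemma asi_deformation_iff:
  assumes comm: "comm_matched_pair scale UNIV fun_scale dual m dot RA RB"
  shows "asi_deformation scale m \<Delta> mh \<Delta>h \<longleftrightarrow>
    matched_pair_deformation scale UNIV fun_scale dual m dot RA RA RB RB mh doth lAh rAh lBh rBh"
proof -
  have cc: "cc_asi_bialgebra scale m \<Delta>" using comm cc_asi_bialgebra_iff[OF m \<Delta>] by blast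
  have mp: "matched_pair scale UNIV fun_scale dual m dot RA RA RB RB"
    using comm by (simp add: comm_matched_pair_def)
  then have as: "assoc_algebra (sum_scale scale fun_scale) (UNIV \<times> dual) pair0"
    by (simp add: matched_pair_def)
  have U: "submodule scale UNIV" by (rule submodule_UNIV[OF module_axioms])
  have \<Delta>T: "\<Delta> x \<in> tensors" for x using \<Delta> by (simp add: comultiplication_iff)
  have pair0_closed: "pair0 p q \<in> UNIV \<times> dual" if "p \<in> UNIV \<times> dual" "q \<in> UNIV \<times> dual" for p q
    using as that unfolding assoc_algebra_def bilinear_on_def linear_on_def by blast
  have c1: "cong_h scale UNIV (mh (c x) (c y)) (c (m x y)) \<longleftrightarrow> fps_nth (mh (c x) (c y)) 0 = m x y" for x y
    by (simp add: cong_h_iff[OF U])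
  have c2: "cong_h fun_scale (tensors) (\<Delta>h (c x)) (c (\<Delta> x)) \<longleftrightarrow>
      fps_nth (\<Delta>h (c x)) 0 = \<Delta> x" for x
    by (simp add: cong_h_iff[OF submodule_tensor_space \<Delta>hT
          fps_const_in_fps_space[OF submodule_tensor_space \<Delta>T]])
  have c3: "cong_h (sum_scale scale fun_scale) (UNIV \<times> dual) (joinh (c p) (c q)) (c (pair0 p q)) \<longleftrightarrow>
      fps_nth (joinh (c p) (c q)) 0 = pair0 p q" if "p \<in> UNIV \<times> dual" "q \<in> UNIV \<times> dual" for p q
    using cong_h_iff[OF submodule_double joinh_closed[OF that]
        fps_const_in_fps_space[OF submodule_double pair0_closed[OF that]]] by simp
  have "assoc_deformation (sum_scale scale fun_scale) (UNIV \<times> dual) pair0 joinh \<longleftrightarrow>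
      (\<forall>p\<in>UNIV \<times> dual. \<forall>q\<in>UNIV \<times> dual. fps_nth (joinh (c p) (c q)) 0 = pair0 p q)"
    if "matched_pair hscale UNIV hdual_scale hdual mh doth lAh rAh lBh rBh"
    using that as c3 assoc_algebra_fps_join[OF U submodule_dual, of pairh]
    unfolding assoc_deformation_def matched_pair_def fps_space_UNIV by blast
  then show ?thesis
    using cc mp
    unfolding asi_deformation_def matched_pair_deformation_def asi_bialgebra_h_iff[OF mh \<Delta>h]
      c1 c2 cc_asi_bialgebra_def constant_terms_iff[OF comm] fps_space_UNIV by blast
qed

end

section \<open>The quasi-classical limit of the double\<close>

locale deformed_double = bialgebra_data scale Basis m \<Delta> mh \<Delta>h
  for scale :: "'k::field \<Rightarrow> 'a::ab_group_add \<Rightarrow> 'a" and Basis m \<Delta> mh \<Delta>h +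
  fixes br :: "'a \<Rightarrow> 'a \<Rightarrow> 'a" and dbr :: "('a \<Rightarrow> 'k) \<Rightarrow> ('a \<Rightarrow> 'k) \<Rightarrow> 'a \<Rightarrow> 'k"
  assumes comm: "comm_matched_pair scale UNIV fun_scale dual m dot RA RB"
    and def: "asi_deformation scale m \<Delta> mh \<Delta>h"
    and br: "qcl_bracket scale UNIV mh br"
    and dbr: "qcl_bracket fun_scale dual doth dbr"
begin

lemma comm_m: "commutative_on UNIV m" and comm_dot: "commutative_on dual dot"
  using comm by (auto simp: comm_matched_pair_def)

lemma cc: "cc_asi_bialgebra scale m \<Delta>"
  using comm cc_asi_bialgebra_iff[OF m \<Delta>] by blast

lemma matched_def:
  "matched_pair_deformation scale UNIV fun_scale dual m dot RA RA RB RB mh doth lAh rAh lBh rBh"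
  using def asi_deformation_iff[OF comm] by blast

sublocale F: tensor_double scale UNIV fun_scale dual "\<lambda>u x. u x" m dot RA RA RB RB
  "tensors" tensor_pairing "tmap scale" "tflip scale" \<Delta>
  by (rule comm_tensor_double_dual[OF m \<Delta> comm_m comm_dot])

lemma mh0: "fps_nth (mh (c x) (c y)) 0 = m x y"
  using def cong_h_iff[OF F.subA] by (simp add: asi_deformation_def)

lemma doth0: "fps_nth (doth (c a) (c b)) 0 = dot a b" if "a \<in> dual" "b \<in> dual"
proof -
  have "fps_nth (\<Delta>h (c x)) 0 = \<Delta> x" for x
    using def cong_h_iff[OF submodule_tensor_space \<Delta>hT
        fps_const_in_fps_space[OF submodule_tensor_space F.\<Delta>_closed]]
    by (simp add: asi_deformation_def)
  then show ?thesis using that by (auto simp: doth_nth dual_operation_def intro!: ext)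
qed

lemma br_nth: "br x y = fps_nth (mh (c x) (c y)) 1 - fps_nth (mh (c y) (c x)) 1"
  using br by (simp add: qcl_bracket_def quot_cong_h_iff[OF F.subA])

lemma dbr_nth: "dbr a b = fps_nth (doth (c a) (c b)) 1 - fps_nth (doth (c b) (c a)) 1"
  and dbr_closed: "dbr a b \<in> dual" if "a \<in> dual" "b \<in> dual"
  using dbr that by (simp_all add: qcl_bracket_def quot_cong_h_iff[OF F.subB])

lemma assoc_qcl_A: "assoc_qcl scale UNIV mh br m"
  using comm_m br def
  by (simp add: assoc_qcl_def assoc_deformation_def asi_deformation_def asi_bialgebra_def
      asi_bialgebra_h_def)

lemma assoc_qcl_B: "assoc_qcl fun_scale dual doth dbr dot"
proof -
  have "cong_h fun_scale dual (doth (c a) (c b)) (c (dot a b))" if "a \<in> dual" "b \<in> dual" for a b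
    using that
    by (subst cong_h_iff[OF F.subB]) (simp_all add: hdual_const K.closed F.closed doth0)
  then show ?thesis
    using comm_dot dbr matched_def
    by (simp add: assoc_qcl_def assoc_deformation_def matched_pair_deformation_def matched_pair_def)
qed

lemmas poisson_A = poisson_algebra_of_assoc_qcl[OF assoc_qcl_A]
lemmas poisson_B = poisson_algebra_of_assoc_qcl[OF assoc_qcl_B]

lemma br_bilinear: "binary_operation scale UNIV br" and dbr_bilinear: "binary_operation fun_scale dual dbr"
  using poisson_A poisson_B by (auto simp: poisson_algebra_def lie_algebra_def)

lemma br_antisym: "br x y = - br y x"
  by (simp add: br_nth)

lemma dbr_antisym: "a \<in> dual \<Longrightarrow> b \<in> dual \<Longrightarrow> dbr a b = - dbr b a"
  by (simp add: dbr_nth)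

text \<open>
  The brackets of \<open>A\<close> and \<open>A\<^sup>*\<close> form a double of their own; by antisymmetry its actions \<open>R\<^sup>*\<close> and
  \<open>L\<^sup>*\<close> are \<open>- ad\<^sup>*\<close> and \<open>ad\<^sup>*\<close>.
\<close>

sublocale L: double scale UNIV fun_scale dual "\<lambda>u x. u x" br dbr
  "adA br" "\<lambda>x u. - adA br x u" "adB dbr" "\<lambda>u x. - adB dbr u x"
proof (intro double.intro F.paired_modules_axioms)
  have 1: "adA br x u y = u (br y x)" and 2: "adA br x u \<in> dual" if "u \<in> dual" for x u y
  proof -
    show adj: "adA br x u y = u (br y x)" for x y
      using F.P_right(4)[OF that] br_antisym[of x y]
      by (simp add: dual_rep_def mult_left_def)
    have "br (y + z) x = br y x + br z x" "br (scale k y) x = scale k (br y x)" for y z k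
      using bilinear_on_left[OF br_bilinear, of x] by (simp_all add: linear_on_def)
    then show "adA br x u \<in> dual"
      using F.P_right(1,2)[OF that] by (subst dual_iff) (simp only: adj UNIV_I simp_thms)
  qed
  have 3: "v (predual_rep scale (ad dbr) u x) = dbr u v x" if "u \<in> dual" "v \<in> dual" for u v x
    using dbr_bilinear that
    by (subst predual_rep_adjoint; simp add: bilinear_on_def linear_on_def mult_left_def)
  show "double_axioms scale UNIV fun_scale dual (\<lambda>u x. u x) br dbr
      (adA br) (\<lambda>x u. - adA br x u) (adB dbr) (\<lambda>u x. - adB dbr u x)"
    unfolding double_axioms_def
  proof (intro conjI allI impI br_bilinear dbr_bilinear)
    fix x u v y assume u: "u \<in> dual"
    show "adA br x u \<in> dual" by (rule 2[OF u])
    then show "- adA br x u \<in> dual" by (rule F.B_closed(4))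
    show "adA br x u y = u (br y x)" by (rule 1[OF u])
    show "(- adA br x u) y = u (br x y)" by (simp add: dual_rep_def mult_left_def)
    assume v: "v \<in> dual"
    show "v (adB dbr u x) = dbr v u x" "v (- adB dbr u x) = dbr u v x"
      using F.P_right(4)[OF v] 3[OF u v] dbr_antisym[OF v u] by simp_all
  qed simp_all
qed

text \<open>
  The coefficient of \<open>h\<close> in \<open>R\<^sup>* - L\<^sup>*\<close> is the transpose of minus the commutator, that is \<open>- ad\<^sup>*\<close>.
\<close>

lemma action_A_quot: "quot_cong_h fun_scale dual (lAh (c x) (c u) - rAh (c x) (c u)) (adA br x u)"
  if "u \<in> dual"
proof -
  have u: "u (x - y) = u x - u y" for x y using F.P_right(5)[OF that] by simp
  have "lAh (c x) (c u) - rAh (c x) (c u) \<in> hdual"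
    by (simp add: K.closed hdual_const that)
  moreover have "fps_nth (lAh (c x) (c u) - rAh (c x) (c u)) 0 = 0"
    using comm_m by (simp add: fun_eq_iff action_A_nth that mh0 commutative_on_def)
  moreover have "fps_nth (lAh (c x) (c u) - rAh (c x) (c u)) 1 = adA br x u"
    using L.lA_adjoint[of x u] that
    by (auto simp: fun_eq_iff action_A_nth br_nth u simp del: fun_Compl_def)
  ultimately show ?thesis
    by (simp add: quot_cong_h_iff[OF F.subB] L.lA_closed that)
qed

lemma action_B_quot: "quot_cong_h scale UNIV (lBh (c u) (c x) - rBh (c u) (c x)) (adB dbr u x)"
  if "u \<in> dual"
proof -
  have "fps_nth (lBh (c u) (c x) - rBh (c u) (c x)) 0 = 0"
    by (rule F.A_eqI)
      (use that comm_dot in \<open>simp_all add: F.P_right action_B_nth doth0 commutative_on_def\<close>)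
  moreover have "fps_nth (lBh (c u) (c x) - rBh (c u) (c x)) 1 = adB dbr u x"
  proof (rule F.A_eqI)
    show "v (fps_nth (lBh (c u) (c x) - rBh (c u) (c x)) 1) = v (adB dbr u x)" if v: "v \<in> dual" for v
      using L.lB_adjoint[OF \<open>u \<in> dual\<close> v UNIV_I, of x] \<open>u \<in> dual\<close> v
      by (simp add: F.P_right(5) action_B_nth dbr_nth)
  qed simp_all
  ultimately show ?thesis
    by (simp add: quot_cong_h_iff[OF F.subA])
qed

abbreviation "pair1 \<equiv> bowtie br dbr (adA br) (\<lambda>x u. - adA br x u) (adB dbr) (\<lambda>u x. - adB dbr u x)"

text \<open>
  Collecting the coefficients of \<open>h\<close> in the commutator of the deformed double gives the bracket of the
  double of brackets; the Poisson identities on \<open>A \<oplus> A\<^sup>*\<close> then hold because the former is a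
  quasi-classical limit.
\<close>

lemma assoc_qcl_double: "assoc_qcl (sum_scale scale fun_scale) (UNIV \<times> dual) joinh pair1 pair0"
proof -
  have "commutative_on (UNIV \<times> dual) pair0"
    and "assoc_deformation (sum_scale scale fun_scale) (UNIV \<times> dual) pair0 joinh"
    using comm matched_def by (auto simp: comm_matched_pair_def matched_pair_deformation_def)
  moreover have "qcl_bracket (sum_scale scale fun_scale) (UNIV \<times> dual) joinh pair1"
    unfolding qcl_bracket_def
  proof (intro ballI)
    fix p q :: "'a \<times> ('a \<Rightarrow> 'k)" assume pq: "p \<in> UNIV \<times> dual" "q \<in> UNIV \<times> dual"
    obtain x u y v where p: "p = (x, u)" and q: "q = (y, v)" by (metis surj_pair)
    have uv: "u \<in> dual" "v \<in> dual" using pq p q by auto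
    note qA = action_A_quot[unfolded quot_cong_h_iff[OF F.subB]]
    note qB = action_B_quot[unfolded quot_cong_h_iff[OF F.subA]]
    have A0: "fps_nth (lAh (c x) (c u)) 0 = fps_nth (rAh (c x) (c u)) 0"
      and A1: "fps_nth (lAh (c x) (c u)) 1 = fps_nth (rAh (c x) (c u)) 1 + adA br x u" if "u \<in> dual" for x u
      using qA[OF that, of x] by (auto simp: algebra_simps)
    have B0: "fps_nth (lBh (c u) (c x)) 0 = fps_nth (rBh (c u) (c x)) 0"
      and B1: "fps_nth (lBh (c u) (c x)) 1 = fps_nth (rBh (c u) (c x)) 1 + adB dbr u x" if "u \<in> dual" for x u
      using qB[OF that, of x] by (auto simp: algebra_simps)
    have "joinh (c p) (c q) - joinh (c q) (c p) \<in> fps_space (UNIV \<times> dual)"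
      using submodule_diff[OF submodule_fps_space[OF submodule_double]] joinh_closed pq by blast
    moreover have "fps_nth (joinh (c p) (c q) - joinh (c q) (c p)) 0 = 0"
      using comm_m comm_dot uv
      unfolding p q fps_sub_nth joinh_nth
      by (simp add: A0 B0 mh0 doth0 commutative_on_def zero_prod_def)
    moreover have "fps_nth (joinh (c p) (c q) - joinh (c q) (c p)) 1 = pair1 p q"
      using uv unfolding p q fps_sub_nth joinh_nth
      by (simp add: A1[unfolded One_nat_def] B1[unfolded One_nat_def] br_nth dbr_nth bowtie_def)
    moreover have "pair1 p q \<in> UNIV \<times> dual" by (rule L.prod_closed[OF pq])
    ultimately show "quot_cong_h (sum_scale scale fun_scale) (UNIV \<times> dual)
        (joinh (c p) (c q) - joinh (c q) (c p)) (pair1 p q)"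
      unfolding quot_cong_h_iff[OF submodule_double] by blast
  qed
  ultimately show ?thesis by (simp add: assoc_qcl_def)
qed

theorem poisson_matched:
  "poisson_matched_pair scale UNIV fun_scale dual br m dbr dot (adA br) RA (adB dbr) RB"
  unfolding poisson_matched_pair_def
  using poisson_A poisson_B L.lA_bilinear L.lB_bilinear F.lA_bilinear F.lB_bilinear
    poisson_algebra_of_assoc_qcl[OF assoc_qcl_double] by blast

theorem matched_qcl:
  "matched_pair_qcl scale UNIV fun_scale dual mh doth lAh rAh lBh rBh
    br m dbr dot (adA br) RA (adB dbr) RB"
  unfolding matched_pair_qcl_def
  using comm matched_def assoc_qcl_A assoc_qcl_B action_A_quot action_B_quot by blast

text \<open>
  Pairs of functionals separate tensors, so a quasi-classical cobracket is known from its dual operation,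
  and pairing turns the flip into an exchange of the two functionals: what results is the commutator of
  the dual multiplication.
\<close>

lemma cobracket_quot_iff:
  assumes "comultiplication scale \<delta>"
  shows "(\<forall>x. quot_cong_h fun_scale (tensors) (\<Delta>h (c x) - tflip_h scale (\<Delta>h (c x))) (\<delta> x)) \<longleftrightarrow>
    (\<forall>a\<in>dual. \<forall>b\<in>dual. dual_operation \<delta> a b = dbr a b)"
proof -
  have \<delta>T: "\<delta> x \<in> tensors" for x using assms by (simp add: comultiplication_iff)
  have T: "\<Delta>h (c x) - tflip_h scale (\<Delta>h (c x)) \<in> htensors" for x
    using submodule_diff[OF submodule_htensors] \<Delta>hT tflip_h_closed by blast
  have pair: "tensor_pairing a b (fps_nth (\<Delta>h (c x) - tflip_h scale (\<Delta>h (c x))) n) =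
      fps_nth (doth (c a) (c b)) n x - fps_nth (doth (c b) (c a)) n x" if "a \<in> dual" "b \<in> dual" for a b x n
    using that by (simp add: tensor_pairing_linear tflip_h_nth \<Delta>hT tensor_pairing_tflip doth_nth)
  have zero: "fps_nth (\<Delta>h (c x) - tflip_h scale (\<Delta>h (c x))) 0 = 0" for x
    by (rule tensor_eqI[OF htensor_nth[OF T] submodule_zero[OF submodule_tensor_space]])
      (use comm_dot in \<open>simp only: pair doth0 tensor_pairing_linear(5), simp add: commutative_on_def\<close>)
  have "fps_nth (\<Delta>h (c x) - tflip_h scale (\<Delta>h (c x))) 1 = \<delta> x \<longleftrightarrow>
      (\<forall>a\<in>dual. \<forall>b\<in>dual. dbr a b x = dual_operation \<delta> a b x)" for x
  proof
    assume "fps_nth (\<Delta>h (c x) - tflip_h scale (\<Delta>h (c x))) 1 = \<delta> x"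
    then show "\<forall>a\<in>dual. \<forall>b\<in>dual. dbr a b x = dual_operation \<delta> a b x"
      using pair[of _ _ x 1] by (simp add: dbr_nth dual_operation_apply)
  next
    assume "\<forall>a\<in>dual. \<forall>b\<in>dual. dbr a b x = dual_operation \<delta> a b x"
    then show "fps_nth (\<Delta>h (c x) - tflip_h scale (\<Delta>h (c x))) 1 = \<delta> x"
      by (intro tensor_eqI[OF htensor_nth[OF T] \<delta>T])
        (simp only: pair, simp add: dbr_nth dual_operation_apply)
  qed
  moreover have "quot_cong_h fun_scale (tensors) (\<Delta>h (c x) - tflip_h scale (\<Delta>h (c x))) (\<delta> x) \<longleftrightarrow>
      fps_nth (\<Delta>h (c x) - tflip_h scale (\<Delta>h (c x))) 1 = \<delta> x" for x
    by (simp only: quot_cong_h_iff[OF submodule_tensor_space] \<delta>T T zero simp_thms)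
  ultimately show ?thesis
    by (simp only: fun_eq_iff[of "dual_operation \<delta> _ _"]) metis
qed

theorem bialgebra_qcl:
  assumes \<delta>: "comultiplication scale \<delta>" and dual: "\<forall>a\<in>dual. \<forall>b\<in>dual. dual_operation \<delta> a b = dbr a b"
  shows "poisson_bialgebra scale br m \<delta> \<Delta>" and "asi_qcl scale mh \<Delta>h br m \<delta> \<Delta>"
proof -
  show "poisson_bialgebra scale br m \<delta> \<Delta>"
    by (rule poisson_bialgebra_of_matched_pair[OF poisson_matched cc \<delta> dual])
  show "asi_qcl scale mh \<Delta>h br m \<delta> \<Delta>"
    using cc def br cobracket_quot_iff[OF \<delta>] dual by (simp add: asi_qcl_def)
qed

end

section \<open>The correspondence\<close>

context bialgebra_data
begin

text \<open>
  Linearity comes for free: \<open>\<delta>\<close> is the antisymmetrised coefficient of \<open>h\<close> in \<open>\<Delta>h\<close>.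
\<close>

lemma cobracket_of_asi_qcl:
  assumes cc: "cc_asi_bialgebra scale m \<Delta>" and q: "asi_qcl scale mh \<Delta>h br m \<delta> \<Delta>"
  shows "comultiplication scale \<delta>" and "qcl_bracket fun_scale dual doth (dual_operation \<delta>)"
proof -
  let ?D = "\<lambda>x. fps_nth (\<Delta>h (c x)) 1"
  have D: "comultiplication scale ?D" by (rule comultiplication_coefficient[OF \<Delta>h])
  have "quot_cong_h fun_scale (tensors) (\<Delta>h (c x) - tflip_h scale (\<Delta>h (c x))) (\<delta> x)" for x
    using q by (simp add: asi_qcl_def)
  then have \<delta>: "\<delta> x \<in> tensors" "\<delta> x = ?D x - tflip scale (?D x)"
    and zero: "fps_nth (\<Delta>h (c x)) 0 = tflip scale (fps_nth (\<Delta>h (c x)) 0)" for x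
    by (simp_all add: quot_cong_h_iff[OF submodule_tensor_space] tflip_h_nth \<Delta>hT)
  have "tflip scale (t + t') = tflip scale t + tflip scale t'"
    "tflip scale (fun_scale k t) = fun_scale k (tflip scale t)" for t t' k
    by (simp_all add: tflip_def tlift_def fun_eq_iff)
  then show \<delta>_comult: "comultiplication scale \<delta>"
    using D \<delta>(1) unfolding comultiplication_iff \<delta>(2)
    by (auto simp: module.scale_right_diff_distrib[OF module_fun_scale])
  show "qcl_bracket fun_scale dual doth (dual_operation \<delta>)"
    unfolding qcl_bracket_def quot_cong_h_iff[OF submodule_dual]
  proof (intro ballI conjI)
    fix a b assume ab: "a \<in> dual" "b \<in> dual"
    show "dual_operation \<delta> a b \<in> dual" by (rule dual_operation_closed[OF \<delta>_comult])
    show "doth (c a) (c b) - doth (c b) (c a) \<in> hdual"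
      using ab by (simp add: K.closed hdual_const)
    have "tensor_pairing a b (fps_nth (\<Delta>h (c x)) 0) = tensor_pairing b a (fps_nth (\<Delta>h (c x)) 0)" for x
      by (subst zero) (rule tensor_pairing_tflip[OF ab])
    then show "fps_nth (doth (c a) (c b) - doth (c b) (c a)) 0 = 0"
      using ab by (simp add: fun_eq_iff doth_nth)
    show "fps_nth (doth (c a) (c b) - doth (c b) (c a)) 1 = dual_operation \<delta> a b"
      using ab
      by (auto simp: fun_eq_iff doth_nth dual_operation_apply \<delta>(2) tensor_pairing_linear
          tensor_pairing_tflip)
  qed
qed

end

theorem theorem3p14:
  fixes s :: "'k::field_char_0 \<Rightarrow> 'a::ab_group_add \<Rightarrow> 'a"
    and basis :: "'a set"
    and m :: "'a \<Rightarrow> 'a \<Rightarrow> 'a"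
    and \<Delta> :: "'a \<Rightarrow> ('a, 'k) tensor2"
    and mh :: "'a fps \<Rightarrow> 'a fps \<Rightarrow> 'a fps"
    and \<Delta>h :: "'a fps \<Rightarrow> ('a, 'k) tensor2 fps"
    and dot :: "('a \<Rightarrow> 'k) \<Rightarrow> ('a \<Rightarrow> 'k) \<Rightarrow> ('a \<Rightarrow> 'k)"
    and doth :: "('a \<Rightarrow> 'k) fps \<Rightarrow> ('a \<Rightarrow> 'k) fps \<Rightarrow> ('a \<Rightarrow> 'k) fps"
  assumes "finite_dimensional_vector_space s basis"
    and "binary_operation s UNIV m"
    and "comultiplication s \<Delta>"
    and "binary_operation (fps_scale s) (fps_space UNIV) mh"
    and "comultiplication_h s \<Delta>h"
    and dot: "dot = dual_operation \<Delta>"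
    and doth: "doth = dual_operation_h s \<Delta>h"
  shows
    "(\<forall>br \<delta>.
        cc_asi_bialgebra s m \<Delta> \<and>
        asi_deformation s m \<Delta> mh \<Delta>h \<and>
        asi_qcl s mh \<Delta>h br m \<delta> \<Delta> \<longrightarrow>
        comm_matched_pair s UNIV fun_scale (dual_space s) m dot
          (dual_rep (mult_right m)) (predual_rep s (mult_right dot)) \<and>
        matched_pair_deformation s UNIV fun_scale (dual_space s) m dot
          (dual_rep (mult_right m)) (dual_rep (mult_right m))
          (predual_rep s (mult_right dot)) (predual_rep s (mult_right dot))
          mh doth
          (dual_rep_h s (mult_right mh)) (dual_rep_h s (mult_left mh))
          (predual_rep_h s (mult_right doth)) (predual_rep_h s (mult_left doth)) \<and>
        poisson_bialgebra s br m \<delta> \<Delta> \<and>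
        poisson_matched_pair s UNIV fun_scale (dual_space s) br m (dual_operation \<delta>) dot
          (\<lambda>x u. - dual_rep (ad br) x u) (dual_rep (mult_right m))
          (\<lambda>u x. - predual_rep s (ad (dual_operation \<delta>)) u x) (predual_rep s (mult_right dot)) \<and>
        matched_pair_qcl s UNIV fun_scale (dual_space s) mh doth
          (dual_rep_h s (mult_right mh)) (dual_rep_h s (mult_left mh))
          (predual_rep_h s (mult_right doth)) (predual_rep_h s (mult_left doth))
          br m (dual_operation \<delta>) dot
          (\<lambda>x u. - dual_rep (ad br) x u) (dual_rep (mult_right m))
          (\<lambda>u x. - predual_rep s (ad (dual_operation \<delta>)) u x) (predual_rep s (mult_right dot)))
     \<and>
     (\<forall>br dbr \<rho>br \<rho>dbr.
        comm_matched_pair s UNIV fun_scale (dual_space s) m dot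
          (dual_rep (mult_right m)) (predual_rep s (mult_right dot)) \<and>
        matched_pair_deformation s UNIV fun_scale (dual_space s) m dot
          (dual_rep (mult_right m)) (dual_rep (mult_right m))
          (predual_rep s (mult_right dot)) (predual_rep s (mult_right dot))
          mh doth
          (dual_rep_h s (mult_right mh)) (dual_rep_h s (mult_left mh))
          (predual_rep_h s (mult_right doth)) (predual_rep_h s (mult_left doth)) \<and>
        matched_pair_qcl s UNIV fun_scale (dual_space s) mh doth
          (dual_rep_h s (mult_right mh)) (dual_rep_h s (mult_left mh))
          (predual_rep_h s (mult_right doth)) (predual_rep_h s (mult_left doth))
          br m dbr dot
          \<rho>br (dual_rep (mult_right m)) \<rho>dbr (predual_rep s (mult_right dot)) \<longrightarrow>
        cc_asi_bialgebra s m \<Delta> \<and>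
        asi_deformation s m \<Delta> mh \<Delta>h \<and>
        (\<forall>x. \<forall>u\<in>dual_space s.
           \<rho>br x u = - dual_rep (ad br) x u \<and> \<rho>dbr u x = - predual_rep s (ad dbr) u x) \<and>
        poisson_matched_pair s UNIV fun_scale (dual_space s) br m dbr dot
          (\<lambda>x u. - dual_rep (ad br) x u) (dual_rep (mult_right m))
          (\<lambda>u x. - predual_rep s (ad dbr) u x) (predual_rep s (mult_right dot)) \<and>
        (\<exists>!\<delta>. comultiplication s \<delta> \<and>
           (\<forall>a\<in>dual_space s. \<forall>b\<in>dual_space s. dual_operation \<delta> a b = dbr a b)) \<and>
        (\<forall>\<delta>. comultiplication s \<delta> \<and>
           (\<forall>a\<in>dual_space s. \<forall>b\<in>dual_space s. dual_operation \<delta> a b = dbr a b) \<longrightarrow>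
           poisson_bialgebra s br m \<delta> \<Delta> \<and> asi_qcl s mh \<Delta>h br m \<delta> \<Delta>))"
proof -
  interpret finite_dimensional_vector_space s basis by fact
  interpret bialgebra_data s basis m \<Delta> mh \<Delta>h
    using assms by unfold_locales simp_all
  note cc_iff = cc_asi_bialgebra_iff[OF m \<Delta>]
  show ?thesis
    unfolding dot doth
  proof (intro conjI allI impI; elim conjE)
    fix br \<delta>
    assume cc: "cc_asi_bialgebra s m \<Delta>" and def: "asi_deformation s m \<Delta> mh \<Delta>h"
      and q: "asi_qcl s mh \<Delta>h br m \<delta> \<Delta>"
    note \<delta> = cobracket_of_asi_qcl[OF cc q]
    interpret deformed_double s basis m \<Delta> mh \<Delta>h br "dual_operation \<delta>"
      using cc[unfolded cc_iff] def q \<delta>(2) by unfold_locales (simp_all add: asi_qcl_def)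
    show "comm_matched_pair s UNIV fun_scale dual m (dual_operation \<Delta>) RA RB" by (rule comm)
    show "matched_pair_deformation s UNIV fun_scale dual m (dual_operation \<Delta>) RA RA RB RB mh (dual_operation_h s \<Delta>h) lAh rAh lBh rBh"
      by (rule matched_def)
    show "poisson_bialgebra s br m \<delta> \<Delta>" by (rule bialgebra_qcl(1)[OF \<delta>(1)]) simp
    show "poisson_matched_pair s UNIV fun_scale dual br m (dual_operation \<delta>) (dual_operation \<Delta>)
        (adA br) RA (adB (dual_operation \<delta>)) RB"
      by (rule poisson_matched)
    show "matched_pair_qcl s UNIV fun_scale dual mh (dual_operation_h s \<Delta>h) lAh rAh lBh rBh
        br m (dual_operation \<delta>) (dual_operation \<Delta>) (adA br) RA (adB (dual_operation \<delta>)) RB"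
      by (rule matched_qcl)
  next
    fix br dbr \<rho>br \<rho>dbr
    assume comm: "comm_matched_pair s UNIV fun_scale dual m (dual_operation \<Delta>) RA RB"
      and md: "matched_pair_deformation s UNIV fun_scale dual m (dual_operation \<Delta>) RA RA RB RB mh (dual_operation_h s \<Delta>h) lAh rAh lBh rBh"
      and q: "matched_pair_qcl s UNIV fun_scale dual mh (dual_operation_h s \<Delta>h) lAh rAh lBh rBh
        br m dbr (dual_operation \<Delta>) \<rho>br RA \<rho>dbr RB"
    interpret deformed_double s basis m \<Delta> mh \<Delta>h br dbr
      using comm md q asi_deformation_iff[OF comm]
      by unfold_locales (simp_all add: matched_pair_qcl_def assoc_qcl_def)
    show "cc_asi_bialgebra s m \<Delta>" by (rule cc)
    show "asi_deformation s m \<Delta> mh \<Delta>h" by (rule def)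
    show "\<forall>u\<in>dual. \<rho>br x u = adA br x u \<and> \<rho>dbr u x = adB dbr u x" for x
      using q action_A_quot action_B_quot
      by (auto simp: matched_pair_qcl_def quot_cong_h_iff[OF F.subA] quot_cong_h_iff[OF F.subB])
    show "poisson_matched_pair s UNIV fun_scale dual br m dbr (dual_operation \<Delta>) (adA br) RA (adB dbr) RB"
      by (rule poisson_matched)
    show "\<exists>!\<delta>. comultiplication s \<delta> \<and> (\<forall>a\<in>dual. \<forall>b\<in>dual. dual_operation \<delta> a b = dbr a b)"
      by (rule comultiplication_of_dual_operation[OF dbr_bilinear])
    show "poisson_bialgebra s br m \<delta> \<Delta>" "asi_qcl s mh \<Delta>h br m \<delta> \<Delta>"
      if "comultiplication s \<delta>" "\<forall>a\<in>dual. \<forall>b\<in>dual. dual_operation \<delta> a b = dbr a b" for \<delta>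
      using bialgebra_qcl[OF that] .
  qed
qed

end
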